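(* Let $n\ge2$, $p>1$, and let $K\in\mathcal{K}_e^n$ be of class $C_+^2$. Let $u\in\mathbb{S}^{n-1}$ and let $\{K_t\}_{t\in[-1,1]}$ be the linear reflection shadow system of $K$ in the direction $u$. If $$\left.\frac{d}{dt}\mathrm{Vol}_n(\Pi_p^{\ast}K_t)\right|_{t=1^-}=0,$$ then $\mathrm{Vol}_n(\Pi_p^{\ast}K_t)$ is constant for $t\in[-1,1]$.
   Context: $\mathcal{K}_e^n$ is the set of origin-symmetric convex bodies (compact convex sets with nonempty interior) in $\mathbb{R}^n$; a convex body is of class $C_+^2$ if its boundary is $C^2$ with positive curvature everywhere. $h_K$ is the support function and $S(K,\cdot)$ the surface area measure. With $\omega_r=\pi^{r/2}/\Gamma(1+r/2)$ and $c_{n,p}=\omega_{n+p}/(\omega_2\omega_n\omega_{p-1})$, the $L_p$-projection body $\Pi_pK$ of a convex body $K$ with the origin in its interior has support function $h_{\Pi_pK}(v)=\left(\frac{1}{n\omega_nc_{n-2,p}}\int_{\mathbb{S}^{n-1}}|\langle v,\theta\rangle|^p h_K(\theta)^{1-p}\,dS(K,\theta)\right)^{1/p}$, and $\Pi_p^{\ast}K=(\Pi_pK)^{\ast}$ is its polar body. Linear reflection shadow system: let $K_u'$ be the orthogonal projection of $K$ onto $u^{\perp}$ and write $K=\{x'+su: x'\in K_u',\ g(x')\le s\le f(x')\}$ with $f$ concave and $g$ convex on $K_u'$. Then $K_t=\{x'+su: x'\in K_u',\ g_t(x')\le s\le f_t(x')\}$ with $f_t=\frac t2(f+g)+\frac12(f-g)$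 and $g_t=\frac t2(f+g)-\frac12(f-g)$. The derivative at $t=1^-$ is the one-sided limit $\lim_{t\to1^-}\frac{\mathrm{Vol}_n(\Pi_p^{\ast}K_t)-\mathrm{Vol}_n(\Pi_p^{\ast}K)}{t-1}$. *)

theory Defs
  imports "HOL-Analysis.Analysis"
begin

section \<open>Convex bodies\<close>

definition convex_body :: "'a::euclidean_space set \<Rightarrow> bool" where
  "convex_body K \<longleftrightarrow> compact K \<and> convex K \<and> interior K \<noteq> {}"

definition origin_symmetric :: "'a::euclidean_space set \<Rightarrow> bool" where
  "origin_symmetric K \<longleftrightarrow> uminus ` K = K"

definition support_fun :: "'a::euclidean_space set \<Rightarrow> 'a \<Rightarrow> real" where
  "support_fun K v = (SUP x\<in>K. x \<bullet> v)"

definition polar_body :: "'a::euclidean_space set \<Rightarrow> 'a set" where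
  "polar_body K = {y. \<forall>x\<in>K. x \<bullet> y \<le> 1}"

section \<open>Hausdorff measure\<close>

text \<open>
  The \<open>k\<close>-dimensional Hausdorff measure, normalised to agree with Lebesgue measure
  on \<open>k\<close>-dimensional affine subspaces. The empty set is treated separately because
  \<open>0 ^ 0 = 1\<close>, and boundedness is required because \<^const>\<open>diameter\<close> is real-valued.
\<close>

definition hausdorff_pre :: "nat \<Rightarrow> real \<Rightarrow> 'a::euclidean_space set \<Rightarrow> ennreal" where
  "hausdorff_pre k \<delta> A =
     (INF U \<in> {U :: nat \<Rightarrow> 'a set. A \<subseteq> (\<Union>i. U i) \<and> (\<forall>i. bounded (U i) \<and> diameter (U i) \<le> \<delta>)}.
        \<Sum>i. if U i = {} then 0
            else ennreal (unit_ball_vol (real k) * (diameter (U i) / 2) ^ k))"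

definition hausdorff_outer :: "nat \<Rightarrow> 'a::euclidean_space set \<Rightarrow> ennreal" where
  "hausdorff_outer k A = (SUP \<delta>\<in>{0<..}. hausdorff_pre k \<delta> A)"

definition hausdorff_measure :: "nat \<Rightarrow> 'a::euclidean_space measure" where
  "hausdorff_measure k = measure_of UNIV (sets borel) (hausdorff_outer k)"

section \<open>Gauss map, surface area measure, curvature\<close>

definition outer_unit_normal :: "'a::euclidean_space set \<Rightarrow> 'a \<Rightarrow> 'a \<Rightarrow> bool" where
  "outer_unit_normal K x \<theta> \<longleftrightarrow> x \<in> K \<and> norm \<theta> = 1 \<and> (\<forall>y\<in>K. y \<bullet> \<theta> \<le> x \<bullet> \<theta>)"

definition regular_boundary :: "'a::euclidean_space set \<Rightarrow> 'a set" where
  "regular_boundary K = {x \<in> frontier K. \<exists>!\<theta>. outer_unit_normal K x \<theta>}"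

definition gauss_map :: "'a::euclidean_space set \<Rightarrow> 'a \<Rightarrow> 'a" where
  "gauss_map K x = (THE \<theta>. outer_unit_normal K x \<theta>)"

text \<open>
  \<open>S(K, E)\<close> is the \<open>(n-1)\<close>-dimensional Hausdorff measure of the set of regular boundary points
  with outer unit normal in \<open>E\<close>; the non-regular boundary points of a convex body form a null set.
\<close>

definition surface_area_measure :: "'a::euclidean_space set \<Rightarrow> 'a measure" where
  "surface_area_measure K =
     distr (restrict_space (hausdorff_measure (DIM('a) - 1)) (regular_boundary K))
           (restrict_space borel (sphere 0 1)) (gauss_map K)"

text \<open>
  \<open>G\<close> and \<open>H\<close> below are the gradient and the Hessian of the local defining function \<open>F\<close>.
\<close>

definition C2_boundary :: "'a::euclidean_space set \<Rightarrow> bool" where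
  "C2_boundary K \<longleftrightarrow>
     (\<forall>x\<in>frontier K. \<exists>U (F :: 'a \<Rightarrow> real) (G :: 'a \<Rightarrow> 'a) (H :: 'a \<Rightarrow> 'a \<Rightarrow> 'a).
        open U \<and> x \<in> U \<and>
        (\<forall>y\<in>U. GDERIV F y :> G y) \<and>
        (\<forall>y\<in>U. (G has_derivative H y) (at y)) \<and>
        (\<forall>v. continuous_on U (\<lambda>y. H y v)) \<and>
        (\<forall>y\<in>U. G y \<noteq> 0) \<and>
        K \<inter> U = {y\<in>U. F y \<le> 0})"

text \<open>
  The Gauss curvature is the determinant of the derivative of the Gauss map, as an
  endomorphism of the tangent space \<open>\<nu>\<^sup>\<bottom>\<close>. It is computed as the determinant of the endomorphism of
  the whole space that agrees with this derivative on \<open>\<nu>\<^sup>\<bottom>\<close> and fixes \<open>\<nu>\<close>. The derivative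
  \<open>W\<close> within the boundary is determined by the Gauss map on tangent vectors only, and only its
  values there enter.
\<close>

definition has_gauss_curvature :: "(real^'n) set \<Rightarrow> real^'n \<Rightarrow> real \<Rightarrow> bool" where
  "has_gauss_curvature K x \<kappa> \<longleftrightarrow>
     (\<exists>W. (gauss_map K has_derivative W) (at x within frontier K) \<and>
          \<kappa> = (let \<nu> = gauss_map K x in
                 det (matrix (\<lambda>v. W (v - (v \<bullet> \<nu>) *\<^sub>R \<nu>) + (v \<bullet> \<nu>) *\<^sub>R \<nu>))))"

definition class_C2_plus :: "(real^'n) set \<Rightarrow> bool" where
  "class_C2_plus K \<longleftrightarrow>
     C2_boundary K \<and> (\<forall>x\<in>frontier K. \<exists>\<kappa>>0. has_gauss_curvature K x \<kappa>)"

section \<open>\<open>L\<^sub>p\<close>-projection bodies\<close>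

text \<open>
  \<^const>\<open>unit_ball_vol\<close> is \<open>\<omega>\<^sub>r = \<pi>\<^bsup>r/2\<^esup> / \<Gamma>(1 + r/2)\<close> for real \<open>r\<close>.
\<close>

definition lp_const :: "real \<Rightarrow> real \<Rightarrow> real" where
  "lp_const r p = unit_ball_vol (r + p) / (unit_ball_vol 2 * unit_ball_vol r * unit_ball_vol (p - 1))"

definition lp_projection_support :: "real \<Rightarrow> 'a::euclidean_space set \<Rightarrow> 'a \<Rightarrow> real" where
  "lp_projection_support p K v =
     (let n = real DIM('a) in
       (1 / (n * unit_ball_vol n * lp_const (n - 2) p) *
        (LINT \<theta>|surface_area_measure K.
           \<bar>v \<bullet> \<theta>\<bar> powr p * support_fun K \<theta> powr (1 - p))) powr (1 / p))"

definition lp_projection_body :: "real \<Rightarrow> 'a::euclidean_space set \<Rightarrow> 'a set" where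
  "lp_projection_body p K =
     (THE L. convex_body L \<and> (\<forall>v. support_fun L v = lp_projection_support p K v))"

section \<open>Linear reflection shadow systems\<close>

definition proj_perp :: "'a::euclidean_space \<Rightarrow> 'a set \<Rightarrow> 'a set" where
  "proj_perp u K = (\<lambda>x. x - (x \<bullet> u) *\<^sub>R u) ` K"

definition upper_graph :: "'a::euclidean_space \<Rightarrow> 'a set \<Rightarrow> 'a \<Rightarrow> real" where
  "upper_graph u K x = Sup {s. x + s *\<^sub>R u \<in> K}"

definition lower_graph :: "'a::euclidean_space \<Rightarrow> 'a set \<Rightarrow> 'a \<Rightarrow> real" where
  "lower_graph u K x = Inf {s. x + s *\<^sub>R u \<in> K}"

definition reflection_shadow :: "'a::euclidean_space \<Rightarrow> 'a set \<Rightarrow> real \<Rightarrow> 'a set" where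
  "reflection_shadow u K t =
     {x + s *\<^sub>R u | x s. x \<in> proj_perp u K \<and>
        t / 2 * (upper_graph u K x + lower_graph u K x)
          - 1 / 2 * (upper_graph u K x - lower_graph u K x) \<le> s \<and>
        s \<le> t / 2 * (upper_graph u K x + lower_graph u K x)
          + 1 / 2 * (upper_graph u K x - lower_graph u K x)}"

end

theory Submission
  imports Defs
begin

text \<open>
  Write the body \<open>K\<^sub>t\<close> over the hyperplane orthogonal to \<open>u\<close> as the region between the graphs of the
  concave functions \<open>F\<^sub>t\<close> and of \<open>- F\<^bsub>-t\<^esub>\<close>, where \<open>F\<^sub>t\<close> is affine in \<open>t\<close>. By the area formula, the
  \<open>p\<close>-th power of the support function of \<open>\<Pi>\<^sub>p K\<^sub>t\<close> is the sum of two integrals of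
  \<open>|v \<bullet> (u - \<nabla>F)|\<^sup>p (F - x \<bullet> \<nabla>F)\<^sup>1\<^sup>-\<^sup>p\<close>. The perspective \<open>|a|\<^sup>p b\<^sup>1\<^sup>-\<^sup>p\<close> is jointly convex, so the fibres parallel to \<open>u\<close>
  of the polar body have lengths that are even and concave in \<open>t\<close> as long as they are nonempty.
  A vanishing derivative at \<open>t = 1\<close> therefore forces these lengths at \<open>t = 0\<close> and \<open>t = 1\<close> to agree over
  the projection of the polar body of \<open>\<Pi>\<^sub>p K\<close>; strict convexity for \<open>p > 1\<close> excludes that the projection is larger
  at \<open>t = 0\<close>. Hence the volumes at \<open>0\<close> and \<open>1\<close> agree, and all volumes lie between them.

  Neither the dimension \<open>n - 1\<close> nor the normalisation of Hausdorff measure appears explicitly: Lebesgue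
  measure on the hyperplane is the push-forward of Lebesgue measure on a slab of width 1, and
  Hausdorff measure on hyperplanes is an unspecified constant multiple of it. If this constant
  were 0, all surface area measures would vanish and there would be nothing to prove.
\<close>

section \<open>Hausdorff measure\<close>

text \<open>The class C^2_+ enters through two consequences: every boundary point of
  \<open>K\<close> has exactly one normal, and the boundary contains no segment. The first makes the
  gradients of the graph functions continuous on the open shadow; the second makes the upper and the
  lower graph meet over the rim of the shadow, so that no \<open>K_t\<close> has a vertical side.
  Both facts pass to \<open>K_t\<close>, whose graph functions are combinations of those of
  \<open>K\<close>. That is why surface area is computed for bodies bounded by graphs with
  continuous supergradients, and why the area formula is obtained by comparing such graphs with
  their tangent hyperplanes.

  The delicate case at the end is a line that meets the polar body at \<open>t = 0\<close> but not
  at \<open>t = 1\<close>. Concavity of the length holds between nonempty fibres only, so the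
  derivative at 1 says nothing about such a line. The information comes from the boundary of the
  projection at \<open>t = 1\<close>: there the fibre at 1 shrinks to a point while the fibre at 0
  would still be long, which contradicts the equality of lengths on nearby lines inside the
  projection.\<close>

definition hausdorff_gauge :: "nat \<Rightarrow> 'a::euclidean_space set \<Rightarrow> ennreal" where
  "hausdorff_gauge k U =
     (if U = {} then 0 else ennreal (unit_ball_vol (real k) * (diameter U / 2) ^ k))"

definition delta_cover :: "real \<Rightarrow> 'a::euclidean_space set \<Rightarrow> (nat \<Rightarrow> 'a set) \<Rightarrow> bool" where
  "delta_cover \<delta> A U \<longleftrightarrow> A \<subseteq> (\<Union>i. U i) \<and> (\<forall>i. bounded (U i) \<and> diameter (U i) \<le> \<delta>)"

lemma hausdorff_pre_eq:
  "hausdorff_pre k \<delta> A = (INF U \<in> {U. delta_cover \<delta> A U}. \<Sum>i. hausdorff_gauge k (U i))"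
  by (simp add: hausdorff_pre_def delta_cover_def hausdorff_gauge_def)

lemma hausdorff_pre_le:
  "delta_cover \<delta> A U \<Longrightarrow> hausdorff_pre k \<delta> A \<le> (\<Sum>i. hausdorff_gauge k (U i))"
  by (auto simp: hausdorff_pre_eq intro: INF_lower)

lemma hausdorff_pre_close:
  assumes "hausdorff_pre k \<delta> A < e"
  obtains U where "delta_cover \<delta> A U" "(\<Sum>i. hausdorff_gauge k (U i)) < e"
  using assms by (auto simp: hausdorff_pre_eq INF_less_iff)

lemma hausdorff_pre_mono: "A \<subseteq> B \<Longrightarrow> hausdorff_pre k \<delta> A \<le> hausdorff_pre k \<delta> B"
  by (auto simp: hausdorff_pre_eq delta_cover_def intro!: INF_superset_mono)

lemma hausdorff_pre_antimono: "\<delta> \<le> \<epsilon> \<Longrightarrow> hausdorff_pre k \<epsilon> A \<le> hausdorff_pre k \<delta> A"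
  unfolding hausdorff_pre_eq delta_cover_def by (rule INF_superset_mono) (auto intro: order_trans)

lemma hausdorff_pre_le_outer: "0 < \<delta> \<Longrightarrow> hausdorff_pre k \<delta> A \<le> hausdorff_outer k A"
  by (auto simp: hausdorff_outer_def intro: SUP_upper)

lemma hausdorff_outer_mono: "A \<subseteq> B \<Longrightarrow> hausdorff_outer k A \<le> hausdorff_outer k B"
  by (auto simp: hausdorff_outer_def intro!: SUP_mono hausdorff_pre_mono)

lemma hausdorff_outer_empty [simp]: "hausdorff_outer k {} = 0"
proof -
  have *: "hausdorff_pre k \<delta> ({}::'a set) = 0" if "\<delta> > 0" for \<delta>
  proof -
    have "delta_cover \<delta> ({}::'a set) (\<lambda>_. {})" using that by (auto simp: delta_cover_def)
    from hausdorff_pre_le[OF this, of k] show "hausdorff_pre k \<delta> ({}::'a set) = 0" by (simp add: hausdorff_gauge_def)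
  qed
  show ?thesis unfolding hausdorff_outer_def by (auto simp: * intro!: antisym SUP_least)
qed

text \<open>Near-optimal covers of the sets \<open>A n\<close>, with errors summing to
  \<open>e\<close>, are merged into a single sequence by enumerating pairs of naturals.\<close>

lemma hausdorff_pre_countable_subadditive:
  "hausdorff_pre k \<delta> (\<Union>i. A i) \<le> (\<Sum>i. hausdorff_pre k \<delta> (A i))"
proof (rule ennreal_le_epsilon)
  fix e :: real assume e: "0 < e" and fin: "(\<Sum>i. hausdorff_pre k \<delta> (A i)) < top"
  then have *: "\<And>n. hausdorff_pre k \<delta> (A n) < hausdorff_pre k \<delta> (A n) + e * (1/2)^Suc n"
    by (auto simp add: less_top dest!: ennreal_suminf_lessD)
  have "\<exists>U. delta_cover \<delta> (A n) U \<and> (\<Sum>i. hausdorff_gauge k (U i)) \<le> hausdorff_pre k \<delta> (A n) + e * (1/2)^Suc n" for n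
    by (metis hausdorff_pre_close[OF *] less_imp_le)
  then obtain B where B: "\<And>n. delta_cover \<delta> (A n) (B n)"
    and Ble: "\<And>n. (\<Sum>i. hausdorff_gauge k (B n i)) \<le> hausdorff_pre k \<delta> (A n) + e * (1/2)^Suc n"
    by metis
  define C where "C = case_prod B o prod_decode"
  have "\<exists>j. x \<in> C j" if x: "x \<in> A i" for x i
  proof -
    obtain m where "x \<in> B i m" using B[of i] x by (auto simp: delta_cover_def)
    then have "x \<in> C (prod_encode (i, m))" by (simp add: C_def)
    then show ?thesis by blast
  qed
  then have "delta_cover \<delta> (\<Union>i. A i) C"
    using B by (auto simp: delta_cover_def C_def split_def)
  then have "hausdorff_pre k \<delta> (\<Union>i. A i) \<le> (\<Sum>i. hausdorff_gauge k (C i))"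
    by (rule hausdorff_pre_le)
  also have "\<dots> = (\<Sum>n. \<Sum>i. hausdorff_gauge k (B n i))"
    using suminf_ennreal_2dimen[of "\<lambda>n. \<Sum>i. hausdorff_gauge k (B n i)" "\<lambda>(n,i). hausdorff_gauge k (B n i)"]
    by (simp add: C_def comp_def split_def)
  also have "\<dots> \<le> (\<Sum>n. hausdorff_pre k \<delta> (A n) + e * (1/2) ^ Suc n)"
    by (intro suminf_le allI Ble) auto
  also have "\<dots> = (\<Sum>n. hausdorff_pre k \<delta> (A n)) + (\<Sum>n. ennreal e * ennreal ((1/2) ^ Suc n))"
    using \<open>0 < e\<close> by (subst suminf_add[symmetric])
                     (auto simp del: ennreal_suminf_cmult simp add: ennreal_mult[symmetric])
  also have "\<dots> = (\<Sum>n. hausdorff_pre k \<delta> (A n)) + e"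
    unfolding ennreal_suminf_cmult
    by (subst suminf_ennreal_eq[OF zero_le_power power_half_series]) auto
  finally show "hausdorff_pre k \<delta> (\<Union>i. A i) \<le> (\<Sum>n. hausdorff_pre k \<delta> (A n)) + e" .
qed

lemma hausdorff_outer_countable_subadditive:
  "hausdorff_outer k (\<Union>i. A i) \<le> (\<Sum>i. hausdorff_outer k (A i))"
  unfolding hausdorff_outer_def[of k "\<Union>i. A i"]
proof (rule SUP_least)
  fix \<delta> :: real assume "\<delta> \<in> {0<..}"
  then have "(\<Sum>i. hausdorff_pre k \<delta> (A i)) \<le> (\<Sum>i. hausdorff_outer k (A i))"
    by (intro suminf_le hausdorff_pre_le_outer) auto
  then show "hausdorff_pre k \<delta> (\<Union>i. A i) \<le> (\<Sum>i. hausdorff_outer k (A i))"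
    using hausdorff_pre_countable_subadditive[of k \<delta> A] by (rule order_trans[rotated])
qed

lemma hausdorff_outer_subadditive:
  "hausdorff_outer k (A \<union> B) \<le> hausdorff_outer k A + hausdorff_outer k B"
proof -
  have "hausdorff_outer k (\<Union>i. binaryset A B i) \<le> (\<Sum>i. hausdorff_outer k (binaryset A B i))"
    by (rule hausdorff_outer_countable_subadditive)
  also have "(\<Sum>i. hausdorff_outer k (binaryset A B i)) = hausdorff_outer k A + hausdorff_outer k B"
    by (rule suminf_binaryset_eq) simp
  finally show ?thesis by (simp add: UN_binaryset_eq)
qed

text \<open>As soon as the mesh is smaller than \<open>d\<close>, no covering set meets both
  \<open>A\<close> and \<open>B\<close>, so a cover of the union splits into a cover of
  each.\<close>

lemma hausdorff_outer_separated:
  fixes A B :: "'a::euclidean_space set"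
  assumes d: "d > 0" and sep: "\<And>x y. x \<in> A \<Longrightarrow> y \<in> B \<Longrightarrow> d \<le> dist x y"
  shows "hausdorff_outer k A + hausdorff_outer k B \<le> hausdorff_outer k (A \<union> B)"
proof -
  \<comment> \<open>The two meshes are kept independent so that the suprema over them can be taken
    one after the other.\<close>
  have main: "hausdorff_pre k \<delta>\<^sub>1 A + hausdorff_pre k \<delta>\<^sub>2 B \<le> hausdorff_outer k (A \<union> B)"
    if "\<delta>\<^sub>1 > 0" "\<delta>\<^sub>2 > 0" for \<delta>\<^sub>1 \<delta>\<^sub>2
  proof -
    define \<delta> where "\<delta> = min (d/2) (min \<delta>\<^sub>1 \<delta>\<^sub>2)"
    have \<delta>: "\<delta> > 0" "\<delta> < d" "\<delta> \<le> \<delta>\<^sub>1" "\<delta> \<le> \<delta>\<^sub>2" using that d by (auto simp: \<delta>_def)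
    have "hausdorff_pre k \<delta> A + hausdorff_pre k \<delta> B \<le> hausdorff_pre k \<delta> (A \<union> B)"
      unfolding hausdorff_pre_eq[of k \<delta> "A \<union> B"]
    proof (rule INF_greatest)
      fix U assume "U \<in> {U. delta_cover \<delta> (A \<union> B) U}"
      then have U: "delta_cover \<delta> (A \<union> B) U" by simp
      define UA where "UA = (\<lambda>i. if U i \<inter> A = {} then {} else U i)"
      define UB where "UB = (\<lambda>i. if U i \<inter> B = {} then {} else U i)"
      have cA: "delta_cover \<delta> A UA" using U \<delta> by (force simp: delta_cover_def UA_def)
      have cB: "delta_cover \<delta> B UB" using U \<delta> by (force simp: delta_cover_def UB_def)
      have le: "hausdorff_gauge k (UA i) + hausdorff_gauge k (UB i) \<le> hausdorff_gauge k (U i)" for i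
      proof -
        have "U i \<inter> A = {} \<or> U i \<inter> B = {}"
        proof (rule ccontr)
          assume "\<not> ?thesis"
          then obtain x y where "x \<in> U i" "x \<in> A" "y \<in> U i" "y \<in> B" by blast
          then have "d \<le> diameter (U i)"
            using sep diameter_bounded_bound[of "U i" x y] U by (force simp: delta_cover_def)
          then show False using U \<delta> by (auto simp: delta_cover_def dest: spec[of _ i])
        qed
        then show ?thesis by (auto simp: UA_def UB_def hausdorff_gauge_def)
      qed
      have "hausdorff_pre k \<delta> A + hausdorff_pre k \<delta> B
          \<le> (\<Sum>i. hausdorff_gauge k (UA i)) + (\<Sum>i. hausdorff_gauge k (UB i))"
        by (intro add_mono hausdorff_pre_le cA cB)
      also have "\<dots> = (\<Sum>i. hausdorff_gauge k (UA i) + hausdorff_gauge k (UB i))"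
        by (rule suminf_add) auto
      also have "\<dots> \<le> (\<Sum>i. hausdorff_gauge k (U i))"
        by (intro suminf_le le) auto
      finally show "hausdorff_pre k \<delta> A + hausdorff_pre k \<delta> B \<le> (\<Sum>i. hausdorff_gauge k (U i))" .
    qed
    then show ?thesis
      using hausdorff_pre_antimono[OF \<delta>(3), of k A] hausdorff_pre_antimono[OF \<delta>(4), of k B]
        hausdorff_pre_le_outer[OF \<delta>(1), of k "A \<union> B"]
      by (meson add_mono order_trans)
  qed
  have "hausdorff_pre k \<delta>\<^sub>1 A + hausdorff_outer k B \<le> hausdorff_outer k (A \<union> B)" if "\<delta>\<^sub>1 > 0" for \<delta>\<^sub>1
    unfolding hausdorff_outer_def[of k B]
    by (subst ennreal_SUP_add_right) (auto intro!: SUP_least main that)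
  note this [intro]
  show ?thesis
    unfolding hausdorff_outer_def[of k A]
    by (subst ennreal_SUP_add_left[symmetric]) (auto intro!: SUP_least)
qed

text \<open>Caratheodory's argument for metric outer measures. The part \<open>D n\<close> of
  \<open>S\<close> at distance at least \<open>1 / Suc n\<close> from \<open>C\<close> is separated
  from \<open>S \<inter> C\<close>. What is missing from \<open>S - C\<close> consists of the thin
  layers \<open>R i\<close> around \<open>C\<close>, and the point is that their measures form a
  convergent series.\<close>

lemma hausdorff_outer_closed_caratheodory:
  fixes C S :: "'a::euclidean_space set"
  assumes C: "closed C"
  shows "hausdorff_outer k (S \<inter> C) + hausdorff_outer k (S - C) \<le> hausdorff_outer k S"
proof (cases "C = {} \<or> hausdorff_outer k S = top")
  case True
  then show ?thesis by auto
next
  case False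
  let ?H = "hausdorff_outer k"
  define D where "D n = {x\<in>S. 1 / Suc n \<le> infdist x C}" for n :: nat
  define R where "R n = {x\<in>S. 1 / Suc (Suc n) \<le> infdist x C \<and> infdist x C < 1 / Suc n}" for n :: nat
  have sepR: "1 / Suc (Suc i) - 1 / Suc (Suc (Suc i)) \<le> dist x y"
    if "x \<in> R i" "y \<in> R j" "i + 2 \<le> j" for i j x y
  proof -
    have "1 / real (Suc j) \<le> 1 / Suc (Suc (Suc i))" using that(3) by (intro divide_left_mono) auto
    then show ?thesis
      using that infdist_triangle[of x C y] unfolding R_def by auto
  qed
  \<comment> \<open>Neighbouring layers may touch, but layers two indices apart are separated by
    \<open>sepR\<close>. Hence the sum is bounded along even and along odd indices; \<open>e\<close>
    is the offset.\<close>
  have sums: "(\<Sum>i<N. ?H (R (2*i+e))) \<le> ?H (S \<inter> (\<Union>i<N. R (2*i+e)))" for e N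
  proof (induction N)
    case (Suc N)
    have sep: "?H (S \<inter> (\<Union>i<N. R (2*i+e))) + ?H (R (2*N+e))
        \<le> ?H ((S \<inter> (\<Union>i<N. R (2*i+e))) \<union> R (2*N+e))"
    proof (cases "N = 0")
      case False
      \<comment> \<open>The distance to the new layer is bounded by gaps that depend only on the
        finitely many earlier indices. For \<open>N = 0\<close> this would be the minimum of an
        empty set, hence the case distinction.\<close>
      define d where "d = Min ((\<lambda>i. 1 / real (Suc (Suc (2*i+e))) - 1 / Suc (Suc (Suc (2*i+e)))) ` {..<N})"
      have "d > 0" using False unfolding d_def by (subst Min_gr_iff) (auto simp del: of_nat_Suc intro!: divide_strict_left_mono)
      moreover have "d \<le> dist x y" if "x \<in> S \<inter> (\<Union>i<N. R (2*i+e))" "y \<in> R (2*N+e)" for x y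
      proof -
        obtain i where i: "i < N" "x \<in> R (2*i+e)" using \<open>x \<in> _\<close> by blast
        have "d \<le> 1 / real (Suc (Suc (2*i+e))) - 1 / Suc (Suc (Suc (2*i+e)))"
          unfolding d_def using i by (intro Min_le) auto
        also have "\<dots> \<le> dist x y" using i that by (intro sepR[of x "2*i+e" y "2*N+e"]) auto
        finally show ?thesis .
      qed
      ultimately show ?thesis by (rule hausdorff_outer_separated)
    qed simp
    have "(S \<inter> (\<Union>i<N. R (2*i+e))) \<union> R (2*N+e) = S \<inter> (\<Union>i<Suc N. R (2*i+e))"
      by (auto simp: R_def less_Suc_eq)
    with sep Suc.IH show ?case
      by simp (meson add_right_mono order_trans)
  qed simp
  have sums': "(\<Sum>i. ?H (R (2*i+e))) \<le> ?H S" for e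
    by (rule suminf_le_const) (auto intro!: order_trans[OF sums] hausdorff_outer_mono)
  have "(\<Sum>i. ?H (R i)) \<le> ?H S + ?H S"
  proof (rule suminf_le_const)
    fix N
    have "(\<Sum>i<N. ?H (R i)) \<le> (\<Sum>i<2*N. ?H (R i))" by (intro sum_mono2) auto
    also have "\<dots> = (\<Sum>i<N. ?H (R (2*i+0))) + (\<Sum>i<N. ?H (R (2*i+1)))"
      by (induction N) (auto simp: algebra_simps)
    also have "\<dots> \<le> ?H S + ?H S"
      by (intro add_mono order_trans[OF sum_le_suminf sums']) auto
    finally show "(\<Sum>i<N. ?H (R i)) \<le> ?H S + ?H S" .
  qed simp
  then have fin: "(\<Sum>i. ?H (R i)) \<noteq> top" using False by (auto simp: top_unique)
  define r where "r i = enn2real (?H (R i))" for i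
  have "?H (R i) \<noteq> top" for i
    using ennreal_suminf_lessD[of "\<lambda>i. ?H (R i)" top i] fin by (simp add: less_top)
  then have r: "?H (R i) = ennreal (r i)" for i by (simp add: r_def less_top)
  have r0: "0 \<le> r i" for i by (simp add: r_def)
  have sumr: "summable r" using fin r r0 by (intro summable_suminf_not_top) auto
  show ?thesis
  proof (rule ennreal_le_epsilon)
    fix e :: real assume e: "0 < e"
    obtain N where N: "norm (\<Sum>i. r (i + N)) < e" using suminf_exist_split[OF e sumr] by blast
    have tail: "(\<Sum>i. ?H (R (i + N))) \<le> ennreal e"
    proof -
      have "(\<Sum>i. ?H (R (i + N))) = ennreal (\<Sum>i. r (i + N))"
        unfolding r by (rule suminf_ennreal2) (use r0 sumr in \<open>auto simp: summable_iff_shift\<close>)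
      then show ?thesis using N by (auto intro!: ennreal_leI)
    qed
    have "S - C \<subseteq> D N \<union> (\<Union>i. R (i + N))"
    proof
      fix x assume x: "x \<in> S - C"
      then have pos: "infdist x C > 0"
        using C False in_closed_iff_infdist_zero[of C x] infdist_nonneg[of x C] by force
      show "x \<in> D N \<union> (\<Union>i. R (i + N))"
      proof (cases "x \<in> D N")
        case False
        \<comment> \<open>The layer containing \<open>x\<close> is found from the least
          \<open>m\<close> with \<open>1 / Suc m \<le> infdist x C\<close>. As \<open>x\<close> is
          not in \<open>D N\<close>, this \<open>m\<close> exceeds \<open>N\<close>, and the layer
          has index \<open>m - 1\<close>.\<close>
        define P where "P m \<longleftrightarrow> 1 / real (Suc m) \<le> infdist x C" for m
        have "\<exists>m. P m" unfolding P_def using reals_Archimedean[OF pos]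
          by (auto simp: inverse_eq_divide intro: less_imp_le)
        define m where "m = (LEAST m. P m)"
        have Pm: "P m" unfolding m_def by (rule LeastI_ex) fact
        have least: "\<not> P j" if "j < m" for j using that unfolding m_def by (rule not_less_Least)
        have "\<not> P N" using False x by (simp add: D_def P_def)
        have "N < m"
        proof (rule ccontr)
          assume "\<not> N < m"
          then have "1 / real (Suc N) \<le> 1 / real (Suc m)" by (intro divide_left_mono) auto
          then show False using Pm \<open>\<not> P N\<close> by (simp add: P_def)
        qed
        then obtain i where i: "m = Suc (i + N)" by (metis add.commute less_iff_Suc_add)
        then have "x \<in> R (i + N)" using Pm least[of "i+N"] x by (auto simp: R_def P_def)
        then show ?thesis by blast
      qed simp
    qed
    then have "?H (S - C) \<le> ?H (D N \<union> (\<Union>i. R (i + N)))" by (rule hausdorff_outer_mono)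
    also have "\<dots> \<le> ?H (D N) + ?H (\<Union>i. R (i + N))" by (rule hausdorff_outer_subadditive)
    also have "\<dots> \<le> ?H (D N) + ennreal e"
      using order_trans[OF hausdorff_outer_countable_subadditive tail] by (intro add_left_mono)
    finally have 1: "?H (S - C) \<le> ?H (D N) + ennreal e" .
    have "?H (S \<inter> C) + ?H (D N) \<le> ?H ((S \<inter> C) \<union> D N)"
    proof (rule hausdorff_outer_separated[where d = "1 / Suc N"])
      fix x y assume "x \<in> S \<inter> C" "y \<in> D N"
      then show "1 / real (Suc N) \<le> dist x y"
        using infdist_le[of x C y] by (auto simp: D_def dist_commute)
    qed simp
    also have "\<dots> \<le> ?H S" by (rule hausdorff_outer_mono) (auto simp: D_def)
    finally have 2: "?H (S \<inter> C) + ?H (D N) \<le> ?H S" .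
    have "?H (S \<inter> C) + ?H (S - C) \<le> (?H (S \<inter> C) + ?H (D N)) + ennreal e"
      using 1 by (simp add: add.assoc add_left_mono)
    also have "\<dots> \<le> ?H S + ennreal e" using 2 by (rule add_right_mono)
    finally show "?H (S \<inter> C) + ?H (S - C) \<le> ?H S + ennreal e" .
  qed
qed

section \<open>The Borel measure induced by the outer measure\<close>

lemma sets_hausdorff_measure [simp, measurable_cong]: "sets (hausdorff_measure k) = sets borel"
  by (metis hausdorff_measure_def sets.sigma_algebra_axioms sigma_algebra.sets_measure_of_eq space_borel)

lemma space_hausdorff_measure [simp]: "space (hausdorff_measure k) = UNIV"
  by (simp add: hausdorff_measure_def)

text \<open>\<open>measure_of\<close> returns the given set function only where that function is a
  measure. This is the case because closed sets, and therefore all Borel sets, lie in the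
  Caratheodory system of the outer measure.\<close>

lemma emeasure_hausdorff_measure:
  fixes A :: "'a::euclidean_space set"
  assumes "A \<in> sets borel"
  shows "emeasure (hausdorff_measure k) A = hausdorff_outer k A"
proof -
  let ?H = "hausdorff_outer k :: 'a set \<Rightarrow> ennreal"
  interpret P: sigma_algebra UNIV "Pow UNIV :: 'a set set" by (rule sigma_algebra_Pow)
  define L where "L = lambda_system UNIV (Pow UNIV) ?H"
  have ms: "measure_space UNIV L ?H" unfolding L_def
    by (rule P.caratheodory_lemma)
       (auto simp: outer_measure_space_def positive_def increasing_def countably_subadditive_def
             intro: hausdorff_outer_mono hausdorff_outer_countable_subadditive)
  have "closed C \<Longrightarrow> C \<in> L" for C
    unfolding L_def P.lambda_system_eq
    using hausdorff_outer_closed_caratheodory[of C k]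
      hausdorff_outer_subadditive[of k "S \<inter> C" "S - C" for S]
    by (auto simp: Int_Diff_Un intro!: antisym)
  then have "sigma_sets UNIV (Collect closed) \<subseteq> L"
    using ms by (intro sigma_algebra.sigma_sets_subset) (auto simp: measure_space_def)
  then have "sets borel \<subseteq> L"
    by (simp add: borel_eq_closed)
  then have "measure_space UNIV (sets borel) ?H"
    using measure_down[OF ms] sets.sigma_algebra_axioms[of borel] by simp
  then show ?thesis
    unfolding hausdorff_measure_def using assms
    by (intro emeasure_measure_of_sigma) (auto simp: measure_space_def sigma_algebra_def)
qed

text \<open>Two maps from a common parameter set are compared, so that a graph and its tangent
  hyperplane can each be bounded by the other without inverting a map.\<close>

lemma hausdorff_outer_lipschitz:
  fixes f :: "'c \<Rightarrow> 'a::euclidean_space" and g :: "'c \<Rightarrow> 'b::euclidean_space"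
  assumes c: "c > 0" and lip: "\<And>x y. x \<in> E \<Longrightarrow> y \<in> E \<Longrightarrow> dist (f x) (f y) \<le> c * dist (g x) (g y)"
  shows "hausdorff_outer k (f ` E) \<le> ennreal (c ^ k) * hausdorff_outer k (g ` E)"
proof -
  have pre: "hausdorff_pre k (c * \<delta>) (f ` E) \<le> ennreal (c ^ k) * hausdorff_pre k \<delta> (g ` E)" for \<delta>
  proof -
    have inv: "ennreal (c ^ k) * ennreal (inverse (c ^ k)) = 1"
      using c by (simp add: ennreal_mult[symmetric])
    \<comment> \<open>With the constant moved to the left, the right side is a bare infimum and can
      be treated cover by cover.\<close>
    have "ennreal (inverse (c ^ k)) * hausdorff_pre k (c * \<delta>) (f ` E) \<le> hausdorff_pre k \<delta> (g ` E)"
      unfolding hausdorff_pre_eq[of k \<delta>]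
    proof (rule INF_greatest)
      fix U assume "U \<in> {U. delta_cover \<delta> (g ` E) U}"
      then have U: "delta_cover \<delta> (g ` E) U" by simp
      define V where "V i = f ` {x\<in>E. g x \<in> U i}" for i
      have d: "dist y z \<le> c * diameter (U i)" if yz: "y \<in> V i" "z \<in> V i" for i y z
      proof -
        obtain a b where ab: "a \<in> E" "b \<in> E" "g a \<in> U i" "g b \<in> U i" "y = f a" "z = f b"
          using yz unfolding V_def by blast
        have "dist (g a) (g b) \<le> diameter (U i)"
          using U ab by (intro diameter_bounded_bound) (auto simp: delta_cover_def)
        then show ?thesis using lip[OF ab(1,2)] ab c by (simp add: order_trans mult_left_mono)
      qed
      have dU: "0 \<le> diameter (U i)" for i using U by (auto simp: delta_cover_def intro!: diameter_ge_0)
      have diam: "diameter (V i) \<le> c * diameter (U i)" for i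
        using d dU[of i] c by (intro diameter_le) (auto simp: dist_norm)
      have bdd: "bounded (V i)" for i using d[of _ i] by (auto simp: bounded_two_points)
      have "delta_cover (c * \<delta>) (f ` E) V"
        unfolding delta_cover_def
      proof (intro conjI allI)
        show "f ` E \<subseteq> (\<Union>i. V i)" using U by (fastforce simp: delta_cover_def V_def)
        show "diameter (V i) \<le> c * \<delta>" for i
          using U c by (intro order_trans[OF diam]) (auto simp: delta_cover_def)
      qed (rule bdd)
      then have "hausdorff_pre k (c * \<delta>) (f ` E) \<le> (\<Sum>i. hausdorff_gauge k (V i))"
        by (rule hausdorff_pre_le)
      also have "\<dots> \<le> (\<Sum>i. ennreal (c ^ k) * hausdorff_gauge k (U i))"
      proof (intro suminf_le)
        fix i
        show "hausdorff_gauge k (V i) \<le> ennreal (c ^ k) * hausdorff_gauge k (U i)"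
        proof (cases "V i = {}")
          case False
          then have ne: "U i \<noteq> {}" by (auto simp: V_def)
          have V0: "0 \<le> diameter (V i)" by (rule diameter_ge_0[OF bdd])
          have "(diameter (V i) / 2) ^ k \<le> (c * diameter (U i) / 2) ^ k"
            using diam[of i] V0 by (intro power_mono) auto
          also have "\<dots> = c ^ k * (diameter (U i) / 2) ^ k"
            by (metis power_mult_distrib times_divide_eq_right)
          finally have "unit_ball_vol (real k) * (diameter (V i) / 2) ^ k
              \<le> unit_ball_vol (real k) * (c ^ k * (diameter (U i) / 2) ^ k)"
            by (intro mult_left_mono) auto
          then show ?thesis
            using False ne c dU[of i] unfolding hausdorff_gauge_def
            by (auto simp: ennreal_mult[symmetric] mult_ac intro!: ennreal_leI)
        qed (simp add: hausdorff_gauge_def)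
      qed auto
      also have "\<dots> = ennreal (c ^ k) * (\<Sum>i. hausdorff_gauge k (U i))" by simp
      finally have "ennreal (inverse (c ^ k)) * hausdorff_pre k (c * \<delta>) (f ` E)
          \<le> ennreal (inverse (c ^ k)) * (ennreal (c ^ k) * (\<Sum>i. hausdorff_gauge k (U i)))"
        by (rule mult_left_mono) simp
      then show "ennreal (inverse (c ^ k)) * hausdorff_pre k (c * \<delta>) (f ` E) \<le> (\<Sum>i. hausdorff_gauge k (U i))"
        using inv by (metis mult.assoc mult.commute mult_1)
    qed
    then have "ennreal (c ^ k) * (ennreal (inverse (c ^ k)) * hausdorff_pre k (c * \<delta>) (f ` E))
        \<le> ennreal (c ^ k) * hausdorff_pre k \<delta> (g ` E)"
      by (rule mult_left_mono) simp
    then show ?thesis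
      using inv by (metis mult.assoc mult_1)
  qed
  show ?thesis unfolding hausdorff_outer_def[of k "f ` E"]
  proof (rule SUP_least)
    fix \<delta> :: real assume "\<delta> \<in> {0<..}"
    then have "\<delta> / c > 0" using c by auto
    have "hausdorff_pre k \<delta> (f ` E) \<le> ennreal (c ^ k) * hausdorff_pre k (\<delta> / c) (g ` E)"
      using pre[of "\<delta> / c"] c by simp
    also have "\<dots> \<le> ennreal (c ^ k) * hausdorff_outer k (g ` E)"
      by (intro mult_left_mono hausdorff_pre_le_outer \<open>\<delta> / c > 0\<close>) auto
    finally show "hausdorff_pre k \<delta> (f ` E) \<le> ennreal (c ^ k) * hausdorff_outer k (g ` E)" .
  qed
qed

lemma hausdorff_outer_isometry:
  fixes f :: "'a::euclidean_space \<Rightarrow> 'b::euclidean_space"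
  assumes "\<And>x y. x \<in> E \<Longrightarrow> y \<in> E \<Longrightarrow> dist (f x) (f y) = dist x y"
  shows "hausdorff_outer k (f ` E) = hausdorff_outer k E"
  using hausdorff_outer_lipschitz[of 1 E f "\<lambda>x. x" k] hausdorff_outer_lipschitz[of 1 E "\<lambda>x. x" f k] assms
  by (intro antisym) auto

section \<open>Finiteness of the Hausdorff measure of convex boundaries\<close>

lemma open_sets_lebesgue: "open S \<Longrightarrow> S \<in> sets lebesgue"
  by (simp add: borel_open sets_completionI_sets)

text \<open>The bound \<open>N\<close> yields a separated set of largest cardinality; a point
  outside all of its balls could be added to it.\<close>

lemma finite_maximal_separated:
  fixes A :: "'a::metric_space set"
  assumes d: "d > 0"
    and bd: "\<And>S. S \<subseteq> A \<Longrightarrow> finite S \<Longrightarrow> (\<And>x y. x \<in> S \<Longrightarrow> y \<in> S \<Longrightarrow> x \<noteq> y \<Longrightarrow> d \<le> dist x y)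
      \<Longrightarrow> card S \<le> N"
  obtains S where "S \<subseteq> A" "finite S" "\<And>x y. x \<in> S \<Longrightarrow> y \<in> S \<Longrightarrow> x \<noteq> y \<Longrightarrow> d \<le> dist x y"
    "A \<subseteq> (\<Union>x\<in>S. ball x d)"
proof -
  define Q where "Q S \<longleftrightarrow> S \<subseteq> A \<and> finite S \<and> (\<forall>x\<in>S. \<forall>y\<in>S. x \<noteq> y \<longrightarrow> d \<le> dist x y)" for S
  have le: "card S < Suc N" if "Q S" for S
    using bd[of S] that unfolding Q_def by (simp add: less_Suc_eq_le)
  have "Q {}" by (simp add: Q_def)
  define S where "S = arg_max card Q"
  have QS: "Q S" and max: "\<And>T. Q T \<Longrightarrow> card T \<le> card S"
    using arg_max_nat_lemma[of Q "{}" card "Suc N"] le \<open>Q {}\<close> unfolding S_def by auto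
  show thesis
  proof
    show "A \<subseteq> (\<Union>x\<in>S. ball x d)"
    proof (rule ccontr)
      assume "\<not> ?thesis"
      then obtain z where z: "z \<in> A" "\<And>x. x \<in> S \<Longrightarrow> d \<le> dist x z" by (force simp: not_less)
      then have "z \<notin> S" using d by force
      have "Q (insert z S)" using z QS unfolding Q_def by (auto simp: dist_commute)
      then have "card (insert z S) \<le> card S" by (rule max)
      then show False using \<open>z \<notin> S\<close> QS by (simp add: Q_def)
    qed
  qed (use QS in \<open>auto simp: Q_def\<close>)
qed

text \<open>Bounded Minkowski content bounds Hausdorff measure. Balls of radius \<open>d/2\<close>
  about \<open>d\<close>-separated points of \<open>A\<close> are disjoint and fill a volume of at
  most \<open>M * d\<close>, so their number is at most a constant times the power
  \<open>1 - n\<close> of \<open>d\<close>. The balls of radius \<open>d\<close> about a maximal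
  family of such points cover \<open>A\<close>.\<close>

lemma hausdorff_outer_finite_of_nbhd:
  fixes A :: "'a::euclidean_space set"
  assumes A: "bounded A" and r: "r > 0" and M: "0 \<le> M"
    and nb: "\<And>\<delta>. 0 < \<delta> \<Longrightarrow> \<delta> < r \<Longrightarrow> measure lebesgue (\<Union>x\<in>A. ball x \<delta>) \<le> M * \<delta>"
  shows "hausdorff_outer (DIM('a) - 1) A < top"
proof -
  define n where "n = DIM('a)"
  have n: "n > 0" by (simp add: n_def)
  define w where "w = unit_ball_vol (real n)"
  have w: "w > 0" by (simp add: w_def)
  define C where "C = unit_ball_vol (real (n-1)) * (M * 2 ^ n / w)"
  have "hausdorff_pre (n-1) \<delta> A \<le> ennreal C" if \<delta>: "\<delta> > 0" for \<delta>
  proof -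
    \<comment> \<open>The covering balls have radius \<open>d\<close>, so it is the diameter
      \<open>2 * d\<close> that must not exceed \<delta>.\<close>
    define d where "d = min \<delta> r / 2"
    have d: "d > 0" "d < r" "2 * d \<le> \<delta>" using \<delta> r by (auto simp: d_def)
    have cardS: "real (card S) * (w * (d/2)^n) \<le> M * d"
      if S: "S \<subseteq> A" "finite S" "\<And>x y. x \<in> S \<Longrightarrow> y \<in> S \<Longrightarrow> x \<noteq> y \<Longrightarrow> d \<le> dist x y" for S
    proof -
      have "disjoint_family_on (\<lambda>x. ball x (d/2)) S"
        unfolding disjoint_family_on_def
      proof (intro ballI impI)
        fix x y assume xy: "x \<in> S" "y \<in> S" "x \<noteq> y"
        show "ball x (d/2) \<inter> ball y (d/2) = {}"
        proof (rule ccontr)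
          assume "\<not> ?thesis"
          then obtain z where "dist x z < d/2" "dist y z < d/2" by auto
          then show False using S(3)[OF xy] dist_triangle2[of x y z] by simp
        qed
      qed
      then have "measure lebesgue (\<Union>x\<in>S. ball x (d/2)) = (\<Sum>x\<in>S. measure lebesgue (ball x (d/2)))"
        using S(2) by (intro measure_finite_Union) (use emeasure_bounded_finite[OF bounded_ball] in \<open>auto simp: less_top[symmetric]\<close>)
      also have "\<dots> = real (card S) * (w * (d/2)^n)"
        using d by (simp add: content_ball w_def n_def)
      finally have "real (card S) * (w * (d/2)^n) = measure lebesgue (\<Union>x\<in>S. ball x (d/2))" ..
      also have "\<dots> \<le> measure lebesgue (\<Union>x\<in>A. ball x d)"
      proof (rule measure_mono_fmeasurable)
        show "(\<Union>x\<in>S. ball x (d/2)) \<in> sets lebesgue"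
          by (intro open_sets_lebesgue open_UN) auto
        show "(\<Union>x\<in>S. ball x (d/2)) \<subseteq> (\<Union>x\<in>A. ball x d)" using S(1) d by fastforce
        obtain B where B: "\<And>x. x \<in> A \<Longrightarrow> norm x \<le> B" using A by (auto simp: bounded_iff)
        have "norm y \<le> B + d" if "x \<in> A" "y \<in> ball x d" for x y
          using B[OF that(1)] that(2) norm_triangle_ineq2[of y x] by (auto simp: dist_norm norm_minus_commute)
        then have "bounded (\<Union>x\<in>A. ball x d)" unfolding bounded_iff by (intro exI[of _ "B + d"]) auto
        then show "(\<Union>x\<in>A. ball x d) \<in> lmeasurable" by (intro lmeasurable_open) auto
      qed
      also have "\<dots> \<le> M * d" using nb d by simp
      finally show ?thesis .
    qed
    obtain S where S: "S \<subseteq> A" "finite S" "\<And>x y. x \<in> S \<Longrightarrow> y \<in> S \<Longrightarrow> x \<noteq> y \<Longrightarrow> d \<le> dist x y"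
      and cov: "A \<subseteq> (\<Union>x\<in>S. ball x d)"
    proof (rule finite_maximal_separated[OF d(1), of A "nat \<lceil>M * d / (w * (d/2)^n)\<rceil>"])
      fix S assume S: "S \<subseteq> A" "finite S" "\<And>x y. x \<in> S \<Longrightarrow> y \<in> S \<Longrightarrow> x \<noteq> y \<Longrightarrow> d \<le> dist x y"
      have "real (card S) \<le> M * d / (w * (d/2)^n)"
        using cardS[OF S] w d by (simp add: field_simps)
      then show "card S \<le> nat \<lceil>M * d / (w * (d/2)^n)\<rceil>" by linarith
    qed blast
    obtain e where e: "bij_betw e {..<card S} S"
      using ex_bij_betw_nat_finite[OF S(2)] by (auto simp: atLeast0LessThan)
    define U where "U i = (if i < card S then ball (e i) d else {})" for i
    have "delta_cover \<delta> A U"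
      unfolding delta_cover_def
    proof (intro conjI allI)
      show "A \<subseteq> (\<Union>i. U i)"
      proof
        fix x assume "x \<in> A"
        then obtain y where y: "y \<in> S" "x \<in> ball y d" using cov by blast
        have "y \<in> e ` {..<card S}" using e y by (simp add: bij_betw_def)
        then obtain i where "i < card S" "e i = y" by (metis imageE lessThan_iff)
        then show "x \<in> (\<Union>i. U i)" using y by (auto simp: U_def intro!: exI[of _ i])
      qed
      show "bounded (U i)" for i by (simp add: U_def)
      show "diameter (U i) \<le> \<delta>" for i using d \<delta> by (simp add: U_def)
    qed
    then have "hausdorff_pre (n-1) \<delta> A \<le> (\<Sum>i. hausdorff_gauge (n-1) (U i))" by (rule hausdorff_pre_le)
    also have "\<dots> = (\<Sum>i<card S. hausdorff_gauge (n-1) (U i))"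
      by (rule suminf_finite) (auto simp: U_def hausdorff_gauge_def)
    also have "\<dots> = (\<Sum>i<card S. ennreal (unit_ball_vol (real (n-1)) * d ^ (n-1)))"
      using d by (intro sum.cong) (auto simp: U_def hausdorff_gauge_def)
    also have "\<dots> = ennreal (real (card S) * (unit_ball_vol (real (n-1)) * d ^ (n-1)))"
      using d by (simp add: ennreal_of_nat_eq_real_of_nat ennreal_mult[symmetric])
    also have "\<dots> \<le> ennreal C"
    proof (rule ennreal_leI)
      have "real (card S) * d ^ n \<le> (M * 2 ^ n / w) * d"
        using cardS[OF S] w by (simp add: field_simps power_divide)
      moreover have "d ^ n = d ^ (n-1) * d" using n by (metis power_minus_mult)
      ultimately have "real (card S) * d ^ (n-1) * d \<le> (M * 2 ^ n / w) * d"
        by (simp only: mult.assoc)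
      then have "real (card S) * d ^ (n-1) \<le> M * 2 ^ n / w"
        using d(1) by (rule mult_right_le_imp_le)
      then have "unit_ball_vol (real (n-1)) * (real (card S) * d ^ (n-1)) \<le> C"
        unfolding C_def by (rule mult_left_mono) simp
      then show "real (card S) * (unit_ball_vol (real (n-1)) * d ^ (n-1)) \<le> C" by (simp add: mult_ac)
    qed
    finally show ?thesis .
  qed
  then have "hausdorff_outer (n-1) A \<le> ennreal C"
    unfolding hausdorff_outer_def by (auto intro!: SUP_least)
  then show ?thesis by (auto simp: n_def less_top[symmetric] top_unique)
qed

text \<open>Only the first order in \<open>e\<close> matters: the volume of a shell of thickness
  \<delta> has to be at most a constant times \<delta>. The constant is crude.\<close>

lemma power_one_plus_minus_one_minus:
  fixes e :: real assumes "0 \<le> e" "e \<le> 1"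
  shows "(1 + e) ^ n - (1 - e) ^ n \<le> real n * 2 ^ n * e"
proof (induction n)
  case (Suc n)
  have "(1 + e) ^ Suc n - (1 - e) ^ Suc n = ((1 + e) ^ n - (1 - e) ^ n) + e * ((1 + e) ^ n + (1 - e) ^ n)"
    by (simp add: algebra_simps)
  also have "\<dots> \<le> real n * 2 ^ n * e + e * (2 ^ n + 1 ^ n)"
    by (rule add_mono[OF Suc.IH], intro mult_left_mono add_mono power_mono) (use assms in auto)
  also have "\<dots> \<le> real n * 2 ^ n * e + e * (2 ^ n + 2 ^ n)"
    using assms by (intro add_left_mono mult_left_mono) auto
  also have "\<dots> \<le> real (Suc n) * 2 ^ Suc n * e"
    using assms by (simp add: algebra_simps)
  finally show ?case .
qed simp

text \<open>With \<open>e = \<delta> / r\<close>, a point \<open>y\<close> near \<open>x\<close> is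
  \<open>x\<close> plus \<open>e\<close> times some \<open>z\<close> in the ball inside
  \<open>C\<close>, hence \<open>1 + e\<close> times a convex combination of \<open>x\<close> and
  \<open>z\<close>. If \<open>y\<close> were \<open>1 - e\<close> times a point \<open>c\<close> of
  \<open>C\<close>, then \<open>x\<close> would arise from \<open>c\<close> by shrinking towards the
  interior point \<open>- z\<close> and would be interior.\<close>

lemma nbhd_frontier_convex_subset:
  fixes C :: "'a::euclidean_space set"
  assumes C: "convex C" "closed C" and r: "r > 0" "ball 0 r \<subseteq> C" and \<delta>: "0 < \<delta>" "\<delta> < r"
  shows "(\<Union>x\<in>frontier C. ball x \<delta>) \<subseteq> (*\<^sub>R) (1 + \<delta> / r) ` C - (*\<^sub>R) (1 - \<delta> / r) ` C"
proof
  fix y assume "y \<in> (\<Union>x\<in>frontier C. ball x \<delta>)"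
  then obtain x where x: "x \<in> frontier C" "dist x y < \<delta>" by auto
  have xC: "x \<in> C" using x C frontier_subset_closed by blast
  define e where "e = \<delta> / r"
  have e: "0 < e" "e < 1" using \<delta> r by (auto simp: e_def)
  define z where "z = (1/e) *\<^sub>R (y - x)"
  have yx: "y = x + e *\<^sub>R z" using e by (simp add: z_def)
  have "norm z < r"
    using x(2) \<delta> r by (simp add: z_def dist_norm norm_minus_commute e_def divide_simps)
  then have zi: "z \<in> ball 0 r" "-z \<in> ball 0 r" by auto
  have "(1 / (1+e)) *\<^sub>R x + (e / (1+e)) *\<^sub>R z \<in> C"
    using e zi r by (intro convexD[OF C(1) xC]) (auto simp: add_divide_distrib[symmetric])
  moreover have "y = (1+e) *\<^sub>R ((1 / (1+e)) *\<^sub>R x + (e / (1+e)) *\<^sub>R z)"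
    using e by (simp add: yx scaleR_add_right)
  ultimately have 1: "y \<in> (*\<^sub>R) (1+e) ` C" by blast
  have "y \<notin> (*\<^sub>R) (1-e) ` C"
  proof
    assume "y \<in> (*\<^sub>R) (1-e) ` C"
    then obtain c where c: "c \<in> C" "y = (1-e) *\<^sub>R c" by blast
    have "-z \<in> interior C" using zi r interior_maximal[OF r(2) open_ball] by blast
    then have "c - e *\<^sub>R (c - (-z)) \<in> interior C"
      using e by (intro mem_interior_convex_shrink C c) auto
    also have "c - e *\<^sub>R (c - (-z)) = x" using yx c by (simp add: algebra_simps)
    finally show False using x by (simp add: frontier_def)
  qed
  with 1 show "y \<in> (*\<^sub>R) (1 + \<delta> / r) ` C - (*\<^sub>R) (1 - \<delta> / r) ` C" by (simp add: e_def)
qed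

text \<open>A neighbourhood of the boundary lies in the shell between two dilates of
  \<open>C\<close>, whose volume is known exactly from scaling.\<close>

lemma hausdorff_outer_frontier_convex_body_0:
  fixes C :: "'a::euclidean_space set"
  assumes C: "compact C" "convex C" "0 \<in> interior C"
  shows "hausdorff_outer (DIM('a) - 1) (frontier C) < top"
proof -
  obtain r where r: "r > 0" "ball 0 r \<subseteq> C" using C(3) by (auto simp: mem_interior)
  let ?n = "DIM('a)"
  show ?thesis
  proof (rule hausdorff_outer_finite_of_nbhd[OF _ r(1)])
    show "bounded (frontier C)"
      using C by (simp add: compact_frontier compact_imp_bounded)
    show "0 \<le> (real ?n * 2 ^ ?n * measure lebesgue C / r)" using r by simp
    fix \<delta> :: real assume \<delta>: "0 < \<delta>" "\<delta> < r"
    define e where "e = \<delta> / r"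
    have e: "0 < e" "e < 1" using \<delta> r by (auto simp: e_def)
    have m: "measure lebesgue ((*\<^sub>R) c ` C) = c ^ ?n * measure lebesgue C" if "c \<ge> 0" for c
      using measure_lebesgue_affine[of c 0 C] that by simp
    have L: "(*\<^sub>R) c ` C \<in> lmeasurable" for c
      using C by (intro lmeasurable_compact compact_scaling)
    have sub: "(*\<^sub>R) (1 - e) ` C \<subseteq> (*\<^sub>R) (1 + e) ` C"
    proof
      fix y assume "y \<in> (*\<^sub>R) (1 - e) ` C"
      then obtain c where c: "c \<in> C" "y = (1-e) *\<^sub>R c" by blast
      have "((1-e)/(1+e)) *\<^sub>R c + (1 - (1-e)/(1+e)) *\<^sub>R 0 \<in> C"
        using c e r by (intro convexD[OF C(2)]) (auto simp: divide_le_eq)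
      moreover have "y = (1+e) *\<^sub>R (((1-e)/(1+e)) *\<^sub>R c + (1 - (1-e)/(1+e)) *\<^sub>R 0)"
        using c e by simp
      ultimately show "y \<in> (*\<^sub>R) (1 + e) ` C" by blast
    qed
    have "measure lebesgue (\<Union>x\<in>frontier C. ball x \<delta>) \<le> measure lebesgue ((*\<^sub>R) (1 + e) ` C - (*\<^sub>R) (1 - e) ` C)"
    proof (rule measure_mono_fmeasurable)
      show "(\<Union>x\<in>frontier C. ball x \<delta>) \<in> sets lebesgue"
        by (intro open_sets_lebesgue open_UN) auto
      show "(*\<^sub>R) (1 + e) ` C - (*\<^sub>R) (1 - e) ` C \<in> lmeasurable" using L by (intro fmeasurable_Diff) auto
    qed (use nbhd_frontier_convex_subset[OF C(2) compact_imp_closed[OF C(1)] r \<delta>] in \<open>simp add: e_def\<close>)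
    also have "\<dots> = measure lebesgue ((*\<^sub>R) (1 + e) ` C) - measure lebesgue ((*\<^sub>R) (1 - e) ` C)"
      using sub L by (intro measurable_measure_Diff) (auto dest: fmeasurableD)
    also have "\<dots> = ((1+e) ^ ?n - (1-e) ^ ?n) * measure lebesgue C"
      using e m[of "1+e"] m[of "1-e"] by (simp only: left_diff_distrib)
    also have "\<dots> \<le> (real ?n * 2 ^ ?n * e) * measure lebesgue C"
      using e by (intro mult_right_mono power_one_plus_minus_one_minus) auto
    also have "\<dots> = real ?n * 2 ^ ?n * measure lebesgue C / r * \<delta>" by (simp add: e_def)
    finally show "measure lebesgue (\<Union>x\<in>frontier C. ball x \<delta>) \<le> real ?n * 2 ^ ?n * measure lebesgue C / r * \<delta>" .
  qed
qed

lemma hausdorff_outer_frontier_convex_body: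
  fixes C :: "'a::euclidean_space set"
  assumes C: "convex_body C"
  shows "hausdorff_outer (DIM('a) - 1) (frontier C) < top"
proof -
  obtain a where a: "a \<in> interior C" using C by (auto simp: convex_body_def)
  have "hausdorff_outer (DIM('a) - 1) (frontier C) = hausdorff_outer (DIM('a) - 1) ((+) (-a) ` frontier C)"
    by (rule hausdorff_outer_isometry[symmetric]) (simp add: dist_norm)
  also have "(+) (-a) ` frontier C = frontier ((+) (-a) ` C)" by (simp only: frontier_translation)
  also have "hausdorff_outer (DIM('a) - 1) \<dots> < top"
  proof (rule hausdorff_outer_frontier_convex_body_0)
    show "compact ((+) (-a) ` C)" "convex ((+) (-a) ` C)"
      using C by (simp_all only: convex_body_def compact_translation convex_translation)
    show "0 \<in> interior ((+) (-a) ` C)"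
      using a unfolding interior_translation by (intro image_eqI[of _ _ a]) simp_all
  qed
  finally show ?thesis .
qed

section \<open>Lebesgue measure on a hyperplane\<close>

definition perp_part :: "'a::euclidean_space \<Rightarrow> 'a \<Rightarrow> 'a" where
  "perp_part u x = x - (x \<bullet> u) *\<^sub>R u"

definition perp_lborel :: "'a::euclidean_space \<Rightarrow> 'a measure" where
  "perp_lborel u = distr (density lborel (indicator {x. \<bar>x \<bullet> u\<bar> \<le> 1/2})) borel (perp_part u)"

lemma sets_perp_lborel [simp, measurable_cong]: "sets (perp_lborel u) = sets borel"
  by (simp add: perp_lborel_def)

lemma space_perp_lborel [simp]: "space (perp_lborel u) = UNIV"
  by (simp add: perp_lborel_def)

lemma linear_perp_part: "linear (perp_part u)"
  unfolding perp_part_def by (auto intro!: linearI simp: inner_simps algebra_simps)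

lemma continuous_on_perp_part [continuous_intros]:
  "continuous_on S f \<Longrightarrow> continuous_on S (\<lambda>x. perp_part u (f x))"
  unfolding perp_part_def by (intro continuous_intros)

lemma perp_part_measurable [measurable]: "perp_part u \<in> borel_measurable borel"
  by (intro borel_measurable_continuous_onI continuous_intros)

lemma perp_part_add: "perp_part u (x + y) = perp_part u x + perp_part u y"
  by (simp add: linear_add linear_perp_part)

lemma perp_part_scale: "perp_part u (c *\<^sub>R x) = c *\<^sub>R perp_part u x"
  by (simp add: linear_scale linear_perp_part)

lemma perp_part_diff: "perp_part u (x - y) = perp_part u x - perp_part u y"
  by (simp add: linear_diff linear_perp_part)

lemma perp_part_minus: "perp_part u (- x) = - perp_part u x"
  by (rule linear_neg[OF linear_perp_part])

lemma perp_part_uminus_dir: "perp_part (- u) = perp_part u"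
  by (simp add: fun_eq_iff perp_part_def)

lemma perp_lborel_uminus_dir: "perp_lborel (- u) = perp_lborel u"
  by (simp add: perp_lborel_def perp_part_uminus_dir)

lemma perp_part_decomp: "perp_part u x + (x \<bullet> u) *\<^sub>R u = x"
  by (simp add: perp_part_def)

lemma perp_part_eq: "x \<bullet> u = 0 \<Longrightarrow> perp_part u x = x"
  by (simp add: perp_part_def)

context
  fixes u :: "'a::euclidean_space" assumes u: "norm u = 1"
begin

lemma unit_inner_self: "u \<bullet> u = 1"
  using u by (metis norm_eq_1)

lemma perp_part_dir: "perp_part u u = 0"
  unfolding perp_part_def unit_inner_self by simp

lemma perp_part_add_dir: "perp_part u (x + c *\<^sub>R u) = perp_part u x"
  by (simp add: perp_part_add perp_part_scale perp_part_dir)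

lemma inner_perp_part: "perp_part u x \<bullet> u = 0"
  by (simp add: perp_part_def inner_simps unit_inner_self)

lemma norm_perp_part: "(norm x)\<^sup>2 = (norm (perp_part u x))\<^sup>2 + (x \<bullet> u)\<^sup>2"
proof -
  have "norm (perp_part u x + (x \<bullet> u) *\<^sub>R u) ^ 2 = norm (perp_part u x) ^ 2 + norm ((x \<bullet> u) *\<^sub>R u) ^ 2"
    unfolding power2_norm_eq_inner
    by (simp only: inner_add_left inner_add_right inner_scaleR_left inner_scaleR_right
        inner_perp_part inner_commute[of u "perp_part u x"]) simp
  then show ?thesis unfolding perp_part_decomp norm_scaleR u by simp
qed

lemma norm_perp_part_le: "norm (perp_part u x) \<le> norm x"
proof (rule power2_le_imp_le)
  show "(norm (perp_part u x))\<^sup>2 \<le> (norm x)\<^sup>2" unfolding norm_perp_part[of x] by simp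
qed simp

lemma nn_integral_perp_lborel:
  assumes [measurable]: "F \<in> borel_measurable borel"
  shows "(\<integral>\<^sup>+x. F x \<partial>perp_lborel u)
    = (\<integral>\<^sup>+x. indicator {x. \<bar>x \<bullet> u\<bar> \<le> 1/2} x * F (perp_part u x) \<partial>lborel)"
  unfolding perp_lborel_def by (subst nn_integral_distr) (auto simp: nn_integral_density)

text \<open>Shifting the line parameter lets the line through \<open>perp_part u x\<close> start at
  \<open>x\<close> itself. After exchanging the integrals and translating by
  \<open>s *\<^sub>R u\<close>, each point is counted with the length of the set of those
  \<open>s\<close> that move it into the slab, and this length is 1.\<close>

lemma nn_integral_lborel_perp:
  assumes [measurable]: "F \<in> borel_measurable borel"
  shows "(\<integral>\<^sup>+x. F x \<partial>lborel) = (\<integral>\<^sup>+x. (\<integral>\<^sup>+s. F (x + s *\<^sub>R u) \<partial>lborel) \<partial>perp_lborel u)"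
proof -
  let ?I = "indicator {x. \<bar>x \<bullet> u\<bar> \<le> 1/2} :: 'a \<Rightarrow> ennreal"
  have "(\<integral>\<^sup>+x. (\<integral>\<^sup>+s. F (x + s *\<^sub>R u) \<partial>lborel) \<partial>perp_lborel u)
      = (\<integral>\<^sup>+x. ?I x * (\<integral>\<^sup>+s. F (perp_part u x + s *\<^sub>R u) \<partial>lborel) \<partial>lborel)"
    by (rule nn_integral_perp_lborel) measurable
  also have "\<dots> = (\<integral>\<^sup>+x. ?I x * (\<integral>\<^sup>+s. F (x + s *\<^sub>R u) \<partial>lborel) \<partial>lborel)"
  proof -
    have "(\<integral>\<^sup>+s. F (perp_part u x + s *\<^sub>R u) \<partial>lborel) = (\<integral>\<^sup>+s. F (x + s *\<^sub>R u) \<partial>lborel)" for x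
    proof -
      have eq: "perp_part u x + (x \<bullet> u + s) *\<^sub>R u = x + s *\<^sub>R u" for s
        by (simp add: perp_part_def algebra_simps)
      have "(\<lambda>s. F (perp_part u x + s *\<^sub>R u)) \<in> borel_measurable borel" by measurable
      from nn_integral_real_affine[OF this, of 1 "x \<bullet> u"] show ?thesis
        by (simp only: mult_1 eq abs_one ennreal_1 not_False_eq_True one_neq_zero)
    qed
    then show ?thesis by simp
  qed
  also have "\<dots> = (\<integral>\<^sup>+x. (\<integral>\<^sup>+s. ?I x * F (x + s *\<^sub>R u) \<partial>lborel) \<partial>lborel)"
    by (simp add: nn_integral_cmult)
  also have "\<dots> = (\<integral>\<^sup>+s. (\<integral>\<^sup>+x. ?I x * F (x + s *\<^sub>R u) \<partial>lborel) \<partial>lborel)"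
    by (rule lborel_pair.Fubini'[symmetric]) measurable
  also have "\<dots> = (\<integral>\<^sup>+s. (\<integral>\<^sup>+x. ?I (x - s *\<^sub>R u) * F x \<partial>lborel) \<partial>lborel)"
  proof (rule nn_integral_cong)
    fix s :: real
    have "(\<integral>\<^sup>+x. ?I (x - s *\<^sub>R u) * F x \<partial>lborel)
        = (\<integral>\<^sup>+x. ?I (x - s *\<^sub>R u) * F x \<partial>distr lborel borel ((+) (s *\<^sub>R u)))"
      by (simp add: lborel_distr_plus)
    also have "\<dots> = (\<integral>\<^sup>+x. ?I x * F (x + s *\<^sub>R u) \<partial>lborel)"
      by (subst nn_integral_distr) (auto simp: add.commute)
    finally show "(\<integral>\<^sup>+x. ?I x * F (x + s *\<^sub>R u) \<partial>lborel) = (\<integral>\<^sup>+x. ?I (x - s *\<^sub>R u) * F x \<partial>lborel)" ..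
  qed
  also have "\<dots> = (\<integral>\<^sup>+x. (\<integral>\<^sup>+s. ?I (x - s *\<^sub>R u) * F x \<partial>lborel) \<partial>lborel)"
    by (rule lborel_pair.Fubini') measurable
  also have "\<dots> = (\<integral>\<^sup>+x. F x \<partial>lborel)"
  proof (rule nn_integral_cong)
    fix x
    have "(\<integral>\<^sup>+s. ?I (x - s *\<^sub>R u) * F x \<partial>lborel) = (\<integral>\<^sup>+s. ?I (x - s *\<^sub>R u) \<partial>lborel) * F x"
      by (rule nn_integral_multc) measurable
    also have "(\<integral>\<^sup>+s. ?I (x - s *\<^sub>R u) \<partial>lborel) = (\<integral>\<^sup>+s. indicator {x \<bullet> u - 1/2 .. x \<bullet> u + 1/2} s \<partial>lborel)"
    proof (intro nn_integral_cong)
      fix s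
      have "\<bar>(x - s *\<^sub>R u) \<bullet> u\<bar> \<le> 1/2 \<longleftrightarrow> x \<bullet> u - 1/2 \<le> s \<and> s \<le> x \<bullet> u + 1/2"
        by (simp only: inner_diff_left inner_scaleR_left unit_inner_self abs_le_iff) auto
      then show "?I (x - s *\<^sub>R u) = indicator {x \<bullet> u - 1/2 .. x \<bullet> u + 1/2} s"
        by (simp add: indicator_def)
    qed
    also have "\<dots> = 1" by simp
    finally show "(\<integral>\<^sup>+s. ?I (x - s *\<^sub>R u) * F x \<partial>lborel) = F x" by simp
  qed
  finally show ?thesis ..
qed

lemma AE_perp_lborel: "AE x in perp_lborel u. x \<bullet> u = 0"
proof -
  have "emeasure (perp_lborel u) {x. x \<bullet> u \<noteq> 0} = 0"
    unfolding perp_lborel_def by (subst emeasure_distr) (auto simp: inner_perp_part)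
  then show ?thesis by (subst AE_iff_measurable[OF _ refl]) auto
qed

lemma nn_integral_perp_lborel_translate:
  assumes [measurable]: "F \<in> borel_measurable borel" and w: "w \<bullet> u = 0"
  shows "(\<integral>\<^sup>+x. F (x + w) \<partial>perp_lborel u) = (\<integral>\<^sup>+x. F x \<partial>perp_lborel u)"
proof -
  let ?I = "indicator {x. \<bar>x \<bullet> u\<bar> \<le> 1/2} :: 'a \<Rightarrow> ennreal"
  have "(\<integral>\<^sup>+x. F x \<partial>perp_lborel u) = (\<integral>\<^sup>+x. ?I x * F (perp_part u x) \<partial>distr lborel borel ((+) w))"
    by (simp add: nn_integral_perp_lborel lborel_distr_plus)
  also have "\<dots> = (\<integral>\<^sup>+x. ?I x * F (perp_part u x + w) \<partial>lborel)"
    by (subst nn_integral_distr)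
       (auto simp: indicator_def inner_simps w perp_part_add perp_part_eq add.commute intro!: nn_integral_cong)
  also have "\<dots> = (\<integral>\<^sup>+x. F (x + w) \<partial>perp_lborel u)" by (simp add: nn_integral_perp_lborel)
  finally show ?thesis ..
qed

lemma nn_integral_lborel_minus:
  fixes F :: "'a \<Rightarrow> ennreal"
  assumes [measurable]: "F \<in> borel_measurable borel"
  shows "(\<integral>\<^sup>+x. F (- x) \<partial>lborel) = (\<integral>\<^sup>+x. F x \<partial>lborel)"
  by (subst (2) lborel_affine[of "-1" "0::'a"]) (simp_all add: nn_integral_density nn_integral_distr)

lemma nn_integral_perp_lborel_minus:
  assumes [measurable]: "F \<in> borel_measurable borel"
  shows "(\<integral>\<^sup>+x. F (- x) \<partial>perp_lborel u) = (\<integral>\<^sup>+x. F x \<partial>perp_lborel u)"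
  using nn_integral_lborel_minus[of "\<lambda>x. indicator {x. \<bar>x \<bullet> u\<bar> \<le> 1/2} x * F (perp_part u x)"]
  by (simp add: nn_integral_perp_lborel perp_part_minus indicator_def)

lemma emeasure_perp_lborel:
  assumes [measurable]: "A \<in> sets borel"
  shows "emeasure (perp_lborel u) A = emeasure lborel {x. \<bar>x \<bullet> u\<bar> \<le> 1/2 \<and> perp_part u x \<in> A}"
proof -
  have "emeasure (perp_lborel u) A = (\<integral>\<^sup>+x. indicator A x \<partial>perp_lborel u)" by simp
  also have "\<dots> = (\<integral>\<^sup>+x. indicator {x. \<bar>x \<bullet> u\<bar> \<le> 1/2} x * indicator A (perp_part u x) \<partial>lborel)"
    by (rule nn_integral_perp_lborel) measurable
  also have "\<dots> = (\<integral>\<^sup>+x. indicator {x. \<bar>x \<bullet> u\<bar> \<le> 1/2 \<and> perp_part u x \<in> A} x \<partial>lborel)"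
    by (intro nn_integral_cong) (auto simp: indicator_def)
  also have "\<dots> = emeasure lborel {x. \<bar>x \<bullet> u\<bar> \<le> 1/2 \<and> perp_part u x \<in> A}" by simp
  finally show ?thesis .
qed

lemma emeasure_perp_lborel_bounded:
  assumes "bounded A" and A: "A \<in> sets borel"
  shows "emeasure (perp_lborel u) A < top"
proof -
  obtain b where b: "\<And>x. x \<in> A \<Longrightarrow> norm x \<le> b" using assms(1) by (auto simp: bounded_iff)
  have "norm x \<le> b + 1" if "\<bar>x \<bullet> u\<bar> \<le> 1/2" "perp_part u x \<in> A" for x
  proof -
    have "norm x \<le> norm (perp_part u x) + norm ((x \<bullet> u) *\<^sub>R u)"
      using norm_triangle_ineq[of "perp_part u x" "(x \<bullet> u) *\<^sub>R u"] unfolding perp_part_decomp .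
    then show ?thesis using b[OF that(2)] that(1) unfolding norm_scaleR u by linarith
  qed
  then have "bounded {x. \<bar>x \<bullet> u\<bar> \<le> 1/2 \<and> perp_part u x \<in> A}" by (auto simp: bounded_iff)
  from emeasure_bounded_finite[OF this] show ?thesis by (simp add: emeasure_perp_lborel[OF A])
qed

lemma emeasure_perp_lborel_open_pos:
  assumes W: "open W" and x: "x \<in> W" "x \<bullet> u = 0"
  shows "emeasure (perp_lborel u) W > 0"
proof -
  let ?S = "{x. \<bar>x \<bullet> u\<bar> < 1/2} \<inter> perp_part u -` W"
  have "continuous_on UNIV (perp_part u)" by (intro continuous_intros)
  then have "open (perp_part u -` W)" using W by (intro open_vimage)
  moreover have "open {x. \<bar>x \<bullet> u\<bar> < 1/2}" by (intro open_Collect_less continuous_intros)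
  ultimately have o: "open ?S" by blast
  have "x \<in> ?S" using x perp_part_eq[OF x(2)] by (simp only: Int_iff mem_Collect_eq vimage_eq) simp
  then have "\<not> negligible ?S" using open_not_negligible[OF o] by blast
  have "emeasure lborel ?S \<noteq> 0"
  proof
    assume "emeasure lborel ?S = 0"
    then have "?S \<in> null_sets lborel" using borel_open[OF o] by (simp only: null_sets_def mem_Collect_eq sets_lborel)
    then show False
      using \<open>\<not> negligible ?S\<close> null_sets_completionI negligible_iff_null_sets by blast
  qed
  moreover have "emeasure lborel ?S \<le> emeasure lborel {x. \<bar>x \<bullet> u\<bar> \<le> 1/2 \<and> perp_part u x \<in> W}"
  proof (rule emeasure_mono)
    have [measurable]: "W \<in> sets borel" using W by simp
    show "{x. \<bar>x \<bullet> u\<bar> \<le> 1/2 \<and> perp_part u x \<in> W} \<in> sets lborel" by measurable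
  qed auto
  ultimately have "emeasure lborel {x. \<bar>x \<bullet> u\<bar> \<le> 1/2 \<and> perp_part u x \<in> W} \<noteq> 0"
    by (metis le_zero_eq)
  then show ?thesis using W by (simp add: emeasure_perp_lborel[OF borel_open] zero_less_iff_neq_zero)
qed

lemma sigma_finite_perp_lborel: "sigma_finite_measure (perp_lborel u)"
proof
  have "\<Union> (range (\<lambda>n::nat. cball (0::'a) n)) = UNIV"
    by (auto simp: real_arch_simple)
  then show "\<exists>A. countable A \<and> A \<subseteq> sets (perp_lborel u) \<and> \<Union> A = space (perp_lborel u)
      \<and> (\<forall>a\<in>A. emeasure (perp_lborel u) a \<noteq> \<infinity>)"
    using emeasure_perp_lborel_bounded[OF bounded_cball borel_closed[OF closed_cball]]
    by (intro exI[of _ "range (\<lambda>n::nat. cball (0::'a) n)"]) (simp add: less_top image_subset_iff)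
qed

end

text \<open>By Fubini applied to
  \<open>(x, y) \<mapsto> 1\<^sub>A y * 1\<^sub>B (x + y)\<close>.\<close>

lemma translation_invariant_unique:
  fixes V :: "'a::euclidean_space set"
  assumes sM: "sets M = sets borel" and sN: "sets N = sets borel"
    and M: "sigma_finite_measure M" and N: "sigma_finite_measure N"
    and VM: "AE x in M. x \<in> V" and VN: "AE x in N. x \<in> V" and V: "\<And>x. x \<in> V \<Longrightarrow> - x \<in> V"
    and iM: "\<And>w F. w \<in> V \<Longrightarrow> F \<in> borel_measurable borel \<Longrightarrow> (\<integral>\<^sup>+x. F (x + w) \<partial>M) = (\<integral>\<^sup>+x. F x \<partial>M)"
    and iN: "\<And>w F. w \<in> V \<Longrightarrow> F \<in> borel_measurable borel \<Longrightarrow> (\<integral>\<^sup>+x. F (x + w) \<partial>N) = (\<integral>\<^sup>+x. F x \<partial>N)"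
    and mN: "\<And>F. F \<in> borel_measurable borel \<Longrightarrow> (\<integral>\<^sup>+x. F (- x) \<partial>N) = (\<integral>\<^sup>+x. F x \<partial>N)"
    and A: "A \<in> sets borel" and B: "B \<in> sets borel"
  shows "emeasure M A * emeasure N B = emeasure M B * emeasure N A"
proof -
  interpret M: sigma_finite_measure M by fact
  interpret N: sigma_finite_measure N by fact
  interpret P: pair_sigma_finite N M ..
  note [measurable_cong] = sM sN
  note [measurable] = A B
  let ?a = "indicator A :: 'a \<Rightarrow> ennreal" and ?b = "indicator B :: 'a \<Rightarrow> ennreal"
  have "emeasure M A * emeasure N B = (\<integral>\<^sup>+y. ?a y * emeasure N B \<partial>M)"
    by (simp add: nn_integral_multc sM)
  also have "\<dots> = (\<integral>\<^sup>+y. ?a y * (\<integral>\<^sup>+x. ?b (x + y) \<partial>N) \<partial>M)"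
  proof (rule nn_integral_cong_AE)
    show "AE y in M. ?a y * emeasure N B = ?a y * (\<integral>\<^sup>+x. ?b (x + y) \<partial>N)"
      using VM by eventually_elim (simp add: iN sN)
  qed
  also have "\<dots> = (\<integral>\<^sup>+y. (\<integral>\<^sup>+x. ?a y * ?b (x + y) \<partial>N) \<partial>M)"
    by (simp add: nn_integral_cmult)
  also have "\<dots> = (\<integral>\<^sup>+x. (\<integral>\<^sup>+y. ?a y * ?b (x + y) \<partial>M) \<partial>N)"
    by (rule P.Fubini') measurable
  also have "\<dots> = (\<integral>\<^sup>+x. (\<integral>\<^sup>+y. ?a (y - x) * ?b y \<partial>M) \<partial>N)"
  proof (rule nn_integral_cong_AE)
    show "AE x in N. (\<integral>\<^sup>+y. ?a y * ?b (x + y) \<partial>M) = (\<integral>\<^sup>+y. ?a (y - x) * ?b y \<partial>M)"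
      using VN
    proof eventually_elim
      case (elim x)
      show ?case using iM[OF elim, of "\<lambda>y. ?a (y - x) * ?b y"] by (simp add: add.commute)
    qed
  qed
  also have "\<dots> = (\<integral>\<^sup>+y. (\<integral>\<^sup>+x. ?a (y - x) * ?b y \<partial>N) \<partial>M)"
    by (rule P.Fubini'[symmetric]) measurable
  also have "\<dots> = (\<integral>\<^sup>+y. ?b y * emeasure N A \<partial>M)"
  proof (rule nn_integral_cong_AE)
    show "AE y in M. (\<integral>\<^sup>+x. ?a (y - x) * ?b y \<partial>N) = ?b y * emeasure N A"
      using VM
    proof eventually_elim
      case (elim y)
      have "(\<integral>\<^sup>+x. ?a (y - x) * ?b y \<partial>N) = (\<integral>\<^sup>+x. ?a (y - x) \<partial>N) * ?b y"
        by (rule nn_integral_multc) measurable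
      also have "(\<integral>\<^sup>+x. ?a (y - x) \<partial>N) = (\<integral>\<^sup>+x. ?a (x + y) \<partial>N)"
        using mN[of "\<lambda>x. ?a (x + y)"] by (simp add: add.commute[of _ y])
      also have "\<dots> = emeasure N A" by (simp add: iN elim sN)
      finally show ?case by (simp add: mult.commute)
    qed
  qed
  also have "\<dots> = emeasure M B * emeasure N A"
    by (simp add: nn_integral_multc sM)
  finally show ?thesis .
qed

text \<open>The image of Lebesgue measure under \<open>T\<close> is again translation invariant,
  hence proportional to it, and the factor is 1 because \<open>T\<close> preserves the unit
  ball.\<close>

lemma emeasure_lborel_orthogonal:
  fixes T :: "'a::euclidean_space \<Rightarrow> 'a"
  assumes T: "orthogonal_transformation T" and A: "A \<in> sets borel"
  shows "emeasure lborel (T -` A) = emeasure lborel A"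
proof -
  have lin: "linear T" using T by (rule orthogonal_transformation_linear)
  have [measurable]: "T \<in> borel_measurable borel"
    by (intro borel_measurable_continuous_onI linear_continuous_on linear_conv_bounded_linear[THEN iffD1] lin)
  define M where "M = distr lborel borel T"
  have sM: "sets M = sets borel" by (simp add: M_def)
  have eM: "emeasure M X = emeasure lborel (T -` X)" if "X \<in> sets borel" for X
    using that by (simp add: M_def emeasure_distr)
  have nT: "norm (T x) = norm x" for x using T by (simp add: orthogonal_transformation)
  have finM: "emeasure M (cball 0 r) < top" for r
  proof -
    have "T -` cball 0 r = cball 0 r" using nT by auto
    then show ?thesis using emeasure_bounded_finite[OF bounded_cball] by (simp add: eM borel_closed)
  qed
  have sfM: "sigma_finite_measure M"
  proof
    have "\<Union> (range (\<lambda>n::nat. cball (0::'a) n)) = UNIV"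
      by (auto simp: real_arch_simple)
    then show "\<exists>A. countable A \<and> A \<subseteq> sets M \<and> \<Union> A = space M \<and> (\<forall>a\<in>A. emeasure M a \<noteq> \<infinity>)"
      using finM by (intro exI[of _ "range (\<lambda>n::nat. cball (0::'a) n)"])
        (simp add: less_top image_subset_iff sM borel_closed sets_eq_imp_space_eq[OF sM])
  qed
  have eq: "emeasure M A * emeasure lborel (cball 0 1 :: 'a set)
      = emeasure M (cball 0 1) * emeasure lborel A"
  proof (rule translation_invariant_unique[where V=UNIV, OF sM sets_lborel sfM lborel.sigma_finite_measure_axioms])
    fix w and F :: "'a \<Rightarrow> ennreal" assume [measurable]: "F \<in> borel_measurable borel"
    have tr: "(\<integral>\<^sup>+x. G (x + v) \<partial>lborel) = (\<integral>\<^sup>+x. G x \<partial>lborel)"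
      if [measurable]: "G \<in> borel_measurable borel" for G :: "'a \<Rightarrow> ennreal" and v
    proof -
      have "(\<integral>\<^sup>+x. G x \<partial>lborel) = (\<integral>\<^sup>+x. G x \<partial>distr lborel borel ((+) v))" by (simp add: lborel_distr_plus)
      also have "\<dots> = (\<integral>\<^sup>+x. G (x + v) \<partial>lborel)" by (subst nn_integral_distr) (auto simp: add.commute)
      finally show ?thesis ..
    qed
    from tr[of F w] show "(\<integral>\<^sup>+x. F (x + w) \<partial>lborel) = (\<integral>\<^sup>+x. F x \<partial>lborel)" by simp
    obtain v where v: "T v = w" using orthogonal_transformation_surj[OF T] by (metis surjD)
    have "(\<integral>\<^sup>+x. F (x + w) \<partial>M) = (\<integral>\<^sup>+x. F (T x + w) \<partial>lborel)"
      unfolding M_def by (subst nn_integral_distr) auto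
    also have "\<dots> = (\<integral>\<^sup>+x. F (T (x + v)) \<partial>lborel)" by (simp add: linear_add[OF lin] v)
    also have "\<dots> = (\<integral>\<^sup>+x. F (T x) \<partial>lborel)" by (rule tr) measurable
    also have "\<dots> = (\<integral>\<^sup>+x. F x \<partial>M)"
      unfolding M_def by (subst nn_integral_distr) auto
    finally show "(\<integral>\<^sup>+x. F (x + w) \<partial>M) = (\<integral>\<^sup>+x. F x \<partial>M)" .
    show "(\<integral>\<^sup>+x. F (- x) \<partial>lborel) = (\<integral>\<^sup>+x. F x \<partial>lborel)"
      by (subst (2) lborel_affine[of "-1" "0::'a"]) (simp_all add: nn_integral_density nn_integral_distr)
  qed (use A in \<open>auto simp: borel_closed\<close>)
  have cb: "T -` cball 0 1 = cball 0 1" using nT by auto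
  have fin: "emeasure lborel (cball 0 1 :: 'a set) \<noteq> top"
    using emeasure_bounded_finite[OF bounded_cball, of "0::'a" 1] by (simp add: less_top)
  have pos: "emeasure lborel (cball 0 1 :: 'a set) \<noteq> 0"
  proof -
    have "unit_ball_vol (real DIM('a)) > 0" by simp
    then show ?thesis by (auto simp: emeasure_cball simp del: unit_ball_vol_pos)
  qed
  have "emeasure M A * emeasure lborel (cball 0 1 :: 'a set) = emeasure lborel A * emeasure lborel (cball 0 1 :: 'a set)"
    using eq by (simp add: eM[of "cball 0 1"] borel_closed cb mult.commute)
  then have "emeasure M A = emeasure lborel A"
    using fin pos by (metis ennreal_mult_divide_eq)
  then show ?thesis using A by (simp add: eM)
qed

text \<open>The unit disc of the hyperplane determines the factor: both measures are finite there,
  and the denominator is positive.\<close>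

definition hausdorff_ratio :: "'a::euclidean_space \<Rightarrow> ennreal" where
  "hausdorff_ratio u =
     hausdorff_outer (DIM('a) - 1) {x \<in> cball 0 1. x \<bullet> u = 0} / emeasure (perp_lborel u) (cball 0 1)"

text \<open>The disc is part of the boundary of a half ball, which is a convex body.\<close>

lemma hausdorff_outer_disc_finite:
  fixes u :: "'a::euclidean_space"
  assumes u: "norm u = 1" and r: "0 < r"
  shows "hausdorff_outer (DIM('a) - 1) {x \<in> cball 0 r. x \<bullet> u = 0} < top"
proof -
  define C where "C = {x \<in> cball 0 r. 0 \<le> x \<bullet> u}"
  have uu: "u \<bullet> u = 1" using u by (rule unit_inner_self)
  have Ceq: "C = cball 0 r \<inter> {x. 0 \<le> u \<bullet> x}" by (auto simp: C_def inner_commute)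
  have "(r/2) *\<^sub>R u \<in> ball 0 r \<inter> {x. 0 < u \<bullet> x}" using r u uu by simp
  moreover have "open (ball 0 r \<inter> {x. 0 < u \<bullet> x})" by (intro open_Int open_halfspace_gt open_ball)
  moreover have "ball 0 r \<inter> {x. 0 < u \<bullet> x} \<subseteq> C" unfolding Ceq by auto
  ultimately have int: "interior C \<noteq> {}" by (metis empty_iff interiorI)
  have "convex_body C"
    unfolding convex_body_def using int unfolding Ceq
    by (intro conjI compact_Int_closed compact_cball closed_halfspace_ge convex_Int convex_cball convex_halfspace_ge) auto
  then have "hausdorff_outer (DIM('a) - 1) (frontier C) < top" by (rule hausdorff_outer_frontier_convex_body)
  moreover have "{x \<in> cball 0 r. x \<bullet> u = 0} \<subseteq> frontier C"
  proof
    fix x assume x: "x \<in> {x \<in> cball 0 r. x \<bullet> u = 0}"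
    have "x \<notin> interior C"
    proof
      assume "x \<in> interior C"
      then obtain e where e: "e > 0" "ball x e \<subseteq> C" by (auto simp: mem_interior)
      have "x - (e/2) *\<^sub>R u \<in> ball x e" using e u by (simp add: dist_norm)
      then have "x - (e/2) *\<^sub>R u \<in> C" using e by blast
      then show False using x e uu by (simp add: C_def inner_diff_left)
    qed
    moreover have "x \<in> C" using x by (simp add: C_def)
    ultimately show "x \<in> frontier C" unfolding frontier_def using closure_subset by blast
  qed
  ultimately show ?thesis using hausdorff_outer_mono le_less_trans by blast
qed

lemma hausdorff_outer_translate:
  "hausdorff_outer k ((+) (w::'a::euclidean_space) ` A) = hausdorff_outer k A"
  by (rule hausdorff_outer_isometry) (simp add: dist_norm)

lemma distr_hausdorff_translate:
  "distr (hausdorff_measure k) borel ((+) (w::'a::euclidean_space)) = hausdorff_measure k"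
proof (rule measure_eqI)
  fix A assume "A \<in> sets (distr (hausdorff_measure k) borel ((+) w))"
  then have A: "A \<in> sets borel" by simp
  then have m: "(+) w -` A \<in> sets borel" by (intro measurable_sets_borel[OF _ A]) measurable
  have "emeasure (distr (hausdorff_measure k) borel ((+) w)) A = hausdorff_outer k ((+) w -` A)"
    using A m by (subst emeasure_distr) (auto simp: emeasure_hausdorff_measure)
  also have "\<dots> = hausdorff_outer k ((+) w ` ((+) w -` A))" by (simp only: hausdorff_outer_translate)
  also have "(+) w ` ((+) w -` A) = A" by (rule surj_image_vimage_eq) simp
  finally show "emeasure (distr (hausdorff_measure k) borel ((+) w)) A = emeasure (hausdorff_measure k) A"
    using A by (simp add: emeasure_hausdorff_measure)
qed simp

lemma emeasure_perp_lborel_cball: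
  fixes u :: "'a::euclidean_space"
  assumes u: "norm u = 1"
  shows "emeasure (perp_lborel u) (cball 0 1) \<noteq> 0" "emeasure (perp_lborel u) (cball 0 1) \<noteq> top"
proof -
  have "0 < emeasure (perp_lborel u) (ball 0 1)"
    by (rule emeasure_perp_lborel_open_pos[OF u, of _ 0]) auto
  also have "\<dots> \<le> emeasure (perp_lborel u) (cball 0 1)" by (rule emeasure_mono) (auto simp: borel_closed)
  finally show "emeasure (perp_lborel u) (cball 0 1) \<noteq> 0" by simp
  show "emeasure (perp_lborel u) (cball 0 1) \<noteq> top"
    using emeasure_perp_lborel_bounded[OF u bounded_cball, of 0 1] by (simp add: less_top borel_closed)
qed

lemma hausdorff_ratio_finite:
  fixes u :: "'a::euclidean_space"
  assumes u: "norm u = 1"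
  shows "hausdorff_ratio u < top"
  unfolding hausdorff_ratio_def
  using hausdorff_outer_disc_finite[OF u, of 1] emeasure_perp_lborel_cball[OF u]
  unfolding divide_ennreal_def ennreal_mult_less_top
  by (simp add: less_top[symmetric])

text \<open>Both sides are translation-invariant measures on the hyperplane and are compared on the
  unit disc. Restricting Hausdorff measure to the hyperplane makes it sigma-finite, as the
  uniqueness argument requires.\<close>

lemma hausdorff_outer_hyperplane:
  fixes u :: "'a::euclidean_space"
  assumes u: "norm u = 1" and A: "A \<in> sets borel" "\<And>x. x \<in> A \<Longrightarrow> x \<bullet> u = 0"
  shows "hausdorff_outer (DIM('a) - 1) A = hausdorff_ratio u * emeasure (perp_lborel u) A"
proof -
  let ?k = "DIM('a) - 1"
  define V where "V = {x. x \<bullet> u = 0}"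
  have V[measurable]: "V \<in> sets borel" unfolding V_def by measurable
  define M where "M = density (hausdorff_measure ?k) (indicator V)"
  have sM: "sets M = sets borel" by (simp add: M_def)
  have eM: "emeasure M X = hausdorff_outer ?k (X \<inter> V)" if "X \<in> sets borel" for X
  proof -
    have "emeasure M X = (\<integral>\<^sup>+x. indicator V x * indicator X x \<partial>hausdorff_measure ?k)"
      unfolding M_def using that by (intro emeasure_density) auto
    also have "\<dots> = (\<integral>\<^sup>+x. indicator (X \<inter> V) x \<partial>hausdorff_measure ?k)"
      by (intro nn_integral_cong) (auto simp: indicator_def)
    also have "\<dots> = hausdorff_outer ?k (X \<inter> V)"
      using that V by (simp add: emeasure_hausdorff_measure)
    finally show ?thesis .
  qed
  have cV: "cball 0 r \<inter> V = {x \<in> cball 0 r. x \<bullet> u = 0}" for r by (auto simp: V_def)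
  have finM: "emeasure M (cball 0 r) < top" if "r > 0" for r
    using hausdorff_outer_disc_finite[OF u that] by (simp add: eM borel_closed cV)
  have sfM: "sigma_finite_measure M"
  proof
    have "\<Union> (range (\<lambda>n::nat. cball (0::'a) (Suc n))) = UNIV"
    proof -
      have "\<exists>n. norm x \<le> real (Suc n)" for x :: 'a
        using real_arch_simple[of "norm x"] by (metis le_add_same_cancel2 of_nat_Suc order_trans zero_le_one)
      then show ?thesis by auto
    qed
    then show "\<exists>A. countable A \<and> A \<subseteq> sets M \<and> \<Union> A = space M \<and> (\<forall>a\<in>A. emeasure M a \<noteq> \<infinity>)"
      using finM by (intro exI[of _ "range (\<lambda>n::nat. cball (0::'a) (Suc n))"])
        (simp add: less_top image_subset_iff sM borel_closed sets_eq_imp_space_eq[OF sM])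
  qed
  have eq: "emeasure M A * emeasure (perp_lborel u) (cball 0 1)
      = emeasure M (cball 0 1) * emeasure (perp_lborel u) A"
  proof (rule translation_invariant_unique[where V=V, OF sM sets_perp_lborel sfM sigma_finite_perp_lborel[OF u]])
    show "AE x in perp_lborel u. x \<in> V" using AE_perp_lborel[OF u] by (simp add: V_def)
    show "AE x in M. x \<in> V" unfolding M_def
      by (subst AE_density, measurable) (rule AE_I2, simp add: indicator_def split: if_splits)
    show "x \<in> V \<Longrightarrow> - x \<in> V" for x by (simp add: V_def)
    fix F :: "'a \<Rightarrow> ennreal" assume F[measurable]: "F \<in> borel_measurable borel"
    show "(\<integral>\<^sup>+x. F (- x) \<partial>perp_lborel u) = (\<integral>\<^sup>+x. F x \<partial>perp_lborel u)"
      by (rule nn_integral_perp_lborel_minus[OF u F])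
    fix w assume w: "w \<in> V"
    then show "(\<integral>\<^sup>+x. F (x + w) \<partial>perp_lborel u) = (\<integral>\<^sup>+x. F x \<partial>perp_lborel u)"
      by (intro nn_integral_perp_lborel_translate[OF u F]) (simp add: V_def)
    have "(\<integral>\<^sup>+x. F x \<partial>M) = (\<integral>\<^sup>+x. indicator V x * F x \<partial>hausdorff_measure ?k)"
      unfolding M_def by (rule nn_integral_density) auto
    also have "\<dots> = (\<integral>\<^sup>+x. indicator V x * F x \<partial>distr (hausdorff_measure ?k) borel ((+) w))"
      by (simp add: distr_hausdorff_translate)
    also have "\<dots> = (\<integral>\<^sup>+x. indicator V x * F (x + w) \<partial>hausdorff_measure ?k)"
      using w by (subst nn_integral_distr)
        (auto simp: V_def indicator_def inner_add_left add.commute intro!: nn_integral_cong)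
    also have "\<dots> = (\<integral>\<^sup>+x. F (x + w) \<partial>M)"
      unfolding M_def by (rule nn_integral_density[symmetric]) auto
    finally show "(\<integral>\<^sup>+x. F (x + w) \<partial>M) = (\<integral>\<^sup>+x. F x \<partial>M)" ..
  qed (use A in \<open>auto simp: borel_closed\<close>)
  have AV: "A \<inter> V = A" using A(2) by (auto simp: V_def)
  have "hausdorff_outer ?k A * emeasure (perp_lborel u) (cball 0 1)
      = hausdorff_outer ?k {x \<in> cball 0 1. x \<bullet> u = 0} * emeasure (perp_lborel u) A"
    using eq by (simp add: eM A AV borel_closed cV)
  then have "hausdorff_outer ?k A
      = hausdorff_outer ?k {x \<in> cball 0 1. x \<bullet> u = 0} * emeasure (perp_lborel u) A
        / emeasure (perp_lborel u) (cball 0 1)"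
    using emeasure_perp_lborel_cball[OF u] by (metis ennreal_mult_divide_eq)
  then show ?thesis
    unfolding hausdorff_ratio_def divide_ennreal_def by (simp only: mult_ac)
qed

text \<open>An orthogonal map taking \<open>u\<close> to \<open>v\<close> is an isometry, which
  settles the numerator. For the denominator it maps the slab prism over one disc onto that over the
  other and preserves Lebesgue measure.\<close>

lemma hausdorff_ratio_eq:
  fixes u v :: "real^'n"
  assumes u: "norm u = 1" and v: "norm v = 1"
  shows "hausdorff_ratio u = hausdorff_ratio v"
proof -
  obtain T where T: "orthogonal_transformation T" and Tu: "T u = v"
    using orthogonal_transformation_exists[of u v] u v by auto
  have lin: "linear T" using T by (rule orthogonal_transformation_linear)
  have inn: "T x \<bullet> v = x \<bullet> u" for x
    using T Tu unfolding orthogonal_transformation_def by metis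
  have nT: "norm (T x) = norm x" for x using T by (simp add: orthogonal_transformation)
  have 1: "hausdorff_outer k (T ` {x \<in> cball 0 1. x \<bullet> u = 0}) = hausdorff_outer k {x \<in> cball 0 1. x \<bullet> u = 0}" for k
    by (rule hausdorff_outer_isometry) (simp add: dist_norm nT linear_diff[OF lin, symmetric])
  have 2: "T ` {x \<in> cball 0 1. x \<bullet> u = 0} = {x \<in> cball 0 1. x \<bullet> v = 0}"
  proof
    show "{x \<in> cball 0 1. x \<bullet> v = 0} \<subseteq> T ` {x \<in> cball 0 1. x \<bullet> u = 0}"
    proof
      fix y assume y: "y \<in> {x \<in> cball 0 1. x \<bullet> v = 0}"
      obtain x where "y = T x" using orthogonal_transformation_surj[OF T] by (metis surjD)
      then show "y \<in> T ` {x \<in> cball 0 1. x \<bullet> u = 0}" using y inn nT by auto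
    qed
  qed (auto simp: nT inn)
  have PT: "perp_part v (T x) = T (perp_part u x)" for x
    unfolding perp_part_def inn linear_diff[OF lin] linear_scale[OF lin] Tu ..
  have [measurable]: "cball (0::real^'n) 1 \<in> sets borel" by (simp add: borel_closed)
  have "emeasure (perp_lborel v) (cball 0 1)
      = emeasure lborel (T -` {x. \<bar>x \<bullet> v\<bar> \<le> 1/2 \<and> perp_part v x \<in> cball 0 1})"
    unfolding emeasure_perp_lborel[OF v borel_closed[OF closed_cball]]
    by (rule emeasure_lborel_orthogonal[OF T, symmetric]) measurable
  also have "T -` {x. \<bar>x \<bullet> v\<bar> \<le> 1/2 \<and> perp_part v x \<in> cball 0 1}
      = {x. \<bar>x \<bullet> u\<bar> \<le> 1/2 \<and> perp_part u x \<in> cball 0 1}"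
    by (simp add: set_eq_iff inn PT nT)
  also have "emeasure lborel \<dots> = emeasure (perp_lborel u) (cball 0 1)"
    by (rule emeasure_perp_lborel[OF u borel_closed[OF closed_cball], symmetric])
  finally show ?thesis unfolding hausdorff_ratio_def 1[symmetric] 2 by simp
qed

section \<open>The area formula for graphs of concave functions\<close>

definition graph_map :: "'a::euclidean_space \<Rightarrow> ('a \<Rightarrow> real) \<Rightarrow> 'a \<Rightarrow> 'a" where
  "graph_map u F x = x + F x *\<^sub>R u"

lemma perp_part_graph_map:
  "norm u = 1 \<Longrightarrow> x \<bullet> u = 0 \<Longrightarrow> perp_part u (graph_map u F x) = x"
  by (simp only: graph_map_def perp_part_add_dir perp_part_eq)

lemma inner_graph_map: "norm u = 1 \<Longrightarrow> x \<bullet> u = 0 \<Longrightarrow> graph_map u F x \<bullet> u = F x"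
  by (simp add: graph_map_def inner_add_left unit_inner_self)

lemma graph_map_perp_part: "y \<bullet> u = F (perp_part u y) \<Longrightarrow> graph_map u F (perp_part u y) = y"
  by (metis graph_map_def perp_part_decomp)

lemma graph_map_image_eq:
  assumes u: "norm u = 1" and E: "\<And>x. x \<in> E \<Longrightarrow> x \<bullet> u = 0"
  shows "graph_map u F ` E = {y. perp_part u y \<in> E \<and> y \<bullet> u = F (perp_part u y)}"
proof
  show "graph_map u F ` E \<subseteq> {y. perp_part u y \<in> E \<and> y \<bullet> u = F (perp_part u y)}"
    using E by (auto simp: perp_part_graph_map[OF u] inner_graph_map[OF u])
  show "{y. perp_part u y \<in> E \<and> y \<bullet> u = F (perp_part u y)} \<subseteq> graph_map u F ` E"
  proof
    fix y assume y: "y \<in> {y. perp_part u y \<in> E \<and> y \<bullet> u = F (perp_part u y)}"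
    then have "y = graph_map u F (perp_part u y)" by (simp add: graph_map_perp_part)
    then show "y \<in> graph_map u F ` E" using y by blast
  qed
qed

text \<open>The graph of a linear function is a hyperplane with unit normal \<open>\<nu> = (u - a) / J\<close>. Both sides
  are compared with the volume of the prism of unit height over the graph in direction \<open>u\<close>.\<close>

lemma emeasure_perp_lborel_linear_graph:
  fixes u a :: "'a::euclidean_space"
  assumes u: "norm u = 1" and a: "a \<bullet> u = 0" and E: "E \<in> sets borel" "\<And>x. x \<in> E \<Longrightarrow> x \<bullet> u = 0"
  defines "J \<equiv> sqrt (1 + (norm a)\<^sup>2)"
  defines "\<nu> \<equiv> (1 / J) *\<^sub>R (u - a)"
  defines "L \<equiv> graph_map u (\<lambda>x. a \<bullet> x)"
  shows "norm \<nu> = 1" "L ` E \<in> sets borel" "\<And>y. y \<in> L ` E \<Longrightarrow> y \<bullet> \<nu> = 0"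
    "emeasure (perp_lborel \<nu>) (L ` E) = ennreal J * emeasure (perp_lborel u) E"
proof -
  have uu: "u \<bullet> u = 1" by (rule unit_inner_self[OF u])
  have J1: "J \<ge> 1" by (simp add: J_def)
  then have J: "J > 0" by linarith
  have J2: "J\<^sup>2 = 1 + (norm a)\<^sup>2" by (simp add: J_def)
  have ua: "u \<bullet> a = 0" using a by (simp add: inner_commute)
  have "(norm (u - a))\<^sup>2 = J\<^sup>2"
    unfolding J2 power2_norm_eq_inner by (simp add: inner_diff_left inner_diff_right uu a ua)
  then have nua: "norm (u - a) = J" using J by (simp add: power2_eq_iff_nonneg)
  show \<nu>: "norm \<nu> = 1" unfolding \<nu>_def norm_scaleR nua using J by simp
  have LE: "L ` E = {y. perp_part u y \<in> E \<and> y \<bullet> u = a \<bullet> perp_part u y}"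
    unfolding L_def by (rule graph_map_image_eq[OF u E(2)])
  note [measurable] = E(1)
  show LEm[measurable]: "L ` E \<in> sets borel" unfolding LE by measurable
  have aP: "a \<bullet> perp_part u y = a \<bullet> y" for y by (simp add: perp_part_def inner_diff_right a)
  have y\<nu>: "J * (y \<bullet> \<nu>) = y \<bullet> u - a \<bullet> perp_part u y" for y
    unfolding aP \<nu>_def using J by (simp add: inner_diff_right inner_commute)
  show perp: "y \<bullet> \<nu> = 0" if "y \<in> L ` E" for y
    using that y\<nu>[of y] J unfolding LE by simp
  define C where "C = {y. perp_part u y \<in> E \<and> 0 \<le> y \<bullet> u - a \<bullet> perp_part u y \<and> y \<bullet> u - a \<bullet> perp_part u y \<le> 1}"
  have [measurable]: "C \<in> sets borel" unfolding C_def by measurable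
  have "emeasure lborel C = (\<integral>\<^sup>+x. indicator C x \<partial>lborel)" by simp
  also have "\<dots> = (\<integral>\<^sup>+x. (\<integral>\<^sup>+s. indicator C (x + s *\<^sub>R u) \<partial>lborel) \<partial>perp_lborel u)"
    by (rule nn_integral_lborel_perp[OF u]) measurable
  also have "\<dots> = (\<integral>\<^sup>+x. indicator E x \<partial>perp_lborel u)"
  proof (rule nn_integral_cong_AE)
    show "AE x in perp_lborel u. (\<integral>\<^sup>+s. indicator C (x + s *\<^sub>R u) \<partial>lborel) = indicator E x"
      using AE_perp_lborel[OF u]
    proof eventually_elim
      case (elim x)
      have iff: "x + s *\<^sub>R u \<in> C \<longleftrightarrow> x \<in> E \<and> s \<in> {a \<bullet> x .. a \<bullet> x + 1}" for s
        unfolding C_def mem_Collect_eq perp_part_add_dir[OF u] perp_part_eq[OF elim]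
          inner_add_left inner_scaleR_left uu elim by auto
      have "(\<integral>\<^sup>+s. indicator C (x + s *\<^sub>R u) \<partial>lborel)
          = (\<integral>\<^sup>+s. indicator E x * indicator {a \<bullet> x .. a \<bullet> x + 1} s \<partial>lborel)"
        by (intro nn_integral_cong) (simp add: indicator_def iff)
      also have "\<dots> = indicator E x" by (subst nn_integral_cmult) simp_all
      finally show ?case .
    qed
  qed
  also have "\<dots> = emeasure (perp_lborel u) E" by simp
  finally have 1: "emeasure lborel C = emeasure (perp_lborel u) E" .
  interpret S: sigma_finite_measure "perp_lborel \<nu>" by (rule sigma_finite_perp_lborel[OF \<nu>])
  interpret P: pair_sigma_finite "perp_lborel \<nu>" "lborel :: real measure" ..
  have "emeasure lborel C = (\<integral>\<^sup>+x. indicator C x \<partial>lborel)" by simp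
  also have "\<dots> = (\<integral>\<^sup>+y. (\<integral>\<^sup>+r. indicator C (y + r *\<^sub>R \<nu>) \<partial>lborel) \<partial>perp_lborel \<nu>)"
    by (rule nn_integral_lborel_perp[OF \<nu>]) measurable
  also have "\<dots> = (\<integral>\<^sup>+r. (\<integral>\<^sup>+y. indicator C (y + r *\<^sub>R \<nu>) \<partial>perp_lborel \<nu>) \<partial>lborel)"
    by (rule P.Fubini'[symmetric]) measurable
  also have "\<dots> = (\<integral>\<^sup>+r. indicator {0..1/J} r * emeasure (perp_lborel \<nu>) (L ` E) \<partial>lborel)"
  proof (rule nn_integral_cong)
    fix r :: real
    \<comment> \<open>Sliced at height \<open>r\<close> in direction \<nu>, the prism is the graph
      over \<open>E\<close> translated by \<open>- w\<close>, where \<open>w\<close> is the point of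
      the hyperplane over \<open>z\<close>. Only heights from 0 to the thickness \<open>1/J\<close>
      occur.\<close>
    define z where "z = r *\<^sub>R perp_part u \<nu>"
    have zu: "z \<bullet> u = 0" by (simp add: z_def inner_perp_part[OF u])
    define w where "w = L z"
    have Pw: "perp_part u w = z" unfolding w_def L_def by (rule perp_part_graph_map[OF u zu])
    have "w \<bullet> u = a \<bullet> z" unfolding w_def L_def by (rule inner_graph_map[OF u zu])
    then have w\<nu>: "w \<bullet> \<nu> = 0" using y\<nu>[of w] J Pw by simp
    have \<nu>\<nu>: "\<nu> \<bullet> \<nu> = 1" by (rule unit_inner_self[OF \<nu>])
    have iff: "y + r *\<^sub>R \<nu> \<in> C \<longleftrightarrow> r \<in> {0..1/J} \<and> y + w \<in> L ` E" if y: "y \<bullet> \<nu> = 0" for y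
    proof -
      have "(y + r *\<^sub>R \<nu>) \<bullet> u - a \<bullet> perp_part u (y + r *\<^sub>R \<nu>) = J * r"
      proof -
        have "(y + r *\<^sub>R \<nu>) \<bullet> \<nu> = r" unfolding inner_add_left inner_scaleR_left y \<nu>\<nu> by simp
        then show ?thesis using y\<nu>[of "y + r *\<^sub>R \<nu>"] by metis
      qed
      moreover have "perp_part u (y + r *\<^sub>R \<nu>) = perp_part u (y + w)"
        by (simp add: perp_part_add Pw z_def perp_part_scale)
      moreover have "(y + w) \<bullet> u = a \<bullet> perp_part u (y + w)"
        using y\<nu>[of "y + w"] y w\<nu> by (simp add: inner_add_left)
      moreover have "0 \<le> J * r \<and> J * r \<le> 1 \<longleftrightarrow> r \<in> {0..1/J}"
        using J by (auto simp: field_simps zero_le_mult_iff)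
      ultimately show ?thesis unfolding C_def LE by auto
    qed
    have "(\<integral>\<^sup>+y. indicator C (y + r *\<^sub>R \<nu>) \<partial>perp_lborel \<nu>)
        = (\<integral>\<^sup>+y. indicator {0..1/J} r * indicator (L ` E) (y + w) \<partial>perp_lborel \<nu>)"
      using AE_perp_lborel[OF \<nu>]
      by (intro nn_integral_cong_AE, eventually_elim) (simp add: indicator_def iff)
    also have "\<dots> = indicator {0..1/J} r * (\<integral>\<^sup>+y. indicator (L ` E) (y + w) \<partial>perp_lborel \<nu>)"
      by (rule nn_integral_cmult) measurable
    also have "(\<integral>\<^sup>+y. indicator (L ` E) (y + w) \<partial>perp_lborel \<nu>) = (\<integral>\<^sup>+y. indicator (L ` E) y \<partial>perp_lborel \<nu>)"
      by (rule nn_integral_perp_lborel_translate[OF \<nu> _ w\<nu>]) measurable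
    also have "\<dots> = emeasure (perp_lborel \<nu>) (L ` E)" by simp
    finally show "(\<integral>\<^sup>+y. indicator C (y + r *\<^sub>R \<nu>) \<partial>perp_lborel \<nu>)
        = indicator {0..1/J} r * emeasure (perp_lborel \<nu>) (L ` E)" .
  qed
  also have "\<dots> = (\<integral>\<^sup>+r. indicator {0..1/J} r \<partial>lborel) * emeasure (perp_lborel \<nu>) (L ` E)"
    by (rule nn_integral_multc) measurable
  also have "(\<integral>\<^sup>+r. indicator {0..1/J} r \<partial>lborel) = ennreal (1/J)" using J by simp
  finally have 2: "emeasure (perp_lborel u) E = ennreal (1/J) * emeasure (perp_lborel \<nu>) (L ` E)"
    by (simp only: 1)
  have "ennreal J * ennreal (1/J) = 1" using J by (simp add: ennreal_mult[symmetric])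
  then show "emeasure (perp_lborel \<nu>) (L ` E) = ennreal J * emeasure (perp_lborel u) E"
    unfolding 2 by (metis mult.assoc mult_1)
qed

lemma hausdorff_outer_linear_graph:
  fixes u a :: "real^'n"
  assumes u: "norm u = 1" and a: "a \<bullet> u = 0" and E: "E \<in> sets borel" "\<And>x. x \<in> E \<Longrightarrow> x \<bullet> u = 0"
  shows "hausdorff_outer (CARD('n) - 1) (graph_map u (\<lambda>x. a \<bullet> x) ` E)
    = hausdorff_ratio u * (ennreal (sqrt (1 + (norm a)\<^sup>2)) * emeasure (perp_lborel u) E)"
proof -
  note L = emeasure_perp_lborel_linear_graph[OF u a E]
  show ?thesis
    using hausdorff_outer_hyperplane[OF L(1-3)]
    by (simp only: L(4) hausdorff_ratio_eq[OF L(1) u] DIM_cart DIM_real mult_1_right)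
qed

text \<open>For fixed \<epsilon> the local comparisons are summed over a countable disjoint
  refinement of the cover, available by Lindelof's theorem; then \<epsilon> tends to 0.\<close>

lemma emeasure_eq_of_local_ratio:
  fixes U :: "'a::euclidean_space set"
  assumes s1: "sets M = sets borel" and s2: "sets N = sets borel"
    and loc: "\<And>\<epsilon> a. 0 < \<epsilon> \<Longrightarrow> a \<in> U \<Longrightarrow> \<exists>W. open W \<and> a \<in> W \<and> (\<forall>E\<in>sets borel. E \<subseteq> U \<inter> W \<longrightarrow>
      emeasure M E \<le> ennreal (1 + \<epsilon>) * emeasure N E \<and> emeasure N E \<le> ennreal (1 + \<epsilon>) * emeasure M E)"
    and E: "E \<in> sets borel" "E \<subseteq> U"
  shows "emeasure M E = emeasure N E"
proof -
  have lim: "x \<le> y" if *: "\<And>\<epsilon>::real. 0 < \<epsilon> \<Longrightarrow> x \<le> ennreal (1 + \<epsilon>) * y" for x y :: ennreal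
  proof (rule ennreal_le_epsilon)
    fix e :: real assume e: "0 < e" and y: "y < top"
    then obtain r where r: "0 \<le> r" "y = ennreal r" by (cases y) auto
    \<comment> \<open>The summand 1 keeps the denominator positive when \<open>y\<close> is
      0.\<close>
    have "x \<le> ennreal (1 + e / (r + 1)) * y" using e r by (intro *) simp
    also have "\<dots> = ennreal ((1 + e / (r + 1)) * r)" unfolding r(2) using r e by (intro ennreal_mult[symmetric]) auto
    also have "\<dots> \<le> ennreal (r + e)"
      using r e by (intro ennreal_leI) (simp add: field_simps)
    also have "\<dots> = y + ennreal e" using r e by simp
    finally show "x \<le> y + ennreal e" .
  qed
  have glob: "emeasure M E \<le> ennreal (1 + \<epsilon>) * emeasure N E \<and> emeasure N E \<le> ennreal (1 + \<epsilon>) * emeasure M E"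
    if \<epsilon>: "0 < \<epsilon>" for \<epsilon>
  proof -
    obtain W where W: "\<And>a. a \<in> U \<Longrightarrow> open (W a) \<and> a \<in> W a \<and> (\<forall>E\<in>sets borel. E \<subseteq> U \<inter> W a \<longrightarrow>
      emeasure M E \<le> ennreal (1 + \<epsilon>) * emeasure N E \<and> emeasure N E \<le> ennreal (1 + \<epsilon>) * emeasure M E)"
      using loc[OF \<epsilon>] by metis
    obtain \<F> where \<F>: "\<F> \<subseteq> W ` U" "countable \<F>" "\<Union>\<F> = \<Union>(W ` U)"
      using Lindelof[of "W ` U"] W by blast
    show ?thesis
    proof (cases "\<F> = {}")
      case True
      then have "E = {}" using \<F>(3) W E(2) by blast
      then show ?thesis by simp
    next
      case False
      define f where "f = from_nat_into \<F>"
      have f: "f i \<in> \<F>" for i unfolding f_def by (rule from_nat_into[OF False])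
      have rf: "range f = \<F>" unfolding f_def by (rule range_from_nat_into[OF False \<F>(2)])
      have fo: "f i \<in> sets borel" for i using f[of i] \<F>(1) W by auto
      define D where "D i = E \<inter> disjointed f i" for i
      have Dm: "D i \<in> sets borel" for i
      proof -
        have "range (disjointed f) \<subseteq> sets borel"
          using fo by (intro sets.range_disjointed_sets) auto
        then show ?thesis unfolding D_def using E(1) by auto
      qed
      have disj: "disjoint_family D"
        using disjoint_family_disjointed[of f] unfolding D_def disjoint_family_on_def by blast
      have UD: "(\<Union>i. D i) = E"
      proof -
        have "(\<Union>i. D i) = E \<inter> (\<Union>i. disjointed f i)" by (auto simp: D_def)
        also have "\<dots> = E \<inter> \<Union>\<F>" by (simp add: UN_disjointed_eq rf)
        also have "\<dots> = E" using W E(2) \<F>(3) by blast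
        finally show ?thesis .
      qed
      have each: "emeasure M (D i) \<le> ennreal (1 + \<epsilon>) * emeasure N (D i)
          \<and> emeasure N (D i) \<le> ennreal (1 + \<epsilon>) * emeasure M (D i)" for i
      proof -
        obtain a where a: "a \<in> U" "f i = W a" using f[of i] \<F>(1) by blast
        have "D i \<subseteq> U \<inter> W a" using E(2) disjointed_subset[of f i] unfolding D_def a(2)[symmetric] by blast
        then show ?thesis using W[OF a(1)] Dm by blast
      qed
      have sumM: "emeasure M E = (\<Sum>i. emeasure M (D i))"
        unfolding UD[symmetric] using Dm disj by (intro suminf_emeasure[symmetric]) (auto simp: s1)
      have sumN: "emeasure N E = (\<Sum>i. emeasure N (D i))"
        unfolding UD[symmetric] using Dm disj by (intro suminf_emeasure[symmetric]) (auto simp: s2)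
      show ?thesis
        unfolding sumM sumN ennreal_suminf_cmult[symmetric] by (intro conjI suminf_le) (use each in auto)
    qed
  qed
  show ?thesis
  proof (rule antisym)
    show "emeasure M E \<le> emeasure N E" by (rule lim) (rule glob[THEN conjunct1])
    show "emeasure N E \<le> emeasure M E" by (rule lim) (rule glob[THEN conjunct2])
  qed
qed

text \<open>These are the error factors in the comparison of a graph with its tangent hyperplane:
  the power \<open>k\<close> comes from the Lipschitz constants \<open>1 + \<eta>\<close> and
  \<open>1 / (1 - \<eta>)\<close>, the single factor from the oscillation of the area
  density.\<close>

lemma exists_small_ratio:
  fixes \<epsilon> :: real assumes "0 < \<epsilon>"
  obtains \<eta> where "0 < \<eta>" "\<eta> < 1" "(1 + \<eta>) ^ k * (1 + \<eta>) \<le> 1 + \<epsilon>" "(1 / (1 - \<eta>)) ^ k * (1 + \<eta>) \<le> 1 + \<epsilon>"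
proof -
  have "((\<lambda>\<eta>. (1 + \<eta>) ^ k * (1 + \<eta>)) \<longlongrightarrow> (1 + 0) ^ k * (1 + 0)) (at_right (0::real))"
    by (intro tendsto_intros)
  then have 1: "\<forall>\<^sub>F \<eta> in at_right (0::real). (1 + \<eta>) ^ k * (1 + \<eta>) < 1 + \<epsilon>"
    using assms by (intro order_tendstoD(2)) auto
  have "((\<lambda>\<eta>. (1 / (1 - \<eta>)) ^ k * (1 + \<eta>)) \<longlongrightarrow> (1 / (1 - 0)) ^ k * (1 + 0)) (at_right (0::real))"
    by (intro tendsto_intros) simp
  then have 2: "\<forall>\<^sub>F \<eta> in at_right (0::real). (1 / (1 - \<eta>)) ^ k * (1 + \<eta>) < 1 + \<epsilon>"
    using assms by (intro order_tendstoD(2)) auto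
  have 3: "\<forall>\<^sub>F \<eta> in at_right (0::real). 0 < \<eta> \<and> \<eta> < 1"
    using eventually_at_right[of "0::real" 1] by (auto intro!: exI[of _ 1])
  have "\<forall>\<^sub>F \<eta> in at_right (0::real). (1 + \<eta>) ^ k * (1 + \<eta>) < 1 + \<epsilon> \<and>
      (1 / (1 - \<eta>)) ^ k * (1 + \<eta>) < 1 + \<epsilon> \<and> 0 < \<eta> \<and> \<eta> < 1"
    using 1 2 3 by eventually_elim simp
  then obtain \<eta> where "(1 + \<eta>) ^ k * (1 + \<eta>) < 1 + \<epsilon> \<and>
      (1 / (1 - \<eta>)) ^ k * (1 + \<eta>) < 1 + \<epsilon> \<and> 0 < \<eta> \<and> \<eta> < 1"
    using eventually_happens' trivial_limit_at_right_real by blast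
  then show thesis using that by force
qed


text \<open>Described through \<open>perp_part u\<close>, the image becomes the solution set of an
  equation between Borel functions, once \<open>F\<close> is extended by 0 outside
  \<open>U\<close>.\<close>

lemma graph_image_borel:
  fixes u :: "'a::euclidean_space"
  assumes u: "norm u = 1" and U: "U \<in> sets borel" "\<And>x. x \<in> U \<Longrightarrow> x \<bullet> u = 0"
    and F: "continuous_on U F" and X: "X \<in> sets borel" "X \<subseteq> U"
  shows "graph_map u F ` X \<in> sets borel"
proof -
  define F' where "F' x = indicator U x *\<^sub>R F x" for x
  have [measurable]: "F' \<in> borel_measurable borel"
    unfolding F'_def by (rule borel_measurable_continuous_on_indicator[OF U(1) F])
  note [measurable] = X(1)
  have "graph_map u F ` X = {y. perp_part u y \<in> X \<and> y \<bullet> u = F (perp_part u y)}"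
    using U(2) X(2) by (intro graph_map_image_eq[OF u]) auto
  also have "\<dots> = {y. perp_part u y \<in> X \<and> y \<bullet> u = F' (perp_part u y)}"
    using X(2) by (auto simp: F'_def)
  also have "\<dots> \<in> sets borel" by measurable
  finally show ?thesis .
qed

lemma emeasure_distr_hausdorff_graph:
  fixes u :: "'a::euclidean_space"
  assumes u: "norm u = 1" and U: "U \<in> sets borel" "\<And>x. x \<in> U \<Longrightarrow> x \<bullet> u = 0"
    and F: "continuous_on U F" and X: "X \<in> sets borel"
  shows "emeasure (distr (density (hausdorff_measure k) (indicator (graph_map u F ` U))) borel (perp_part u)) X
    = hausdorff_outer k (graph_map u F ` (U \<inter> X))"
proof -
  let ?\<Phi> = "graph_map u F"
  have UX: "U \<inter> X \<in> sets borel" using U(1) X by blast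
  have pX: "perp_part u -` X \<in> sets borel" by (rule measurable_sets_borel[OF perp_part_measurable X])
  note [measurable] = X graph_image_borel[OF u U F U(1) subset_refl]
  have "emeasure (distr (density (hausdorff_measure k) (indicator (?\<Phi> ` U))) borel (perp_part u)) X
      = emeasure (density (hausdorff_measure k) (indicator (?\<Phi> ` U))) (perp_part u -` X)"
    by (subst emeasure_distr) auto
  also have "\<dots> = (\<integral>\<^sup>+x. indicator (?\<Phi> ` U) x * indicator (perp_part u -` X) x \<partial>hausdorff_measure k)"
    by (rule emeasure_density) (use pX in auto)
  also have "\<dots> = (\<integral>\<^sup>+x. indicator (?\<Phi> ` (U \<inter> X)) x \<partial>hausdorff_measure k)"
  proof (rule nn_integral_cong)
    fix y
    have "y \<in> ?\<Phi> ` U \<and> y \<in> perp_part u -` X \<longleftrightarrow> y \<in> ?\<Phi> ` (U \<inter> X)"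
    proof
      assume y: "y \<in> ?\<Phi> ` U \<and> y \<in> perp_part u -` X"
      then obtain x where x: "x \<in> U" "y = ?\<Phi> x" by blast
      then have "x \<in> X" using y perp_part_graph_map[OF u U(2)[OF x(1)], of F] by simp
      then show "y \<in> ?\<Phi> ` (U \<inter> X)" using x by blast
    next
      assume "y \<in> ?\<Phi> ` (U \<inter> X)"
      then obtain x where x: "x \<in> X" "x \<in> U" "y = ?\<Phi> x" by blast
      have "perp_part u y = x" using perp_part_graph_map[OF u U(2)[OF x(2)], of F] x by simp
      then show "y \<in> ?\<Phi> ` U \<and> y \<in> perp_part u -` X" using x by auto
    qed
    then show "indicator (?\<Phi> ` U) y * indicator (perp_part u -` X) y = (indicator (?\<Phi> ` (U \<inter> X)) y :: ennreal)"
      by (auto simp: indicator_def)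
  qed
  also have "\<dots> = hausdorff_outer k (?\<Phi> ` (U \<inter> X))"
    using graph_image_borel[OF u U F UX Int_lower1] by (simp add: emeasure_hausdorff_measure)
  finally show ?thesis .
qed

text \<open>Near a point \<open>a\<close> the graph is a slight bi-Lipschitz distortion of the
  hyperplane of slope \<open>q a\<close>, whose area is known, and the density varies little. Both
  errors are controlled by the oscillation of \<open>q\<close> alone.\<close>

theorem hausdorff_outer_concave_graph:
  fixes u :: "real^'n" and F :: "real^'n \<Rightarrow> real" and q :: "real^'n \<Rightarrow> real^'n"
  assumes u: "norm u = 1" and U: "U \<in> sets borel" "\<And>x. x \<in> U \<Longrightarrow> x \<bullet> u = 0"
    and q: "\<And>x. x \<in> U \<Longrightarrow> q x \<bullet> u = 0" "continuous_on U q"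
    and sup: "\<And>x y. x \<in> U \<Longrightarrow> y \<in> U \<Longrightarrow> F y \<le> F x + q x \<bullet> (y - x)"
    and F: "continuous_on U F"
    and E: "E \<in> sets borel" "E \<subseteq> U"
  shows "hausdorff_outer (CARD('n) - 1) (graph_map u F ` E)
    = (\<integral>\<^sup>+x. indicator E x * (hausdorff_ratio u * ennreal (sqrt (1 + (norm (q x))\<^sup>2))) \<partial>perp_lborel u)"
    and "graph_map u F ` E \<in> sets borel"
proof -
  let ?k = "CARD('n) - 1" and ?\<Phi> = "graph_map u F" and ?\<kappa> = "hausdorff_ratio u"
  define J where "J x = sqrt (1 + (norm (q x))\<^sup>2)" for x
  have J1: "1 \<le> J x" for x by (simp add: J_def)
  note [measurable] = U(1)
  define J' where "J' x = indicator U x *\<^sub>R J x" for x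
  have J'[measurable]: "J' \<in> borel_measurable borel"
    unfolding J'_def J_def
    by (intro borel_measurable_continuous_on_indicator[OF U(1)] continuous_intros q(2))
  have \<Phi>B: "?\<Phi> ` X \<in> sets borel" if "X \<in> sets borel" "X \<subseteq> U" for X
    by (rule graph_image_borel[OF u U F that])
  define M where "M = distr (density (hausdorff_measure ?k) (indicator (?\<Phi> ` U))) borel (perp_part u)"
  define N where "N = density (perp_lborel u) (\<lambda>x. ?\<kappa> * ennreal (J' x))"
  have sM: "sets M = sets borel" by (simp add: M_def)
  have sN: "sets N = sets borel" by (simp add: N_def)
  have eM: "emeasure M X = hausdorff_outer ?k (?\<Phi> ` X)" if X: "X \<in> sets borel" and XU: "X \<subseteq> U" for X
    unfolding M_def
    by (rule trans[OF emeasure_distr_hausdorff_graph[OF u U F X]]) (use XU in \<open>simp_all add: Int_absorb1\<close>)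
  have eN: "emeasure N X = (\<integral>\<^sup>+x. indicator X x * (?\<kappa> * ennreal (J x)) \<partial>perp_lborel u)"
    if X[measurable]: "X \<in> sets borel" and XU: "X \<subseteq> U" for X
  proof -
    have "emeasure N X = (\<integral>\<^sup>+x. (?\<kappa> * ennreal (J' x)) * indicator X x \<partial>perp_lborel u)"
      unfolding N_def by (rule emeasure_density) auto
    also have "\<dots> = (\<integral>\<^sup>+x. indicator X x * (?\<kappa> * ennreal (J x)) \<partial>perp_lborel u)"
      using XU by (intro nn_integral_cong) (auto simp: indicator_def J'_def)
    finally show ?thesis .
  qed
  have loc: "\<exists>W. open W \<and> a \<in> W \<and> (\<forall>E\<in>sets borel. E \<subseteq> U \<inter> W \<longrightarrow>
      emeasure M E \<le> ennreal (1 + \<epsilon>) * emeasure N E \<and> emeasure N E \<le> ennreal (1 + \<epsilon>) * emeasure M E)"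
    if \<epsilon>: "0 < \<epsilon>" and a: "a \<in> U" for \<epsilon> a
  proof -
    obtain \<eta> where \<eta>: "0 < \<eta>" "\<eta> < 1" "(1 + \<eta>) ^ ?k * (1 + \<eta>) \<le> 1 + \<epsilon>"
        "(1 / (1 - \<eta>)) ^ ?k * (1 + \<eta>) \<le> 1 + \<epsilon>"
      using exists_small_ratio[OF \<epsilon>] by blast
    obtain d where d: "0 < d" "\<And>x. x \<in> U \<Longrightarrow> dist x a < d \<Longrightarrow> dist (q x) (q a) < \<eta>"
      using q(2) a \<eta>(1) unfolding continuous_on_iff by blast
    let ?L = "graph_map u (\<lambda>x. q a \<bullet> x)"
    have main: "emeasure M X \<le> ennreal (1 + \<epsilon>) * emeasure N X \<and> emeasure N X \<le> ennreal (1 + \<epsilon>) * emeasure M X"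
      if X: "X \<in> sets borel" and XU: "X \<subseteq> U \<inter> ball a d" for X
    proof -
      note [measurable] = X
      have XU': "X \<subseteq> U" using XU by blast
      have X0: "x \<bullet> u = 0" if "x \<in> X" for x using U(2) XU' that by blast
      have near: "norm (q x - q a) \<le> \<eta>" if "x \<in> X" for x
        using d(2)[of x] that XU by (force simp: dist_norm norm_minus_commute)
      have lin: "?L x - ?L y = (x - y) + (q a \<bullet> (x - y)) *\<^sub>R u" for x y
        by (simp add: graph_map_def inner_diff_right algebra_simps)
      have Lxy: "norm (x - y) \<le> norm (?L x - ?L y)" if "x \<in> X" "y \<in> X" for x y
      proof -
        have "perp_part u (?L x - ?L y) = x - y"
          unfolding lin perp_part_add_dir[OF u]
          using X0[OF that(1)] X0[OF that(2)] by (intro perp_part_eq) (simp add: inner_diff_left)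
        then show ?thesis using norm_perp_part_le[OF u, of "?L x - ?L y"] by simp
      qed
      \<comment> \<open>The supergradient inequality at \<open>y\<close> bounds
        \<open>F x - F y\<close> from above, the one at \<open>x\<close> from below, and both slopes
        are within \<eta> of \<open>q a\<close>.\<close>
      have D: "\<bar>F x - F y - q a \<bullet> (x - y)\<bar> \<le> \<eta> * norm (?L x - ?L y)" if xy: "x \<in> X" "y \<in> X" for x y
      proof -
        have c1: "\<bar>(q x - q a) \<bullet> (x - y)\<bar> \<le> \<eta> * norm (x - y)"
          by (rule order_trans[OF Cauchy_Schwarz_ineq2]) (intro mult_right_mono near xy norm_ge_zero)
        have c2: "\<bar>(q y - q a) \<bullet> (x - y)\<bar> \<le> \<eta> * norm (x - y)"
          by (rule order_trans[OF Cauchy_Schwarz_ineq2]) (intro mult_right_mono near xy norm_ge_zero)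
        have "F x \<le> F y + q y \<bullet> (x - y)" "F y \<le> F x + q x \<bullet> (y - x)"
          using xy XU' by (auto intro: sup)
        moreover have "q x \<bullet> (y - x) = - (q x \<bullet> (x - y))" by (metis inner_minus_right minus_diff_eq)
        ultimately have "\<bar>F x - F y - q a \<bullet> (x - y)\<bar> \<le> \<eta> * norm (x - y)"
          using c1 c2 unfolding inner_diff_left by linarith
        also have "\<dots> \<le> \<eta> * norm (?L x - ?L y)" using Lxy[OF xy] \<eta>(1) by simp
        finally show ?thesis .
      qed
      have \<Phi>L: "?\<Phi> x - ?\<Phi> y = (?L x - ?L y) + (F x - F y - q a \<bullet> (x - y)) *\<^sub>R u" for x y
        unfolding lin by (simp add: graph_map_def algebra_simps)
      have up: "dist (?\<Phi> x) (?\<Phi> y) \<le> (1 + \<eta>) * dist (?L x) (?L y)" if xy: "x \<in> X" "y \<in> X" for x y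
      proof -
        have "norm (?\<Phi> x - ?\<Phi> y) \<le> norm (?L x - ?L y) + norm ((F x - F y - q a \<bullet> (x - y)) *\<^sub>R u)"
          unfolding \<Phi>L by (rule norm_triangle_ineq)
        then show ?thesis using D[OF xy] unfolding norm_scaleR u dist_norm by (simp add: algebra_simps)
      qed
      have dn: "dist (?L x) (?L y) \<le> (1 / (1 - \<eta>)) * dist (?\<Phi> x) (?\<Phi> y)" if xy: "x \<in> X" "y \<in> X" for x y
      proof -
        have "norm (?L x - ?L y) - norm ((F x - F y - q a \<bullet> (x - y)) *\<^sub>R u) \<le> norm (?\<Phi> x - ?\<Phi> y)"
          unfolding \<Phi>L by (rule norm_diff_ineq)
        then have "(1 - \<eta>) * norm (?L x - ?L y) \<le> norm (?\<Phi> x - ?\<Phi> y)"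
          using D[OF xy] unfolding norm_scaleR u by (simp add: algebra_simps)
        then show ?thesis using \<eta>(2) unfolding dist_norm by (simp add: field_simps)
      qed
      let ?l = "emeasure (perp_lborel u) X"
      have HL: "hausdorff_outer ?k (?L ` X) = ?\<kappa> * (ennreal (J a) * ?l)"
        unfolding J_def by (rule hausdorff_outer_linear_graph[OF u q(1)[OF a] X X0])
      have Jx: "J x \<le> (1 + \<eta>) * J a" "J a \<le> (1 + \<eta>) * J x" if x: "x \<in> X" for x
      proof -
        \<comment> \<open>As the length of \<open>q x + u\<close>, the density is 1-Lipschitz in
          \<open>q x\<close>. Since it is at least 1, the additive error \<eta> is also a relative
          one.\<close>
        have Jn: "J x = norm (q x + u)" if "x \<in> U" for x
        proof -
          have "q x \<bullet> u = 0" "u \<bullet> q x = 0" using q(1)[OF that] by (auto simp: inner_commute)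
          then have "(norm (q x + u))\<^sup>2 = 1 + (norm (q x))\<^sup>2"
            unfolding power2_norm_eq_inner inner_add_left inner_add_right using unit_inner_self[OF u] by simp
          then show ?thesis by (simp add: J_def real_sqrt_unique)
        qed
        have "\<bar>J x - J a\<bar> \<le> norm (q x - q a)"
          using norm_triangle_ineq3[of "q x + u" "q a + u"] x XU' a by (simp add: Jn subset_iff)
        then have *: "\<bar>J x - J a\<bar> \<le> \<eta>" using near[OF x] by linarith
        have "\<eta> \<le> \<eta> * J a" "\<eta> \<le> \<eta> * J x" using J1 \<eta>(1) by simp_all
        then show "J x \<le> (1 + \<eta>) * J a" "J a \<le> (1 + \<eta>) * J x"
          using * unfolding distrib_right mult_1 by linarith+
      qed
      have I1: "emeasure N X \<le> ennreal (1 + \<eta>) * hausdorff_outer ?k (?L ` X)"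
      proof -
        have "emeasure N X = (\<integral>\<^sup>+x. indicator X x * (?\<kappa> * ennreal (J x)) \<partial>perp_lborel u)" by (rule eN[OF X XU'])
        also have "\<dots> \<le> (\<integral>\<^sup>+x. (?\<kappa> * ennreal ((1 + \<eta>) * J a)) * indicator X x \<partial>perp_lborel u)"
          by (intro nn_integral_mono) (auto simp: indicator_def intro!: mult_left_mono ennreal_leI Jx)
        also have "\<dots> = (?\<kappa> * ennreal ((1 + \<eta>) * J a)) * ?l"
          using X by (intro nn_integral_cmult_indicator) simp
        also have "ennreal ((1 + \<eta>) * J a) = ennreal (1 + \<eta>) * ennreal (J a)"
          using \<eta>(1) J1[of a] by (intro ennreal_mult) auto
        finally show ?thesis unfolding HL by (simp only: mult_ac)
      qed
      have I2: "hausdorff_outer ?k (?L ` X) \<le> ennreal (1 + \<eta>) * emeasure N X"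
      proof -
        have "hausdorff_outer ?k (?L ` X) = (\<integral>\<^sup>+x. (?\<kappa> * ennreal (J a)) * indicator X x \<partial>perp_lborel u)"
          unfolding HL using X by (subst nn_integral_cmult_indicator) (simp_all add: mult_ac)
        also have "\<dots> \<le> (\<integral>\<^sup>+x. ennreal (1 + \<eta>) * ((?\<kappa> * ennreal (J' x)) * indicator X x) \<partial>perp_lborel u)"
        proof (intro nn_integral_mono)
          fix x
          show "?\<kappa> * ennreal (J a) * indicator X x \<le> ennreal (1 + \<eta>) * (?\<kappa> * ennreal (J' x) * indicator X x)"
          proof (cases "x \<in> X")
            case True
            then have "J' x = J x" using XU' by (auto simp: J'_def)
            have "?\<kappa> * ennreal (J a) \<le> ?\<kappa> * ennreal ((1 + \<eta>) * J x)"
              by (intro mult_left_mono ennreal_leI Jx True) simp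
            also have "\<dots> = ennreal (1 + \<eta>) * (?\<kappa> * ennreal (J x))"
              using \<eta>(1) J1[of x] by (subst ennreal_mult) (auto simp: mult.left_commute)
            finally show ?thesis using True \<open>J' x = J x\<close> by (simp add: indicator_def)
          qed simp
        qed
        also have "\<dots> = ennreal (1 + \<eta>) * (\<integral>\<^sup>+x. (?\<kappa> * ennreal (J' x)) * indicator X x \<partial>perp_lborel u)"
          by (intro nn_integral_cmult) measurable
        also have "(\<integral>\<^sup>+x. (?\<kappa> * ennreal (J' x)) * indicator X x \<partial>perp_lborel u) = emeasure N X"
          unfolding N_def using X by (intro emeasure_density[symmetric]) auto
        finally show ?thesis .
      qed
      have \<eta>': "0 < 1 + \<eta>" "0 < 1 / (1 - \<eta>)" using \<eta> by auto
      have "emeasure M X \<le> ennreal ((1 + \<eta>) ^ ?k) * hausdorff_outer ?k (?L ` X)"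
        unfolding eM[OF X XU'] by (rule hausdorff_outer_lipschitz[OF \<eta>'(1) up])
      also have "\<dots> \<le> ennreal ((1 + \<eta>) ^ ?k) * (ennreal (1 + \<eta>) * emeasure N X)"
        by (intro mult_left_mono I2) simp
      also have "\<dots> = ennreal ((1 + \<eta>) ^ ?k * (1 + \<eta>)) * emeasure N X"
        using \<eta>' by (subst ennreal_mult) (simp_all add: mult.assoc)
      also have "\<dots> \<le> ennreal (1 + \<epsilon>) * emeasure N X" by (intro mult_right_mono ennreal_leI \<eta>) simp
      finally have A: "emeasure M X \<le> ennreal (1 + \<epsilon>) * emeasure N X" .
      have "emeasure N X \<le> ennreal (1 + \<eta>) * (ennreal ((1 / (1 - \<eta>)) ^ ?k) * hausdorff_outer ?k (?\<Phi> ` X))"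
        by (rule order_trans[OF I1], intro mult_left_mono hausdorff_outer_lipschitz[OF \<eta>'(2) dn]) auto
      also have "\<dots> = ennreal ((1 / (1 - \<eta>)) ^ ?k * (1 + \<eta>)) * emeasure M X"
        unfolding eM[OF X XU'] using \<eta>' by (subst ennreal_mult) (simp_all only: mult_ac, simp_all)
      also have "\<dots> \<le> ennreal (1 + \<epsilon>) * emeasure M X" by (intro mult_right_mono ennreal_leI \<eta>) simp
      finally show ?thesis using A by simp
    qed
    show ?thesis using main d(1) by (intro exI[of _ "ball a d"]) auto
  qed
  have "emeasure M E = emeasure N E"
    by (rule emeasure_eq_of_local_ratio[OF sM sN loc E])
  then show "hausdorff_outer ?k (?\<Phi> ` E)
    = (\<integral>\<^sup>+x. indicator E x * (?\<kappa> * ennreal (sqrt (1 + (norm (q x))\<^sup>2))) \<partial>perp_lborel u)"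
    unfolding eM[OF E] eN[OF E] J_def .
  show "?\<Phi> ` E \<in> sets borel" by (rule \<Phi>B[OF E])
qed

text \<open>The formula for sets says that \<open>perp_part u\<close> carries Hausdorff measure on
  the graph to a measure with a density on the hyperplane. Integrands are transported along, since
  \<open>perp_part u\<close> inverts \<open>graph_map u F\<close> over \<open>U\<close>.\<close>

lemma nn_integral_hausdorff_concave_graph:
  fixes u :: "real^'n" and F :: "real^'n \<Rightarrow> real" and q :: "real^'n \<Rightarrow> real^'n"
  assumes u: "norm u = 1" and U: "U \<in> sets borel" "\<And>x. x \<in> U \<Longrightarrow> x \<bullet> u = 0"
    and q: "\<And>x. x \<in> U \<Longrightarrow> q x \<bullet> u = 0" "continuous_on U q"
    and sup: "\<And>x y. x \<in> U \<Longrightarrow> y \<in> U \<Longrightarrow> F y \<le> F x + q x \<bullet> (y - x)"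
    and F: "continuous_on U F"
    and \<phi>[measurable]: "\<phi> \<in> borel_measurable borel"
  shows "(\<integral>\<^sup>+y. indicator (graph_map u F ` U) y * \<phi> y \<partial>hausdorff_measure (CARD('n) - 1))
    = (\<integral>\<^sup>+x. indicator U x * (hausdorff_ratio u * ennreal (sqrt (1 + (norm (q x))\<^sup>2))) * \<phi> (graph_map u F x)
        \<partial>perp_lborel u)"
proof -
  let ?k = "CARD('n) - 1" and ?\<Phi> = "graph_map u F" and ?\<kappa> = "hausdorff_ratio u"
  define J where "J x = sqrt (1 + (norm (q x))\<^sup>2)" for x
  have area: "hausdorff_outer ?k (?\<Phi> ` E)
      = (\<integral>\<^sup>+x. indicator E x * (?\<kappa> * ennreal (J x)) \<partial>perp_lborel u)"
    and area_borel: "?\<Phi> ` E \<in> sets borel" if "E \<in> sets borel" "E \<subseteq> U" for E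
    using hausdorff_outer_concave_graph[of u U q F E] u U q sup F that unfolding J_def by blast+
  note [measurable] = U(1) area_borel[OF U(1) subset_refl]
  define F' where "F' x = indicator U x *\<^sub>R F x" for x
  define J' where "J' x = indicator U x *\<^sub>R J x" for x
  have F'[measurable]: "F' \<in> borel_measurable borel"
    unfolding F'_def by (rule borel_measurable_continuous_on_indicator[OF U(1) F])
  have J'[measurable]: "J' \<in> borel_measurable borel"
    unfolding J'_def J_def
    by (intro borel_measurable_continuous_on_indicator[OF U(1)] continuous_intros q(2))
  define M where "M = distr (density (hausdorff_measure ?k) (indicator (?\<Phi> ` U))) borel (perp_part u)"
  define N where "N = density (perp_lborel u) (\<lambda>x. ?\<kappa> * ennreal (J' x))"
  have "M = N"
  proof (rule measure_eqI)
    show "sets M = sets N" by (simp add: M_def N_def)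
    fix X assume "X \<in> sets M"
    then have X[measurable]: "X \<in> sets borel" by (simp add: M_def)
    have UX: "U \<inter> X \<in> sets borel" "U \<inter> X \<subseteq> U" by auto
    have "emeasure M X = hausdorff_outer ?k (?\<Phi> ` (U \<inter> X))"
      unfolding M_def by (rule emeasure_distr_hausdorff_graph[OF u U F X])
    also have "\<dots> = (\<integral>\<^sup>+x. indicator (U \<inter> X) x * (?\<kappa> * ennreal (J x)) \<partial>perp_lborel u)"
      by (rule area[OF UX])
    also have "\<dots> = (\<integral>\<^sup>+x. (?\<kappa> * ennreal (J' x)) * indicator X x \<partial>perp_lborel u)"
      by (intro nn_integral_cong) (auto simp: indicator_def J'_def)
    also have "\<dots> = emeasure N X" unfolding N_def by (rule emeasure_density[symmetric]) auto
    finally show "emeasure M X = emeasure N X" .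
  qed
  have [measurable]: "graph_map u F' \<in> borel_measurable borel" unfolding graph_map_def[abs_def] by measurable
  have "(\<integral>\<^sup>+y. indicator (?\<Phi> ` U) y * \<phi> y \<partial>hausdorff_measure ?k)
      = (\<integral>\<^sup>+y. indicator (?\<Phi> ` U) y * \<phi> (graph_map u F' (perp_part u y)) \<partial>hausdorff_measure ?k)"
  proof (rule nn_integral_cong)
    fix y
    show "indicator (?\<Phi> ` U) y * \<phi> y = indicator (?\<Phi> ` U) y * \<phi> (graph_map u F' (perp_part u y))"
    proof (cases "y \<in> ?\<Phi> ` U")
      case True
      then obtain x where x: "x \<in> U" "y = ?\<Phi> x" by blast
      have "perp_part u y = x" using perp_part_graph_map[OF u U(2)[OF x(1)], of F] x by simp
      then have "graph_map u F' (perp_part u y) = y" using x by (simp add: graph_map_def F'_def)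
      then show ?thesis by simp
    qed simp
  qed
  also have "\<dots> = (\<integral>\<^sup>+y. \<phi> (graph_map u F' (perp_part u y)) \<partial>density (hausdorff_measure ?k) (indicator (?\<Phi> ` U)))"
    by (rule nn_integral_density[symmetric]) measurable
  also have "\<dots> = (\<integral>\<^sup>+x. \<phi> (graph_map u F' x) \<partial>M)"
    unfolding M_def by (rule nn_integral_distr[symmetric]) measurable
  also have "\<dots> = (\<integral>\<^sup>+x. (?\<kappa> * ennreal (J' x)) * \<phi> (graph_map u F' x) \<partial>perp_lborel u)"
    unfolding \<open>M = N\<close> N_def by (rule nn_integral_density) measurable
  also have "\<dots> = (\<integral>\<^sup>+x. indicator U x * (?\<kappa> * ennreal (J x)) * \<phi> (?\<Phi> x) \<partial>perp_lborel u)"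
    by (intro nn_integral_cong) (auto simp: indicator_def J'_def F'_def graph_map_def)
  finally show ?thesis unfolding J_def .
qed

section \<open>Surface area measure of a body bounded by two graphs\<close>

lemma closed_outer_unit_normal:
  fixes M :: "'a::euclidean_space set"
  assumes M: "closed M"
  shows "closed {(x, \<theta>). outer_unit_normal M x \<theta>}"
proof -
  have "{(x, \<theta>). outer_unit_normal M x \<theta>}
      = (M \<times> sphere 0 1) \<inter> (\<Inter>y\<in>M. {z. y \<bullet> snd z \<le> fst z \<bullet> snd z})"
    by (auto simp: outer_unit_normal_def)
  also have "closed \<dots>"
    by (intro closed_Int closed_Times M closed_sphere closed_INT ballI closed_Collect_le continuous_intros)
  finally show ?thesis .
qed

text \<open>Points with two normals at distance at least \<open>1 / Suc n\<close> form a compact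
  set, being a projection of one. Removing these countably many sets from the boundary points that
  have a normal leaves those with exactly one.\<close>

lemma regular_boundary_borel:
  fixes M :: "'a::euclidean_space set"
  assumes M: "compact M"
  shows "regular_boundary M \<in> sets borel"
proof -
  let ?N = "{(x, \<theta>). outer_unit_normal M x \<theta>}"
  have N: "compact ?N"
  proof -
    have "?N \<subseteq> M \<times> sphere 0 1" by (auto simp: outer_unit_normal_def)
    moreover have "compact (M \<times> sphere (0::'a) 1)" by (intro compact_Times M compact_sphere)
    ultimately show ?thesis
      using closed_outer_unit_normal[OF compact_imp_closed[OF M]] by (metis compact_Int_closed inf.absorb2 )
  qed
  define D where "D = fst ` ?N"
  have D: "compact D" unfolding D_def by (intro compact_continuous_image N continuous_intros)
  define T where "T n = fst ` ({z :: ('a \<times> 'a) \<times> ('a \<times> 'a). fst (fst z) = fst (snd z)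
      \<and> 1 / Suc n \<le> dist (snd (fst z)) (snd (snd z))} \<inter> (?N \<times> ?N))" for n
  have T: "compact (fst ` T n)" for n
  proof -
    have "closed {z :: ('a \<times> 'a) \<times> ('a \<times> 'a). fst (fst z) = fst (snd z)
      \<and> 1 / Suc n \<le> dist (snd (fst z)) (snd (snd z))}"
      by (intro closed_Collect_conj closed_Collect_le closed_Collect_eq continuous_intros)
    then have "compact ({z :: ('a \<times> 'a) \<times> ('a \<times> 'a). fst (fst z) = fst (snd z)
      \<and> 1 / Suc n \<le> dist (snd (fst z)) (snd (snd z))} \<inter> (?N \<times> ?N))"
      by (intro closed_Int_compact compact_Times N)
    then show ?thesis unfolding T_def by (intro compact_continuous_image continuous_intros)
  qed
  have "regular_boundary M = (frontier M \<inter> D) - (\<Union>n. fst ` T n)"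
  proof -
    have "x \<in> (\<Union>n. fst ` T n) \<longleftrightarrow> (\<exists>\<theta> \<theta>'. outer_unit_normal M x \<theta> \<and> outer_unit_normal M x \<theta>' \<and> \<theta> \<noteq> \<theta>')" for x
    proof
      assume "x \<in> (\<Union>n. fst ` T n)"
      then obtain n \<theta> \<theta>' where "outer_unit_normal M x \<theta>" "outer_unit_normal M x \<theta>'"
          and d: "1 / Suc n \<le> dist \<theta> \<theta>'"
        unfolding T_def by auto
      moreover have "\<theta> \<noteq> \<theta>'"
      proof
        assume "\<theta> = \<theta>'"
        then have "1 / real (Suc n) \<le> 0" using d by simp
        then show False by simp
      qed
      ultimately show "\<exists>\<theta> \<theta>'. outer_unit_normal M x \<theta> \<and> outer_unit_normal M x \<theta>' \<and> \<theta> \<noteq> \<theta>'" by blast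
    next
      assume "\<exists>\<theta> \<theta>'. outer_unit_normal M x \<theta> \<and> outer_unit_normal M x \<theta>' \<and> \<theta> \<noteq> \<theta>'"
      then obtain \<theta> \<theta>' where *: "outer_unit_normal M x \<theta>" "outer_unit_normal M x \<theta>'" "0 < dist \<theta> \<theta>'" by auto
      obtain n where "inverse (real (Suc n)) < dist \<theta> \<theta>'" using reals_Archimedean[OF *(3)] by blast
      then have "1 / Suc n \<le> dist \<theta> \<theta>'" by (simp add: inverse_eq_divide)
      then have "(x, \<theta>) \<in> T n" using * unfolding T_def by (intro image_eqI[of _ _ "((x,\<theta>),(x,\<theta>'))"]) auto
      then have "x \<in> fst ` T n" by (intro image_eqI[of _ _ "(x, \<theta>)"]) auto
      then show "x \<in> (\<Union>n. fst ` T n)" by blast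
    qed
    moreover have "x \<in> D \<longleftrightarrow> (\<exists>\<theta>. outer_unit_normal M x \<theta>)" for x unfolding D_def by force
    moreover have "(\<exists>!\<theta>. outer_unit_normal M x \<theta>) \<longleftrightarrow> (\<exists>\<theta>. outer_unit_normal M x \<theta>) \<and>
        \<not> (\<exists>\<theta> \<theta>'. outer_unit_normal M x \<theta> \<and> outer_unit_normal M x \<theta>' \<and> \<theta> \<noteq> \<theta>')" for x
      by blast
    ultimately show ?thesis unfolding regular_boundary_def
      by (simp only: set_eq_iff mem_Collect_eq Diff_iff Int_iff) blast
  qed
  moreover have "frontier M \<in> sets borel" by (simp add: borel_closed)
  moreover have "D \<in> sets borel" by (rule borel_compact[OF D])
  moreover have "(\<Union>n. fst ` T n) \<in> sets borel" by (intro sets.countable_UN) (auto intro: borel_compact[OF T])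
  ultimately show ?thesis by auto
qed

lemma gauss_map_normal: "x \<in> regular_boundary M \<Longrightarrow> outer_unit_normal M x (gauss_map M x)"
  unfolding regular_boundary_def gauss_map_def by (auto intro: theI')

lemma gauss_map_eqI:
  "x \<in> regular_boundary M \<Longrightarrow> outer_unit_normal M x \<theta> \<Longrightarrow> gauss_map M x = \<theta>"
  unfolding regular_boundary_def gauss_map_def by (auto intro: the1_equality)

text \<open>A map into a compact space is continuous if its graph is closed. Over the regular
  points, where the normal is unique, the graph is the closed normal relation.\<close>

lemma continuous_on_gauss_map:
  fixes M :: "'a::euclidean_space set"
  assumes M: "compact M"
  shows "continuous_on (regular_boundary M) (gauss_map M)"
proof (rule continuous_closed_graph_eq[of "sphere 0 1", THEN iffD2])
  let ?R = "regular_boundary M"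
  show "gauss_map M \<in> ?R \<rightarrow> sphere 0 1"
    using gauss_map_normal[of _ M] unfolding outer_unit_normal_def by auto
  have "(\<lambda>x. (x, gauss_map M x)) ` ?R = (?R \<times> sphere 0 1) \<inter> {(x, \<theta>). outer_unit_normal M x \<theta>}"
  proof (intro set_eqI iffI)
    fix z assume "z \<in> (\<lambda>x. (x, gauss_map M x)) ` ?R"
    then show "z \<in> (?R \<times> sphere 0 1) \<inter> {(x, \<theta>). outer_unit_normal M x \<theta>}"
      using gauss_map_normal[of _ M] by (auto simp: outer_unit_normal_def)
  next
    fix z assume z: "z \<in> (?R \<times> sphere 0 1) \<inter> {(x, \<theta>). outer_unit_normal M x \<theta>}"
    then have "gauss_map M (fst z) = snd z" by (intro gauss_map_eqI) auto
    with z show "z \<in> (\<lambda>x. (x, gauss_map M x)) ` ?R" by (intro image_eqI[of _ _ "fst z"]) auto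
  qed
  then show "closedin (top_of_set (?R \<times> sphere 0 1)) ((\<lambda>x. (x, gauss_map M x)) ` ?R)"
    using closed_outer_unit_normal[OF compact_imp_closed[OF M]] by (simp only: closedin_closed_Int)
qed (rule compact_sphere)

text \<open>The lower boundary is encoded as the graph of \<open>- G\<close>, so that
  \<open>F\<close> and \<open>G\<close> satisfy the same supergradient inequalities and a change of
  sign of \<open>u\<close> exchanges them. \<open>U\<close> is the open shadow; by
  \<open>flat\<close> the graphs meet over its rim, so the body has no vertical sides.\<close>

locale graph_body =
  fixes u :: "real^'n" and M K' U :: "(real^'n) set" and F G :: "real^'n \<Rightarrow> real"
    and qF qG :: "real^'n \<Rightarrow> real^'n"
  assumes u: "norm u = 1" and cb: "convex_body M"
    and M_eq: "M = {x + s *\<^sub>R u | x s. x \<in> K' \<and> - G x \<le> s \<and> s \<le> F x}"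
    and K'_perp: "\<And>x. x \<in> K' \<Longrightarrow> x \<bullet> u = 0"
    and U_sub: "U \<subseteq> K'" and U_open: "\<exists>C. open C \<and> U = C \<inter> {x. x \<bullet> u = 0}"
    and pos: "\<And>x. x \<in> U \<Longrightarrow> - G x < F x"
    and flat: "\<And>x. x \<in> K' \<Longrightarrow> x \<notin> U \<Longrightarrow> - G x = F x"
    and sup_F: "\<And>x z. x \<in> U \<Longrightarrow> z \<in> K' \<Longrightarrow> F z \<le> F x + qF x \<bullet> (z - x)"
    and sup_G: "\<And>x z. x \<in> U \<Longrightarrow> z \<in> K' \<Longrightarrow> G z \<le> G x + qG x \<bullet> (z - x)"
    and qF_perp: "\<And>x. x \<in> U \<Longrightarrow> qF x \<bullet> u = 0" and qG_perp: "\<And>x. x \<in> U \<Longrightarrow> qG x \<bullet> u = 0"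
    and cont_qF: "continuous_on U qF" and cont_qG: "continuous_on U qG"
    and cont_F: "continuous_on U F" and cont_G: "continuous_on U G"
begin

text \<open>Through this instance everything proved for the upper graph holds for the lower
  one.\<close>

lemma flip: "graph_body (- u) M K' U G F qG qF"
proof
  have "{x + s *\<^sub>R u | x s. x \<in> K' \<and> - G x \<le> s \<and> s \<le> F x}
      = {x + s *\<^sub>R (- u) | x s. x \<in> K' \<and> - F x \<le> s \<and> s \<le> G x}" (is "?A = ?B")
  proof (intro set_eqI iffI)
    fix y assume "y \<in> ?A"
    then obtain x s where "x \<in> K'" "- G x \<le> s" "s \<le> F x" "y = x + s *\<^sub>R u" by blast
    then show "y \<in> ?B" by (intro CollectI exI[of _ x] exI[of _ "-s"]) auto
  next
    fix y assume "y \<in> ?B"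
    then obtain x s where "x \<in> K'" "- F x \<le> s" "s \<le> G x" "y = x + s *\<^sub>R (-u)" by blast
    then show "y \<in> ?A" by (intro CollectI exI[of _ x] exI[of _ "-s"]) auto
  qed
  then show "M = {x + s *\<^sub>R (- u) | x s. x \<in> K' \<and> - F x \<le> s \<and> s \<le> G x}" using M_eq by simp
  show "\<And>x. x \<in> U \<Longrightarrow> - F x < G x" using pos by fastforce
  show "\<And>x. x \<in> K' \<Longrightarrow> x \<notin> U \<Longrightarrow> - F x = G x" using flat by fastforce
qed (use u cb K'_perp U_sub U_open sup_F sup_G qF_perp qG_perp cont_qF cont_qG cont_F cont_G in auto)

section \<open>Points and normals of the upper graph\<close>

lemma U_perp: "x \<in> U \<Longrightarrow> x \<bullet> u = 0"
  using K'_perp U_sub by blast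

lemma U_borel: "U \<in> sets borel"
proof -
  obtain C where "open C" "U = C \<inter> {x. x \<bullet> u = 0}" using U_open by blast
  moreover have "closed {x. x \<bullet> u = 0}" by (intro closed_Collect_eq continuous_intros)
  ultimately show ?thesis by (auto intro: borel_open borel_closed)
qed

lemma mem_M: "x \<in> K' \<Longrightarrow> x + s *\<^sub>R u \<in> M \<longleftrightarrow> - G x \<le> s \<and> s \<le> F x"
proof
  assume x: "x \<in> K'" and "x + s *\<^sub>R u \<in> M"
  then obtain x' s' where *: "x' \<in> K'" "- G x' \<le> s'" "s' \<le> F x'" "x + s *\<^sub>R u = x' + s' *\<^sub>R u"
    unfolding M_eq by blast
  have "x = x'" using arg_cong[OF *(4), of "perp_part u"]
    unfolding perp_part_add_dir[OF u] perp_part_eq[OF K'_perp[OF x]] perp_part_eq[OF K'_perp[OF *(1)]] .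
  moreover have "u \<noteq> 0" using u by auto
  ultimately have "s = s'" using *(4) by simp
  with * \<open>x = x'\<close> show "- G x \<le> s \<and> s \<le> F x" by simp
qed (auto simp: M_eq)

lemma M_decomp:
  assumes "y \<in> M"
  shows "perp_part u y \<in> K'" "- G (perp_part u y) \<le> y \<bullet> u" "y \<bullet> u \<le> F (perp_part u y)"
proof -
  obtain x s where xs: "x \<in> K'" "- G x \<le> s" "s \<le> F x" "y = x + s *\<^sub>R u"
    using assms unfolding M_eq by blast
  have 1: "perp_part u y = x" using xs(4) perp_part_add_dir[OF u] perp_part_eq[OF K'_perp[OF xs(1)]] by metis
  have 2: "y \<bullet> u = s" unfolding xs(4) inner_add_left K'_perp[OF xs(1)] inner_scaleR_left
    using unit_inner_self[OF u] by simp
  show "perp_part u y \<in> K'" "- G (perp_part u y) \<le> y \<bullet> u" "y \<bullet> u \<le> F (perp_part u y)"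
    unfolding 1 2 using xs by auto
qed

lemma norm_normal: "x \<in> U \<Longrightarrow> norm (u - qF x) = sqrt (1 + (norm (qF x))\<^sup>2)"
proof -
  assume "x \<in> U"
  then have "qF x \<bullet> u = 0" "u \<bullet> qF x = 0" using qF_perp by (auto simp: inner_commute)
  then have "(norm (u - qF x))\<^sup>2 = 1 + (norm (qF x))\<^sup>2"
    unfolding power2_norm_eq_inner inner_diff_left inner_diff_right using unit_inner_self[OF u] by simp
  then show ?thesis by (simp add: real_sqrt_unique)
qed

lemma normal_nz: "x \<in> U \<Longrightarrow> 1 \<le> norm (u - qF x)"
  by (simp add: norm_normal)

lemma graph_in_M: "x \<in> U \<Longrightarrow> graph_map u F x \<in> M"
  unfolding graph_map_def using mem_M pos U_sub by (auto simp: less_imp_le)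

lemma eventually_in_U:
  assumes "x \<in> U" "z \<bullet> u = 0"
  shows "\<forall>\<^sub>F e in at_right 0. x + e *\<^sub>R z \<in> U"
proof -
  obtain C where C: "open C" "U = C \<inter> {x. x \<bullet> u = 0}" using U_open by blast
  have "((\<lambda>e. x + e *\<^sub>R z) \<longlongrightarrow> x + 0 *\<^sub>R z) (at_right (0::real))" by (intro tendsto_intros)
  then have "\<forall>\<^sub>F e in at_right 0. x + e *\<^sub>R z \<in> C"
    using C assms(1) by (intro topological_tendstoD) auto
  then show ?thesis
  proof eventually_elim
    case (elim e)
    then show ?case using C(2) assms U_perp[OF assms(1)] by (simp add: inner_add_left)
  qed
qed

text \<open>For uniqueness, a normal is tested against nearby points of the graph. No derivative of
  \<open>F\<close> is at hand; instead the supergradient at the displaced point bounds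
  \<open>F\<close> there from below, and continuity of \<open>qF\<close> allows the displacement to
  tend to 0.\<close>

lemma outer_unit_normal_graph:
  assumes x: "x \<in> U"
  shows "outer_unit_normal M (graph_map u F x) \<theta> \<longleftrightarrow> \<theta> = (1 / norm (u - qF x)) *\<^sub>R (u - qF x)"
proof
  have uu: "u \<bullet> u = 1" by (rule unit_inner_self[OF u])
  have xu: "x \<bullet> u = 0" "u \<bullet> x = 0" using U_perp[OF x] by (auto simp: inner_commute)
  have qu: "qF x \<bullet> u = 0" "u \<bullet> qF x = 0" using qF_perp[OF x] by (auto simp: inner_commute)
  have n1: "0 < norm (u - qF x)" using normal_nz[OF x] by linarith
  {
    assume \<theta>: "\<theta> = (1 / norm (u - qF x)) *\<^sub>R (u - qF x)"
    have "y \<bullet> (u - qF x) \<le> graph_map u F x \<bullet> (u - qF x)" if "y \<in> M" for y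
    proof -
      note y = M_decomp[OF that]
      have "y \<bullet> qF x = perp_part u y \<bullet> qF x" by (simp add: perp_part_def inner_diff_left qu)
      moreover have "F (perp_part u y) \<le> F x + qF x \<bullet> (perp_part u y - x)" by (rule sup_F[OF x y(1)])
      ultimately have "y \<bullet> (u - qF x) \<le> F x - x \<bullet> qF x"
        using y(3) by (simp add: inner_diff_right inner_commute)
      also have "\<dots> = graph_map u F x \<bullet> (u - qF x)"
        unfolding graph_map_def by (simp add: inner_diff_right inner_add_left xu uu qu)
      finally show ?thesis .
    qed
    then show "outer_unit_normal M (graph_map u F x) \<theta>"
      unfolding outer_unit_normal_def \<theta> using n1 graph_in_M[OF x] by (auto intro!: divide_right_mono)
  }
  assume \<theta>: "outer_unit_normal M (graph_map u F x) \<theta>"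
  have le: "y \<bullet> \<theta> \<le> graph_map u F x \<bullet> \<theta>" if "y \<in> M" for y using \<theta> that by (simp add: outer_unit_normal_def)
  \<comment> \<open>The opposite point on the same vertical line shows that the normal does not
    point downwards.\<close>
  have "x + (- G x) *\<^sub>R u \<in> M" using mem_M[of x "- G x"] pos[OF x] U_sub x by auto
  from le[OF this] have "(- G x) * (u \<bullet> \<theta>) \<le> F x * (u \<bullet> \<theta>)"
    by (simp add: graph_map_def inner_add_left inner_diff_left)
  then have "0 \<le> (F x - (- G x)) * (u \<bullet> \<theta>)" unfolding left_diff_distrib by linarith
  moreover have "0 < F x - (- G x)" using pos[OF x] by simp
  ultimately have ut: "0 \<le> u \<bullet> \<theta>" unfolding zero_le_mult_iff by linarith
  have lin: "z \<bullet> \<theta> + (qF x \<bullet> z) * (u \<bullet> \<theta>) \<le> 0" if z: "z \<bullet> u = 0" for z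
  proof (rule tendsto_upperbound)
    have "((\<lambda>e. x + e *\<^sub>R z) \<longlongrightarrow> x + 0 *\<^sub>R z) (at_right (0::real))" by (intro tendsto_intros)
    then have "((\<lambda>e. qF (x + e *\<^sub>R z)) \<longlongrightarrow> qF x) (at_right 0)"
      using continuous_on_tendsto_compose[OF cont_qF _ x eventually_in_U[OF x z]] by simp
    then show "((\<lambda>e. z \<bullet> \<theta> + (qF (x + e *\<^sub>R z) \<bullet> z) * (u \<bullet> \<theta>)) \<longlongrightarrow> z \<bullet> \<theta> + (qF x \<bullet> z) * (u \<bullet> \<theta>)) (at_right 0)"
      by (intro tendsto_intros)
    have "\<forall>\<^sub>F e in at_right (0::real). 0 < e" by (simp add: eventually_at_right_less)
    then show "\<forall>\<^sub>F e in at_right 0. z \<bullet> \<theta> + (qF (x + e *\<^sub>R z) \<bullet> z) * (u \<bullet> \<theta>) \<le> 0"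
      using eventually_in_U[OF x z]
    proof eventually_elim
      case (elim e)
      let ?y = "x + e *\<^sub>R z"
      have "F x \<le> F ?y + qF ?y \<bullet> (x - ?y)" using elim x U_sub by (intro sup_F) auto
      then have 1: "F x + e * (qF ?y \<bullet> z) \<le> F ?y" by simp
      have "graph_map u F ?y \<in> M" by (rule graph_in_M[OF elim(2)])
      from le[OF this] have "e * (z \<bullet> \<theta>) + F ?y * (u \<bullet> \<theta>) \<le> F x * (u \<bullet> \<theta>)"
        by (simp add: graph_map_def inner_add_left)
      moreover have "(F x + e * (qF ?y \<bullet> z)) * (u \<bullet> \<theta>) \<le> F ?y * (u \<bullet> \<theta>)"
        by (rule mult_right_mono[OF 1 ut])
      ultimately have "e * (z \<bullet> \<theta> + (qF ?y \<bullet> z) * (u \<bullet> \<theta>)) \<le> 0"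
        by (simp add: algebra_simps)
      then show ?case using elim(1) by (simp add: mult_le_0_iff)
    qed
  qed simp
  have eq: "z \<bullet> \<theta> + (qF x \<bullet> z) * (u \<bullet> \<theta>) = 0" if z: "z \<bullet> u = 0" for z
    using lin[OF z] lin[of "- z"] z by simp
  \<comment> \<open>The part of \<theta> that is not along \<open>u - qF x\<close>. It is orthogonal
    to \<open>u\<close>, so \<open>eq\<close> applies to it and shows that it is orthogonal to
    itself.\<close>
  define w where "w = \<theta> - (u \<bullet> \<theta>) *\<^sub>R (u - qF x)"
  have wu: "w \<bullet> u = 0"
    unfolding w_def inner_diff_left inner_scaleR_left uu qu inner_commute[of \<theta> u] by simp
  have "w \<bullet> w = w \<bullet> \<theta> - (u \<bullet> \<theta>) * (w \<bullet> u - w \<bullet> qF x)"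
    by (simp only: w_def[symmetric] inner_diff_right[symmetric] inner_scaleR_right[symmetric])
  also have "\<dots> = w \<bullet> \<theta> + (qF x \<bullet> w) * (u \<bullet> \<theta>)" unfolding wu by (simp add: inner_commute)
  also have "\<dots> = 0" by (rule eq[OF wu])
  finally have \<theta>w: "\<theta> = (u \<bullet> \<theta>) *\<^sub>R (u - qF x)" by (simp add: w_def)
  have "norm \<theta> = 1" using \<theta> by (simp add: outer_unit_normal_def)
  then have "(u \<bullet> \<theta>) * norm (u - qF x) = 1" using arg_cong[OF \<theta>w, of norm] ut by simp
  then have "u \<bullet> \<theta> = 1 / norm (u - qF x)" using n1 by (simp add: field_simps)
  then show "\<theta> = (1 / norm (u - qF x)) *\<^sub>R (u - qF x)" using \<theta>w by metis
qed

lemma graph_frontier: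
  assumes x: "x \<in> U" shows "graph_map u F x \<in> frontier M"
proof -
  have "graph_map u F x \<notin> interior M"
  proof
    assume "graph_map u F x \<in> interior M"
    then obtain e where e: "e > 0" "ball (graph_map u F x) e \<subseteq> M" by (auto simp: mem_interior)
    have "graph_map u F x + (e/2) *\<^sub>R u \<in> ball (graph_map u F x) e"
      using e(1) by (simp add: dist_norm u)
    then have "x + (F x + e/2) *\<^sub>R u \<in> M" using e(2) by (simp add: graph_map_def scaleR_add_left add.assoc subset_iff)
    then show False using mem_M x U_sub e(1) by fastforce
  qed
  then show ?thesis using graph_in_M[OF x] closure_subset unfolding frontier_def by blast
qed

lemma graph_regular:
  assumes x: "x \<in> U" shows "graph_map u F x \<in> regular_boundary M"
  unfolding regular_boundary_def mem_Collect_eq outer_unit_normal_graph[OF x]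
  using graph_frontier[OF x] by blast

lemma gauss_map_graph:
  assumes x: "x \<in> U" shows "gauss_map M (graph_map u F x) = (1 / norm (u - qF x)) *\<^sub>R (u - qF x)"
  using gauss_map_eqI[OF graph_regular[OF x]] outer_unit_normal_graph[OF x] by blast

end

lemma ennreal_eq_0_of_nat_mult_bounded:
  fixes h T :: ennreal
  assumes "T < top" "\<And>N::nat. of_nat N * h \<le> T"
  shows "h = 0"
proof (rule ccontr)
  assume "h \<noteq> 0"
  have "h \<le> T" using assms(2)[of 1] by simp
  then have "h < top" using assms(1) by (rule le_less_trans)
  then obtain r where r: "0 \<le> r" "h = ennreal r" by (cases h) auto
  obtain t where t: "0 \<le> t" "T = ennreal t" using assms(1) by (cases T) auto
  have "0 < r" using \<open>h \<noteq> 0\<close> r by (cases "r = 0") auto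
  then obtain N :: nat where N: "t < real N * r" using reals_Archimedean3 by blast
  have "ennreal (real N * r) \<le> ennreal t"
    using assms(2)[of N] r t by (simp add: ennreal_mult ennreal_of_nat_eq_real_of_nat)
  then have "real N * r \<le> t" using t(1) by (simp add: ennreal_le_iff)
  with N show False by linarith
qed

context graph_body
begin

section \<open>The part of the body over the rim of the shadow\<close>

definition edge :: "(real^'n) set" where
  "edge = {y \<in> M. perp_part u y \<notin> U}"

lemma edge_inj: "y \<in> edge \<Longrightarrow> y' \<in> edge \<Longrightarrow> perp_part u y = perp_part u y' \<Longrightarrow> y = y'"
proof -
  assume y: "y \<in> edge" "y' \<in> edge" and eq: "perp_part u y = perp_part u y'"
  have yM: "y \<in> M" "perp_part u y \<notin> U" and y'M: "y' \<in> M" "perp_part u y' \<notin> U" using y by (auto simp: edge_def)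
  have "y \<bullet> u = y' \<bullet> u"
    using M_decomp[OF yM(1)] M_decomp[OF y'M(1)] flat[of "perp_part u y"] yM(2) eq by auto
  then show "y = y'" using perp_part_decomp[of u y] perp_part_decomp[of u y'] eq by metis
qed

lemma perp_vimage_U_open: "open (perp_part u -` U)"
proof -
  obtain C where C: "open C" "U = C \<inter> {x. x \<bullet> u = 0}" using U_open by blast
  then have "perp_part u -` U = perp_part u -` C" using inner_perp_part[OF u] by auto
  moreover have "open (perp_part u -` C)"
    using C(1) continuous_on_perp_part[OF continuous_on_id, of UNIV u] by (intro open_vimage) auto
  ultimately show ?thesis by simp
qed

lemma edge_borel: "edge \<in> sets borel"
proof -
  have "edge = M - perp_part u -` U" by (auto simp: edge_def)
  moreover have "M \<in> sets borel" using cb by (auto simp: convex_body_def intro: borel_compact)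
  ultimately show ?thesis using perp_vimage_U_open by (auto intro: borel_open)
qed

lemma interior_perp_U: "y \<in> interior M \<Longrightarrow> perp_part u y \<in> U"
proof (rule ccontr)
  assume y: "y \<in> interior M" and nU: "perp_part u y \<notin> U"
  obtain r where r: "r > 0" "ball y r \<subseteq> M" using y by (auto simp: mem_interior)
  have "y + (r/2) *\<^sub>R u \<in> ball y r" using r(1) by (simp add: dist_norm u)
  then have "y + (r/2) *\<^sub>R u \<in> M" using r(2) by blast
  then have 1: "y + (r/2) *\<^sub>R u \<in> edge" using nU by (simp add: edge_def perp_part_add_dir[OF u])
  have "y \<in> M" using interior_subset y by (rule subsetD)
  then have 2: "y \<in> edge" by (simp add: edge_def nU)
  have "y + (r/2) *\<^sub>R u = y" by (rule edge_inj[OF 1 2 perp_part_add_dir[OF u]])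
  then have "(r/2) *\<^sub>R u = 0" by simp
  then have "\<bar>r/2\<bar> * norm u = 0" by (metis norm_scaleR norm_zero)
  then show False using r(1) unfolding u by simp
qed

text \<open>The segment from the projection of an interior point of \<open>M\<close> to that of
  \<open>y\<close> can be prolonged a little within \<open>K'\<close>. Over its end lies a point of
  \<open>M\<close>, and shrinking it towards the interior point gives an interior point of
  \<open>M\<close> over \<open>perp_part u y\<close>.\<close>

lemma interior_perp_part_U:
  assumes y: "y \<in> interior {y. perp_part u y \<in> K' \<and> \<bar>y \<bullet> u\<bar> \<le> R}"
  shows "perp_part u y \<in> U"
proof -
  obtain k where k: "k \<in> interior M" using cb by (auto simp: convex_body_def)
  define v where "v = perp_part u y - perp_part u k"
  have vu: "v \<bullet> u = 0" by (simp add: v_def inner_diff_left inner_perp_part[OF u])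
  obtain d where d: "d > 0" "ball y d \<subseteq> {y. perp_part u y \<in> K' \<and> \<bar>y \<bullet> u\<bar> \<le> R}"
    using y by (auto simp: mem_interior)
  define e where "e = d / (2 * (norm v + 1))"
  have e: "e > 0" using d(1) by (simp add: e_def add_nonneg_pos)
  have "norm (e *\<^sub>R v) < d"
  proof -
    have "e * norm v \<le> e * (norm v + 1)" using e by simp
    also have "\<dots> = d / 2" unfolding e_def by (simp add: field_simps add_nonneg_eq_0_iff)
    finally show ?thesis using e d(1) by simp
  qed
  then have "y + e *\<^sub>R v \<in> ball y d" by (simp add: dist_norm)
  then have "perp_part u (y + e *\<^sub>R v) \<in> K'" using d(2) by blast
  then have K: "perp_part u y + e *\<^sub>R v \<in> K'"
    unfolding perp_part_add perp_part_scale perp_part_eq[OF vu] .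
  obtain m where m: "m \<in> M" "perp_part u m = perp_part u y + e *\<^sub>R v"
  proof (cases "perp_part u y + e *\<^sub>R v \<in> U")
    case True
    show ?thesis
      using graph_in_M[OF True] perp_part_graph_map[OF u U_perp[OF True], of F] by (rule that)
  next
    case False
    let ?z = "perp_part u y + e *\<^sub>R v"
    have "?z + F ?z *\<^sub>R u \<in> M" using mem_M[OF K] flat[OF K False] by simp
    moreover have "perp_part u (?z + F ?z *\<^sub>R u) = ?z"
      unfolding perp_part_add_dir[OF u] by (rule perp_part_eq[OF K'_perp[OF K]])
    ultimately show ?thesis by (rule that)
  qed
  \<comment> \<open>Chosen so that the shrunk point \<open>w\<close> projects exactly onto
    \<open>perp_part u y\<close>.\<close>
  define c where "c = e / (1 + e)"
  have c: "0 < c" "c \<le> 1" using e by (auto simp: c_def)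
  define w where "w = m - c *\<^sub>R (m - k)"
  have wi: "w \<in> interior M"
    unfolding w_def using cb m(1) k c by (intro mem_interior_convex_shrink) (auto simp: convex_body_def)
  have cc: "e - c * (1 + e) = 0" using e by (simp add: c_def)
  have "perp_part u w = perp_part u m - c *\<^sub>R (perp_part u m - perp_part u k)"
    by (simp add: w_def perp_part_diff perp_part_scale)
  also have "\<dots> = perp_part u y + (e - c * (1 + e)) *\<^sub>R v"
    unfolding m(2) v_def by (simp add: algebra_simps)
  finally have Pw: "perp_part u w = perp_part u y" by (simp add: cc)
  from interior_perp_U[OF wi] show ?thesis unfolding Pw .
qed

text \<open>The vertical translates of \<open>edge\<close> are disjoint and lie in the boundary of a bounded cylinder,
  which has finite measure.\<close>

lemma hausdorff_outer_edge: "hausdorff_outer (CARD('n) - 1) edge = 0"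
proof -
  have M: "compact M" "convex M" "interior M \<noteq> {}" using cb by (auto simp: convex_body_def)
  obtain B where B: "\<And>y. y \<in> M \<Longrightarrow> norm y \<le> B" using compact_imp_bounded[OF M(1)] by (auto simp: bounded_iff)
  define R where "R = B + 1"
  have yR: "\<bar>y \<bullet> u\<bar> \<le> B" if "y \<in> M" for y
    using B[OF that] Cauchy_Schwarz_ineq2[of y u] u by simp
  define D where "D = {y. perp_part u y \<in> K' \<and> \<bar>y \<bullet> u\<bar> \<le> R}"
  have K'_eq: "K' = perp_part u ` M"
  proof
    show "perp_part u ` M \<subseteq> K'" using M_decomp(1) by blast
    show "K' \<subseteq> perp_part u ` M"
    proof
      fix x assume x: "x \<in> K'"
      have "x + F x *\<^sub>R u \<in> M" using mem_M[OF x] pos[of x] flat[OF x] by force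
      moreover have "perp_part u (x + F x *\<^sub>R u) = x"
        unfolding perp_part_add_dir[OF u] by (rule perp_part_eq[OF K'_perp[OF x]])
      ultimately show "x \<in> perp_part u ` M" by (metis image_eqI)
    qed
  qed
  have K'c: "compact K'" "convex K'"
    unfolding K'_eq
    by (intro compact_continuous_image continuous_on_perp_part continuous_on_id M)
       (intro convex_linear_image linear_perp_part M)
  have D_eq: "D = (\<lambda>z. fst z + snd z *\<^sub>R u) ` (K' \<times> {-R..R})"
  proof (intro set_eqI iffI)
    fix y assume "y \<in> D"
    then have "(perp_part u y, y \<bullet> u) \<in> K' \<times> {-R..R}" by (auto simp: D_def abs_le_iff)
    moreover have "y = fst (perp_part u y, y \<bullet> u) + snd (perp_part u y, y \<bullet> u) *\<^sub>R u"
      by (simp add: perp_part_decomp)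
    ultimately show "y \<in> (\<lambda>z. fst z + snd z *\<^sub>R u) ` (K' \<times> {-R..R})" by (rule image_eqI[rotated])
  next
    fix y assume "y \<in> (\<lambda>z. fst z + snd z *\<^sub>R u) ` (K' \<times> {-R..R})"
    then obtain x s where xs: "x \<in> K'" "-R \<le> s" "s \<le> R" "y = x + s *\<^sub>R u" by auto
    have "perp_part u y = x" unfolding xs(4) perp_part_add_dir[OF u] by (rule perp_part_eq[OF K'_perp[OF xs(1)]])
    moreover have "y \<bullet> u = s" unfolding xs(4) using K'_perp[OF xs(1)] unit_inner_self[OF u] by (simp add: inner_add_left)
    ultimately show "y \<in> D" using xs by (simp add: D_def abs_le_iff)
  qed
  have "compact D"
    unfolding D_eq by (intro compact_continuous_image compact_Times K'c compact_Icc continuous_intros)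
  moreover have "convex D"
  proof (rule convexI)
    fix x y and a b :: real assume *: "x \<in> D" "y \<in> D" "0 \<le> a" "0 \<le> b" "a + b = 1"
    have "perp_part u (a *\<^sub>R x + b *\<^sub>R y) \<in> K'"
      unfolding perp_part_add perp_part_scale using * by (intro convexD[OF K'c(2)]) (auto simp: D_def)
    moreover have "\<bar>(a *\<^sub>R x + b *\<^sub>R y) \<bullet> u\<bar> \<le> R"
    proof -
      have "a * (x \<bullet> u) + b * (y \<bullet> u) \<in> {-R..R}"
        using convexD[OF convex_real_interval(5), of "x \<bullet> u" "-R" R "y \<bullet> u" a b] * by (auto simp: D_def abs_le_iff)
      then show ?thesis by (auto simp: inner_add_left abs_le_iff)
    qed
    ultimately show "a *\<^sub>R x + b *\<^sub>R y \<in> D" by (simp add: D_def)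
  qed
  moreover have MD: "M \<subseteq> D" using M_decomp(1) yR by (fastforce simp: D_def R_def)
  ultimately have "convex_body D" using M(3) interior_mono[OF MD] by (auto simp: convex_body_def)
  then have fin: "hausdorff_outer (CARD('n) - 1) (frontier D) < top"
    using hausdorff_outer_frontier_convex_body[of D] by simp
  \<comment> \<open>Infinitely many distinct shifts, all at most 1, so that the translates stay
    within the height \<open>R = B + 1\<close>.\<close>
  define s where "s i = 1 / real (Suc i)" for i
  define Z where "Z i = (+) (s i *\<^sub>R u) ` edge" for i
  have Zfr: "Z i \<subseteq> frontier D" for i
  proof
    fix z assume "z \<in> Z i"
    then obtain y where y: "y \<in> edge" "z = s i *\<^sub>R u + y" by (auto simp: Z_def)
    then have yM: "y \<in> M" "perp_part u y \<notin> U" by (auto simp: edge_def)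
    have Pz: "perp_part u z = perp_part u y" unfolding y(2) by (simp add: perp_part_add_dir[OF u] add.commute)
    have s01: "0 \<le> s i" "s i \<le> 1" by (auto simp: s_def)
    have "z \<bullet> u = s i + y \<bullet> u" unfolding y(2) using unit_inner_self[OF u] by (simp add: inner_add_left)
    then have "z \<in> D" using Pz M_decomp(1)[OF yM(1)] yR[OF yM(1)] s01 by (simp add: D_def R_def)
    moreover have "z \<notin> interior D" using interior_perp_part_U[of z R] Pz yM(2) by (auto simp: D_def)
    ultimately show "z \<in> frontier D" using closure_subset unfolding frontier_def by blast
  qed
  have Zb: "Z i \<in> sets borel" for i
  proof -
    have "Z i = (+) (- (s i *\<^sub>R u)) -` edge" by (force simp: Z_def image_iff)
    also have "\<dots> \<in> sets borel" by (rule measurable_sets_borel[OF _ edge_borel]) measurable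
    finally show ?thesis .
  qed
  have disj: "disjoint_family Z"
    unfolding disjoint_family_on_def
  proof (intro ballI impI)
    fix i j :: nat assume ij: "i \<noteq> j"
    show "Z i \<inter> Z j = {}"
    proof (rule ccontr)
      assume "Z i \<inter> Z j \<noteq> {}"
      then obtain z where "z \<in> Z i" "z \<in> Z j" by blast
      then obtain y y' where y: "y \<in> edge" "z = s i *\<^sub>R u + y" and y': "y' \<in> edge" "z = s j *\<^sub>R u + y'"
        unfolding Z_def by blast
      have eq: "y + s i *\<^sub>R u = y' + s j *\<^sub>R u" using y(2) y'(2) by (simp add: add.commute)
      have "perp_part u y = perp_part u y'"
        using arg_cong[OF eq, of "perp_part u"] unfolding perp_part_add_dir[OF u] .
      then have "y = y'" by (rule edge_inj[OF y(1) y'(1)])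
      then have "s i *\<^sub>R u = s j *\<^sub>R u" using eq by simp
      moreover have "u \<noteq> 0" using u by auto
      ultimately have "s i = s j" by simp
      then show False using ij by (simp add: s_def)
    qed
  qed
  show ?thesis
  proof (rule ennreal_eq_0_of_nat_mult_bounded[OF fin])
    fix N :: nat
    let ?H = "hausdorff_measure (CARD('n) - 1) :: (real^'n) measure"
    have "of_nat N * hausdorff_outer (CARD('n) - 1) edge = (\<Sum>i<N. hausdorff_outer (CARD('n) - 1) (Z i))"
      by (simp add: Z_def hausdorff_outer_translate)
    also have "\<dots> = (\<Sum>i<N. emeasure ?H (Z i))" using Zb by (simp add: emeasure_hausdorff_measure)
    also have "\<dots> = emeasure ?H (\<Union>i<N. Z i)"
      using disj Zb by (intro sum_emeasure) (auto simp: disjoint_family_on_def)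
    also have "\<dots> = hausdorff_outer (CARD('n) - 1) (\<Union>i<N. Z i)"
      using Zb by (intro emeasure_hausdorff_measure sets.finite_UN) auto
    also have "\<dots> \<le> hausdorff_outer (CARD('n) - 1) (frontier D)"
      using Zfr by (intro hausdorff_outer_mono) blast
    finally show "of_nat N * hausdorff_outer (CARD('n) - 1) edge \<le> hausdorff_outer (CARD('n) - 1) (frontier D)" .
  qed
qed

section \<open>Integration against the surface area measure\<close>

lemma between_interior:
  assumes "perp_part u y \<in> U" "- G (perp_part u y) < y \<bullet> u" "y \<bullet> u < F (perp_part u y)"
  shows "y \<in> interior M"
proof -
  let ?C = "perp_part u -` U"
  have cF: "continuous_on ?C (\<lambda>y. F (perp_part u y) - y \<bullet> u)"
    by (intro continuous_intros continuous_on_compose2[OF cont_F, of _ "perp_part u"] continuous_on_perp_part continuous_on_id) auto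
  have cG: "continuous_on ?C (\<lambda>y. G (perp_part u y) + y \<bullet> u)"
    by (intro continuous_intros continuous_on_compose2[OF cont_G, of _ "perp_part u"] continuous_on_perp_part continuous_on_id) auto
  let ?W = "(?C \<inter> (\<lambda>y. F (perp_part u y) - y \<bullet> u) -` {0<..}) \<inter> (?C \<inter> (\<lambda>y. G (perp_part u y) + y \<bullet> u) -` {0<..})"
  have "open ?W"
    by (intro open_Int continuous_open_preimage cF cG perp_vimage_U_open open_greaterThan)
  moreover have "?W \<subseteq> M"
  proof
    fix z assume z: "z \<in> ?W"
    then have "perp_part u z + (z \<bullet> u) *\<^sub>R u \<in> M" using mem_M[of "perp_part u z" "z \<bullet> u"] U_sub by auto
    then show "z \<in> M" by (simp only: perp_part_decomp)
  qed
  moreover have "y \<in> ?W" using assms by simp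
  ultimately show ?thesis by (meson interiorI)
qed

lemma regular_boundary_subset:
  "regular_boundary M \<subseteq> graph_map u F ` U \<union> graph_map (- u) G ` U \<union> edge"
proof
  fix y assume y: "y \<in> regular_boundary M"
  have yM: "y \<in> M" using gauss_map_normal[OF y] by (simp add: outer_unit_normal_def)
  have fr: "y \<notin> interior M" using y by (simp add: regular_boundary_def frontier_def)
  show "y \<in> graph_map u F ` U \<union> graph_map (- u) G ` U \<union> edge"
  proof (cases "perp_part u y \<in> U")
    case True
    have "\<not> (- G (perp_part u y) < y \<bullet> u \<and> y \<bullet> u < F (perp_part u y))"
      using between_interior[OF True] fr by blast
    then have "y \<bullet> u = F (perp_part u y) \<or> y \<bullet> (- u) = G (perp_part (- u) y)"
      using M_decomp(2,3)[OF yM] unfolding perp_part_uminus_dir inner_minus_right by linarith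
    then show ?thesis
      using graph_map_perp_part[of y u F] graph_map_perp_part[of y "-u" G] True
      unfolding perp_part_uminus_dir by (metis UnCI image_eqI)
  qed (simp add: edge_def yM)
qed

lemma graphs_disjoint: "graph_map u F ` U \<inter> graph_map (- u) G ` U = {}"
proof (rule ccontr)
  assume "\<not> ?thesis"
  then obtain x x' where x: "x \<in> U" "x' \<in> U" and eq: "x + F x *\<^sub>R u = x' + (- G x') *\<^sub>R u"
    by (auto simp: graph_map_def)
  have "x = x'" using arg_cong[OF eq, of "perp_part u"]
    unfolding perp_part_add_dir[OF u] perp_part_eq[OF U_perp[OF x(1)]] perp_part_eq[OF U_perp[OF x(2)]] .
  moreover have "u \<noteq> 0" using u by auto
  ultimately have "F x = - G x" using eq by (metis add_left_cancel scaleR_cancel_right)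
  then show False using pos[OF x(1)] by simp
qed

lemma nn_integral_surface_half:
  assumes \<psi>[measurable]: "\<psi> \<in> borel_measurable borel"
  shows "(\<integral>\<^sup>+y. indicator (graph_map u F ` U) y * \<psi> y \<partial>hausdorff_measure (CARD('n) - 1))
    = (\<integral>\<^sup>+x. indicator U x * (hausdorff_ratio u * ennreal (norm (u - qF x))) * \<psi> (graph_map u F x) \<partial>perp_lborel u)"
proof -
  have "(\<integral>\<^sup>+y. indicator (graph_map u F ` U) y * \<psi> y \<partial>hausdorff_measure (CARD('n) - 1))
    = (\<integral>\<^sup>+x. indicator U x * (hausdorff_ratio u * ennreal (sqrt (1 + (norm (qF x))\<^sup>2))) * \<psi> (graph_map u F x)
        \<partial>perp_lborel u)"
    using U_sub sup_F U_perp qF_perp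
    by (intro nn_integral_hausdorff_concave_graph u U_borel cont_qF cont_F \<psi>) auto
  also have "\<dots> = (\<integral>\<^sup>+x. indicator U x * (hausdorff_ratio u * ennreal (norm (u - qF x))) * \<psi> (graph_map u F x) \<partial>perp_lborel u)"
    by (intro nn_integral_cong) (auto simp: indicator_def norm_normal)
  finally show ?thesis .
qed

lemma graph_borel: "graph_map u F ` U \<in> sets borel"
  using hausdorff_outer_concave_graph(2)[OF u U_borel U_perp qF_perp cont_qF _ cont_F U_borel] sup_F U_sub
  by blast

text \<open>Up to the null set \<open>edge\<close> the regular boundary consists of two disjoint
  graphs. Each is integrated by the area formula, with the Gauss map known explicitly there.\<close>

theorem nn_integral_surface_area_measure:
  assumes \<phi>[measurable]: "\<phi> \<in> borel_measurable borel"
  shows "(\<integral>\<^sup>+\<theta>. \<phi> \<theta> \<partial>surface_area_measure M)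
    = (\<integral>\<^sup>+x. indicator U x * (hausdorff_ratio u * ennreal (norm (u - qF x)))
          * \<phi> ((1 / norm (u - qF x)) *\<^sub>R (u - qF x)) \<partial>perp_lborel u)
    + (\<integral>\<^sup>+x. indicator U x * (hausdorff_ratio u * ennreal (norm (- u - qG x)))
          * \<phi> ((1 / norm (- u - qG x)) *\<^sub>R (- u - qG x)) \<partial>perp_lborel u)"
proof -
  interpret L: graph_body "- u" M K' U G F qG qF by (rule flip)
  let ?H = "hausdorff_measure (CARD('n) - 1) :: (real^'n) measure" and ?R = "regular_boundary M"
  have M: "compact M" using cb by (simp add: convex_body_def)
  have R[measurable]: "?R \<in> sets borel" by (rule regular_boundary_borel[OF M])
  have RH: "?R \<inter> space ?H \<in> sets ?H" using R by simp
  note [measurable] = graph_borel L.graph_borel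
  have gs: "gauss_map M \<in> measurable (restrict_space ?H ?R) (restrict_space borel (sphere 0 1))"
  proof (rule measurable_restrict_space2)
    show "gauss_map M \<in> space (restrict_space ?H ?R) \<rightarrow> sphere 0 1"
      using gauss_map_normal[of _ M] by (auto simp: space_restrict_space outer_unit_normal_def)
    have "gauss_map M \<in> borel_measurable (restrict_space borel ?R)"
      by (rule borel_measurable_continuous_on_restrict[OF continuous_on_gauss_map[OF M]])
    moreover have "sets (restrict_space ?H ?R) = sets (restrict_space borel ?R)"
      by (simp add: sets_restrict_space)
    ultimately show "gauss_map M \<in> borel_measurable (restrict_space ?H ?R)"
      by (simp cong: measurable_cong_sets)
  qed
  have \<phi>g: "(\<lambda>y. \<phi> (gauss_map M y)) \<in> borel_measurable (restrict_space ?H ?R)"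
    using measurable_compose[OF gs measurable_restrict_space1[OF \<phi>]] .
  \<comment> \<open>The Gauss map is under control on the regular boundary only, so the integrand is
    set to 0 elsewhere.\<close>
  define \<psi> where "\<psi> y = \<phi> (gauss_map M y) * indicator ?R y" for y
  have "\<psi> \<in> borel_measurable ?H"
    using \<phi>g unfolding borel_measurable_restrict_space_iff_ennreal[OF RH] \<psi>_def .
  then have \<psi>[measurable]: "\<psi> \<in> borel_measurable borel" by (simp cong: measurable_cong_sets)
  have "(\<integral>\<^sup>+\<theta>. \<phi> \<theta> \<partial>surface_area_measure M) = (\<integral>\<^sup>+y. \<phi> (gauss_map M y) \<partial>restrict_space ?H ?R)"
    unfolding surface_area_measure_def
    using gs measurable_restrict_space1[OF \<phi>] by (subst nn_integral_distr) simp_all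
  also have "\<dots> = (\<integral>\<^sup>+y. \<psi> y \<partial>?H)" unfolding \<psi>_def by (rule nn_integral_restrict_space[OF RH])
  also have "\<dots> = (\<integral>\<^sup>+y. indicator (graph_map u F ` U) y * \<psi> y + indicator (graph_map (- u) G ` U) y * \<psi> y \<partial>?H)"
  proof (rule nn_integral_cong_AE)
    have "emeasure ?H edge = 0" using hausdorff_outer_edge edge_borel by (simp add: emeasure_hausdorff_measure)
    then have "AE y in ?H. y \<notin> edge" using edge_borel by (intro AE_not_in) (auto simp: null_sets_def)
    then show "AE y in ?H. \<psi> y = indicator (graph_map u F ` U) y * \<psi> y + indicator (graph_map (- u) G ` U) y * \<psi> y"
    proof eventually_elim
      case (elim y)
      show ?case
      proof (cases "y \<in> ?R")
        case True
        then have "y \<in> graph_map u F ` U \<or> y \<in> graph_map (- u) G ` U" using regular_boundary_subset elim by blast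
        then show ?thesis using graphs_disjoint by (auto simp: indicator_def)
      qed (simp add: \<psi>_def)
    qed
  qed
  also have "\<dots> = (\<integral>\<^sup>+y. indicator (graph_map u F ` U) y * \<psi> y \<partial>?H) + (\<integral>\<^sup>+y. indicator (graph_map (- u) G ` U) y * \<psi> y \<partial>?H)"
    by (intro nn_integral_add) (measurable, measurable)
  also have "(\<integral>\<^sup>+y. indicator (graph_map u F ` U) y * \<psi> y \<partial>?H)
      = (\<integral>\<^sup>+x. indicator U x * (hausdorff_ratio u * ennreal (norm (u - qF x)))
          * \<phi> ((1 / norm (u - qF x)) *\<^sub>R (u - qF x)) \<partial>perp_lborel u)"
    unfolding nn_integral_surface_half[OF \<psi>]
    by (intro nn_integral_cong) (auto simp: indicator_def \<psi>_def graph_regular gauss_map_graph)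
  also have "(\<integral>\<^sup>+y. indicator (graph_map (- u) G ` U) y * \<psi> y \<partial>?H)
      = (\<integral>\<^sup>+x. indicator U x * (hausdorff_ratio u * ennreal (norm (- u - qG x)))
          * \<phi> ((1 / norm (- u - qG x)) *\<^sub>R (- u - qG x)) \<partial>perp_lborel u)"
    unfolding L.nn_integral_surface_half[OF \<psi>] hausdorff_ratio_eq[OF L.u u] perp_lborel_uminus_dir
    by (intro nn_integral_cong) (auto simp: indicator_def \<psi>_def L.graph_regular L.gauss_map_graph)
  finally show ?thesis .
qed

end

section \<open>Fibre lengths of convex families\<close>

lemma compact_convex_real_eq:
  fixes A :: "real set"
  assumes "compact A" "convex A" "A \<noteq> {}"
  obtains a b where "a \<le> b" "A = {a..b}"
proof -
  obtain a b where "A = {a..b}"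
    using assms connected_compact_interval_1[of A] convex_connected by blast
  with assms(3) show thesis by (intro that[of a b]) auto
qed

text \<open>The Brunn-Minkowski inequality on the line, where the sets are intervals and endpoints
  can be compared. If one set is empty, \<open>sub\<close> says nothing and the inequality may fail;
  this is the source of the case distinctions on empty fibres.\<close>

lemma measure_convex_combination_real:
  fixes A B C :: "real set"
  assumes A: "compact A" "convex A" "A \<noteq> {}" and B: "compact B" "convex B" "B \<noteq> {}"
    and C: "compact C" "convex C" and l: "0 \<le> l" "l \<le> 1"
    and sub: "\<And>a b. a \<in> A \<Longrightarrow> b \<in> B \<Longrightarrow> (1 - l) * a + l * b \<in> C"
  shows "(1 - l) * measure lborel A + l * measure lborel B \<le> measure lborel C"
proof -
  obtain a1 a2 where a: "a1 \<le> a2" "A = {a1..a2}" using compact_convex_real_eq[OF A] by blast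
  obtain b1 b2 where b: "b1 \<le> b2" "B = {b1..b2}" using compact_convex_real_eq[OF B] by blast
  have "C \<noteq> {}" using sub[of a1 b1] a b by auto
  then obtain c1 c2 where c: "c1 \<le> c2" "C = {c1..c2}" using compact_convex_real_eq[OF C] by blast
  have "c1 \<le> (1 - l) * a1 + l * b1" using sub[of a1 b1] a b c by auto
  moreover have "(1 - l) * a2 + l * b2 \<le> c2" using sub[of a2 b2] a b c by auto
  ultimately show ?thesis using a b c by (simp add: algebra_simps)
qed

text \<open>Here \<open>w t\<close> stands for the \<open>p\<close>-th power of the support function
  of a projection body, and its sublevel set at 1 for the polar body. Joint convexity in
  \<open>t\<close> and \<open>v\<close> is required only on lines parallel to \<open>u\<close>: the
  integrand contains the product of a gradient depending on \<open>t\<close> with the part of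
  \<open>v\<close> orthogonal to \<open>u\<close>, and this is affine in \<open>t\<close> once that
  part is fixed.\<close>

locale fiber_family =
  fixes w :: "real \<Rightarrow> 'a::euclidean_space \<Rightarrow> real" and u :: 'a and p :: real
  assumes u: "norm u = 1" and p: "0 < p"
    and w_pos: "\<And>t v. t \<in> {-1..1} \<Longrightarrow> v \<noteq> 0 \<Longrightarrow> 0 < w t v"
    and w_scale: "\<And>t c v. t \<in> {-1..1} \<Longrightarrow> w t (c *\<^sub>R v) = \<bar>c\<bar> powr p * w t v"
    and w_convex: "\<And>t. t \<in> {-1..1} \<Longrightarrow> convex_on UNIV (w t)"
    and w_joint: "\<And>t t' v v' l. t \<in> {-1..1} \<Longrightarrow> t' \<in> {-1..1} \<Longrightarrow> perp_part u v = perp_part u v' \<Longrightarrow>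
        0 \<le> l \<Longrightarrow> l \<le> 1 \<Longrightarrow>
        w ((1 - l) * t + l * t') ((1 - l) *\<^sub>R v + l *\<^sub>R v') \<le> (1 - l) * w t v + l * w t' v'"
    and w_refl: "\<And>t v. t \<in> {-1..1} \<Longrightarrow> w (- t) v = w t (v - (2 * (v \<bullet> u)) *\<^sub>R u)"
    and w_strict: "\<And>t v c. t \<in> {-1..1} \<Longrightarrow> c \<noteq> 0 \<Longrightarrow>
        w t (v + (c / 2) *\<^sub>R u) < (w t v + w t (v + c *\<^sub>R u)) / 2"
begin

section \<open>Sublevel sets and their fibres\<close>

definition B :: "real \<Rightarrow> 'a set" where "B t = {v. w t v \<le> 1}"

definition S :: "real \<Rightarrow> 'a \<Rightarrow> real set" where "S t x = {s. w t (x + s *\<^sub>R u) \<le> 1}"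

definition L :: "real \<Rightarrow> 'a \<Rightarrow> real" where "L t x = measure lborel (S t x)"

lemma w_zero: "t \<in> {-1..1} \<Longrightarrow> w t 0 = 0"
  using w_scale[of t 0 0] p by simp

lemma w_cont: "t \<in> {-1..1} \<Longrightarrow> continuous_on X (w t)"
  using convex_on_continuous[OF open_UNIV w_convex] continuous_on_subset by blast

lemma B_closed: "t \<in> {-1..1} \<Longrightarrow> closed (B t)"
  unfolding B_def by (intro closed_Collect_le w_cont continuous_on_const)

lemma B_convex: assumes t: "t \<in> {-1..1}" shows "convex (B t)"
proof (rule convexI)
  fix x y and a b :: real assume *: "x \<in> B t" "y \<in> B t" "0 \<le> a" "0 \<le> b" "a + b = 1"
  have "w t (a *\<^sub>R x + b *\<^sub>R y) \<le> max (w t x) (w t y)"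
    by (rule convex_lower[OF w_convex[OF t] UNIV_I UNIV_I *(3-5)])
  then show "a *\<^sub>R x + b *\<^sub>R y \<in> B t" using *(1,2) by (simp add: B_def)
qed

text \<open>Homogeneity bounds \<open>w t v\<close> from below by the positive minimum of
  \<open>w t\<close> on the unit sphere times \<open>norm v powr p\<close>.\<close>

lemma B_compact:
  assumes t: "t \<in> {-1..1}" shows "compact (B t)"
proof -
  have "sphere (0::'a) 1 \<noteq> {}" using u by (auto intro!: exI[of _ u])
  then obtain z where z: "z \<in> sphere 0 1" "\<And>v. v \<in> sphere 0 1 \<Longrightarrow> w t z \<le> w t v"
    using continuous_attains_inf[OF compact_sphere _ w_cont[OF t]] by metis
  have m: "0 < w t z" using z(1) by (intro w_pos t) auto
  have "norm v \<le> (1 / w t z) powr (1 / p)" if "v \<in> B t" for v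
  proof (cases "v = 0")
    case False
    have "w t v = norm v powr p * w t (v /\<^sub>R norm v)"
      using w_scale[OF t, of "norm v" "v /\<^sub>R norm v"] False by simp
    moreover have "w t z \<le> w t (v /\<^sub>R norm v)" using False by (intro z(2)) simp
    ultimately have "norm v powr p * w t z \<le> 1"
      using that mult_left_mono[of "w t z" "w t (v /\<^sub>R norm v)" "norm v powr p"] by (simp add: B_def)
    then have "norm v powr p \<le> 1 / w t z" using m by (simp add: field_simps)
    then have "(norm v powr p) powr (1 / p) \<le> (1 / w t z) powr (1 / p)"
      using p by (intro powr_mono2) auto
    then show ?thesis using p False by (simp add: powr_powr)
  qed simp
  then have "bounded (B t)" unfolding bounded_iff by blast
  then show ?thesis using B_closed[OF t] by (simp add: compact_eq_bounded_closed)
qed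

lemma S_eq: "S t x = (\<lambda>s. x + s *\<^sub>R u) -` B t" by (auto simp: S_def B_def)

lemma S_compact: assumes t: "t \<in> {-1..1}" shows "compact (S t x)"
proof -
  have "closed (S t x)" unfolding S_eq
    by (intro continuous_closed_vimage B_closed t) (intro continuous_intros)
  moreover have "bounded (S t x)"
  proof -
    obtain b where b: "\<And>v. v \<in> B t \<Longrightarrow> norm v \<le> b"
      using compact_imp_bounded[OF B_compact[OF t]] by (auto simp: bounded_iff)
    have "\<bar>s\<bar> \<le> b + norm x" if "s \<in> S t x" for s
    proof -
      have "norm (s *\<^sub>R u) \<le> norm (x + s *\<^sub>R u) + norm x"
        using norm_triangle_ineq4[of "x + s *\<^sub>R u" x] by simp
      moreover have "norm (x + s *\<^sub>R u) \<le> b" using that by (intro b) (simp add: S_eq)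
      ultimately show ?thesis unfolding norm_scaleR u by simp
    qed
    then show ?thesis unfolding bounded_iff by (auto intro!: exI[of _ "b + norm x"])
  qed
  ultimately show ?thesis by (simp add: compact_eq_bounded_closed)
qed

lemma S_combine:
  assumes "t \<in> {-1..1}" "t' \<in> {-1..1}" "0 \<le> l" "l \<le> 1" "a \<in> S t x" "b \<in> S t' x"
  shows "(1 - l) * a + l * b \<in> S ((1 - l) * t + l * t') x"
proof -
  have eq: "(1 - l) *\<^sub>R (x + a *\<^sub>R u) + l *\<^sub>R (x + b *\<^sub>R u) = x + ((1 - l) * a + l * b) *\<^sub>R u"
    by (simp add: algebra_simps)
  have "perp_part u (x + a *\<^sub>R u) = perp_part u (x + b *\<^sub>R u)" by (simp only: perp_part_add_dir[OF u])
  from w_joint[OF assms(1,2) this assms(3,4)]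
  have "w ((1 - l) * t + l * t') (x + ((1 - l) * a + l * b) *\<^sub>R u)
      \<le> (1 - l) * w t (x + a *\<^sub>R u) + l * w t' (x + b *\<^sub>R u)"
    unfolding eq .
  also have "\<dots> \<le> (1 - l) * 1 + l * 1"
    using assms by (intro add_mono mult_left_mono) (auto simp: S_def)
  finally show ?thesis by (simp add: S_def)
qed

lemma S_convex: assumes t: "t \<in> {-1..1}" shows "convex (S t x)"
proof (rule convexI)
  fix a b and k l :: real
  assume "a \<in> S t x" "b \<in> S t x" "0 \<le> k" "0 \<le> l" "k + l = 1"
  then have "(1 - l) * a + l * b \<in> S ((1 - l) * t + l * t) x" "k = 1 - l" using t by (auto intro: S_combine)
  moreover have "(1 - l) * t + l * t = t" by (simp add: algebra_simps)
  ultimately show "k *\<^sub>R a + l *\<^sub>R b \<in> S t x" by simp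
qed

lemma S_refl: "t \<in> {-1..1} \<Longrightarrow> x \<bullet> u = 0 \<Longrightarrow> s \<in> S (- t) x \<longleftrightarrow> - s \<in> S t x"
proof -
  assume t: "t \<in> {-1..1}" and x: "x \<bullet> u = 0"
  have "(x + s *\<^sub>R u) \<bullet> u = s" unfolding inner_add_left inner_scaleR_left unit_inner_self[OF u] x by simp
  then have "(x + s *\<^sub>R u) - (2 * ((x + s *\<^sub>R u) \<bullet> u)) *\<^sub>R u = x + (s - 2 * s) *\<^sub>R u"
    by (simp only: scaleR_diff_left add_diff_eq)
  then have "(x + s *\<^sub>R u) - (2 * ((x + s *\<^sub>R u) \<bullet> u)) *\<^sub>R u = x + (- s) *\<^sub>R u"
    by simp
  then show ?thesis unfolding S_def mem_Collect_eq w_refl[OF t] by metis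
qed

lemma L_concave:
  assumes t: "t \<in> {-1..1}" "t' \<in> {-1..1}" and l: "0 \<le> l" "l \<le> 1" and ne: "S t x \<noteq> {}" "S t' x \<noteq> {}"
  shows "(1 - l) * L t x + l * L t' x \<le> L ((1 - l) * t + l * t') x"
proof -
  have tl: "(1 - l) * t + l * t' \<in> {-1..1}"
    using convexD[OF convex_real_interval(5), of t "-1" 1 t' "1 - l" l] t l by simp
  show ?thesis
    unfolding L_def using t l
    by (intro measure_convex_combination_real S_compact S_convex ne tl S_combine)
qed

lemma L_refl:
  assumes t: "t \<in> {-1..1}" and x: "x \<bullet> u = 0" shows "L (- t) x = L t x"
proof -
  have "S (- t) x = uminus ` S t x"
  proof (intro set_eqI iffI)
    fix s assume "s \<in> S (- t) x"
    then have "- s \<in> S t x" by (simp only: S_refl[OF t x])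
    then have "- (- s) \<in> uminus ` S t x" by (rule imageI)
    then show "s \<in> uminus ` S t x" by simp
  next
    fix s assume "s \<in> uminus ` S t x"
    then obtain a where "a \<in> S t x" "s = - a" by blast
    then show "s \<in> S (- t) x" by (simp only: S_refl[OF t x] minus_minus)
  qed
  moreover have "measure lborel (uminus ` S t x) = measure lborel (S t x)"
  proof (cases "S t x = {}")
    case False
    then obtain a b where "a \<le> b" "S t x = {a..b}"
      using compact_convex_real_eq[OF S_compact[OF t] S_convex[OF t]] by blast
    then show ?thesis by simp
  qed simp
  ultimately show ?thesis by (simp add: L_def)
qed

lemma S_refl_nonempty: "t \<in> {-1..1} \<Longrightarrow> x \<bullet> u = 0 \<Longrightarrow> S t x \<noteq> {} \<Longrightarrow> S (- t) x \<noteq> {}"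
  using S_refl by (metis all_not_in_conv minus_minus)

lemma L_nonneg: "0 \<le> L t x" by (simp add: L_def)

lemma L_empty: "S t x = {} \<Longrightarrow> L t x = 0" by (simp add: L_def)

text \<open>The length is even in \<open>t\<close>, and \<open>t\<close> lies between
  \<open>- t'\<close> and \<open>t'\<close>, so concavity gives the claim. An empty fibre at
  \<open>t'\<close> has length 0.\<close>

lemma L_le_of_abs_le:
  assumes t: "t' \<in> {-1..1}" "\<bar>t\<bar> \<le> \<bar>t'\<bar>" and x: "x \<bullet> u = 0"
  shows "L t' x \<le> L t x"
proof (cases "S t' x = {} \<or> t' = 0")
  case True
  then show ?thesis using t L_nonneg by (auto simp: L_empty)
next
  case False
  define l where "l = (t' - t) / (2 * t')"
  have t'0: "t' \<noteq> 0" using False by blast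
  have l: "0 \<le> l" "l \<le> 1"
    using t(2) t'0 unfolding l_def by (cases "0 < t'"; simp add: field_simps abs_if split: if_splits)+
  have tl: "(1 - l) * t' + l * (- t') = t" using t'0 by (simp add: l_def field_simps)
  have "(1 - l) * L t' x + l * L (- t') x \<le> L ((1 - l) * t' + l * (- t')) x"
    using t(1) False x by (intro L_concave l S_refl_nonempty) auto
  then show ?thesis unfolding tl L_refl[OF t(1) x] by (simp add: algebra_simps)
qed

lemma ennreal_L:
  assumes t: "t \<in> {-1..1}"
  shows "ennreal (L t x) = (\<integral>\<^sup>+s. indicator (B t) (x + s *\<^sub>R u) \<partial>lborel)"
proof -
  have "(\<integral>\<^sup>+s. indicator (B t) (x + s *\<^sub>R u) \<partial>lborel) = (\<integral>\<^sup>+s. indicator (S t x) s \<partial>lborel)"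
    by (intro nn_integral_cong) (simp add: S_eq indicator_def)
  also have "\<dots> = emeasure lborel (S t x)"
    using borel_compact[OF S_compact[OF t]] by simp
  also have "\<dots> = ennreal (L t x)"
    unfolding L_def using emeasure_bounded_finite[OF compact_imp_bounded[OF S_compact[OF t]]]
    by (intro emeasure_eq_ennreal_measure) (simp add: less_top)
  finally show ?thesis ..
qed

lemma L_measurable [measurable]:
  assumes t: "t \<in> {-1..1}" shows "L t \<in> borel_measurable borel"
proof -
  have [measurable]: "B t \<in> sets borel" using B_closed[OF t] by (rule borel_closed)
  have "(\<lambda>x. \<integral>\<^sup>+s. indicator (B t) (x + s *\<^sub>R u) \<partial>lborel) \<in> borel_measurable borel" by measurable
  then have "(\<lambda>x. enn2real (ennreal (L t x))) \<in> borel_measurable borel"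
    unfolding ennreal_L[OF t] by measurable
  then show ?thesis using L_nonneg by simp
qed

section \<open>The volume as an integral of fibre lengths\<close>

definition V :: "real \<Rightarrow> real" where "V t = measure lebesgue (B t)"

lemma ennreal_V:
  assumes t: "t \<in> {-1..1}"
  shows "ennreal (V t) = (\<integral>\<^sup>+x. ennreal (L t x) \<partial>perp_lborel u)"
proof -
  have B[measurable]: "B t \<in> sets borel" using B_closed[OF t] by (rule borel_closed)
  have "ennreal (V t) = emeasure lborel (B t)"
    unfolding V_def using emeasure_bounded_finite[OF compact_imp_bounded[OF B_compact[OF t]]] B
    by (subst measure_completion) (auto intro!: emeasure_eq_ennreal_measure[symmetric] simp: less_top)
  also have "\<dots> = (\<integral>\<^sup>+x. indicator (B t) x \<partial>lborel)" by simp
  also have "\<dots> = (\<integral>\<^sup>+x. ennreal (L t x) \<partial>perp_lborel u)"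
    unfolding ennreal_L[OF t] by (rule nn_integral_lborel_perp[OF u]) measurable
  finally show ?thesis .
qed

lemma V_mono:
  assumes t: "t' \<in> {-1..1}" "\<bar>t\<bar> \<le> \<bar>t'\<bar>"
  shows "V t' \<le> V t"
proof -
  have tt: "t \<in> {-1..1}" using t by auto
  have "ennreal (V t') \<le> ennreal (V t)"
    unfolding ennreal_V[OF t(1)] ennreal_V[OF tt]
    using AE_perp_lborel[OF u] by (intro nn_integral_mono_AE, eventually_elim) (intro ennreal_leI L_le_of_abs_le t)
  then show ?thesis by (simp add: V_def ennreal_le_iff)
qed

text \<open>The full cylinder over the projection rather than the projection itself; it is closed
  and convex and has interior points in the whole space.\<close>

definition D :: "'a set" where "D = {x. S 1 x \<noteq> {}}"

lemma D_eq: "D = {b + c | b c. b \<in> B 1 \<and> c \<in> range (\<lambda>s. s *\<^sub>R u)}"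
proof (intro set_eqI iffI)
  fix x assume "x \<in> D"
  then obtain s where "x + s *\<^sub>R u \<in> B 1" by (auto simp: D_def S_eq)
  then show "x \<in> {b + c | b c. b \<in> B 1 \<and> c \<in> range (\<lambda>s. s *\<^sub>R u)}"
  proof -
    assume b: "x + s *\<^sub>R u \<in> B 1"
    have "x = (x + s *\<^sub>R u) + (- s) *\<^sub>R u" by simp
    with b show ?thesis by blast
  qed
next
  fix x assume "x \<in> {b + c | b c. b \<in> B 1 \<and> c \<in> range (\<lambda>s. s *\<^sub>R u)}"
  then obtain b s where "b \<in> B 1" "x = b + s *\<^sub>R u" by blast
  then have "- s \<in> S 1 x" by (simp add: S_eq)
  then show "x \<in> D" by (auto simp: D_def)
qed

lemma D_closed: "closed D"
proof -
  have "range (\<lambda>s::real. s *\<^sub>R u) = span {u}" by (simp add: span_singleton)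
  then have "closed (range (\<lambda>s::real. s *\<^sub>R u))" by simp
  then have "closed (\<Union>x\<in>B 1. \<Union>y\<in>range (\<lambda>s. s *\<^sub>R u). {x + y})"
    by (intro compact_closed_sums B_compact) simp_all
  moreover have "(\<Union>x\<in>B 1. \<Union>y\<in>range (\<lambda>s. s *\<^sub>R u). {x + y}) = D" unfolding D_eq by blast
  ultimately show ?thesis by simp
qed

lemma D_convex: "convex D"
proof -
  have "range (\<lambda>s::real. s *\<^sub>R u) = span {u}" by (simp add: span_singleton)
  then have "convex (range (\<lambda>s::real. s *\<^sub>R u))" by (simp only: subspace_imp_convex subspace_span)
  moreover have "convex (B 1)" by (rule B_convex) simp
  ultimately have "convex (\<Union>x\<in>B 1. \<Union>y\<in>range (\<lambda>s. s *\<^sub>R u). {x + y})" by (intro convex_sums)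
  moreover have "(\<Union>x\<in>B 1. \<Union>y\<in>range (\<lambda>s. s *\<^sub>R u). {x + y}) = D" unfolding D_eq by blast
  ultimately show ?thesis by simp
qed

lemma D_interior: "0 \<in> interior D"
proof -
  have o: "open {v. w 1 v < 1}" by (intro open_Collect_less w_cont continuous_on_const) simp
  have "{v. w 1 v < 1} \<subseteq> D"
  proof
    fix v assume "v \<in> {v. w 1 v < 1}"
    then have "0 \<in> S 1 v" by (simp add: S_def)
    then show "v \<in> D" by (auto simp: D_def)
  qed
  moreover have "0 \<in> {v. w 1 v < 1}" using w_zero[of 1] by simp
  ultimately show ?thesis using o by (meson interiorI)
qed

text \<open>On \<open>D\<close>, concavity between 0 and 1 adds at least
  \<open>(1 - t) * g x\<close> to the length at 1; outside \<open>D\<close> the function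
  \<open>g\<close> is 0. After integration the difference quotient is at most minus the integral of
  \<open>g\<close>, which must therefore vanish.\<close>

lemma L_eq_on_D:
  assumes lim: "((\<lambda>t. (V t - V 1) / (t - 1)) \<longlongrightarrow> 0) (at_left 1)"
  shows "AE x in perp_lborel u. x \<in> D \<longrightarrow> L 0 x = L 1 x"
proof -
  have [measurable]: "D \<in> sets borel" using D_closed by (rule borel_closed)
  have [measurable]: "L 0 \<in> borel_measurable borel" "L 1 \<in> borel_measurable borel"
    by (auto intro: L_measurable)
  define g where "g x = indicator D x * (L 0 x - L 1 x)" for x
  have [measurable]: "g \<in> borel_measurable borel" unfolding g_def[abs_def] by measurable
  have g0: "0 \<le> g x" if "x \<bullet> u = 0" for x
    using L_le_of_abs_le[of 1 0 x] that by (simp add: g_def indicator_def)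
  define E where "E = (\<integral>\<^sup>+x. ennreal (g x) \<partial>perp_lborel u)"
  have key: "ennreal (V 1) + ennreal (1 - t) * E \<le> ennreal (V t)" if t: "0 \<le> t" "t < 1" for t
  proof -
    have t1: "t \<in> {-1..1}" using t by simp
    have "ennreal (V 1) + ennreal (1 - t) * E
        = (\<integral>\<^sup>+x. ennreal (L 1 x) + ennreal (1 - t) * ennreal (g x) \<partial>perp_lborel u)"
      unfolding E_def by (subst nn_integral_add) (auto simp: ennreal_V nn_integral_cmult)
    also have "\<dots> \<le> (\<integral>\<^sup>+x. ennreal (L t x) \<partial>perp_lborel u)"
    proof (rule nn_integral_mono_AE)
      show "AE x in perp_lborel u. ennreal (L 1 x) + ennreal (1 - t) * ennreal (g x) \<le> ennreal (L t x)"
      using AE_perp_lborel[OF u]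
    proof eventually_elim
      case (elim x)
      have "L 1 x + (1 - t) * g x \<le> L t x"
      proof (cases "x \<in> D")
        case False
        then show ?thesis using L_le_of_abs_le[of 1 t x] t elim by (simp add: g_def)
      next
        case True
        then have ne: "S 1 x \<noteq> {}" by (simp add: D_def)
        \<comment> \<open>The fibre at 0 contains the midpoints of points of the fibres at 1 and -1.
          Without a point in it, concavity could not be used between 0 and 1.\<close>
        have "S (-1) x \<noteq> {}" using S_refl_nonempty[of 1 x] ne elim by simp
        then obtain a b where "a \<in> S 1 x" "b \<in> S (-1) x" using ne by blast
        then have "(1 - 1/2) * a + (1/2) * b \<in> S ((1 - 1/2) * 1 + (1/2) * (-1)) x" by (intro S_combine) auto
        then have "S 0 x \<noteq> {}" by auto
        then have "(1 - t) * L 0 x + t * L 1 x \<le> L ((1 - t) * 0 + t * 1) x"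
          using t ne by (intro L_concave) auto
        then show ?thesis using True by (simp add: g_def algebra_simps)
      qed
      then have "ennreal (L 1 x + (1 - t) * g x) \<le> ennreal (L t x)" by (rule ennreal_leI)
      then show ?case using L_nonneg[of 1 x] g0[OF elim] t by (simp add: ennreal_mult ennreal_plus)
    qed
    qed
    also have "\<dots> = ennreal (V t)" using ennreal_V[OF t1] by simp
    finally show ?thesis .
  qed
  \<comment> \<open>At \<open>t = 0\<close> the key inequality bounds \<open>E\<close> by the finite
    volume \<open>V 0\<close>.\<close>
  have "E \<noteq> top"
  proof
    assume "E = top"
    with key[of 0] show False by (simp add: top_unique)
  qed
  then obtain e where e: "0 \<le> e" "E = ennreal e" by (cases E) auto
  have "(V t - V 1) / (t - 1) \<le> - e" if t: "0 \<le> t" "t < 1" for t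
  proof -
    have "0 \<le> V 1" by (simp add: V_def)
    then have "ennreal (V 1 + (1 - t) * e) \<le> ennreal (V t)"
      using key[OF t] t e by (simp add: ennreal_mult ennreal_plus)
    then have "V 1 + (1 - t) * e \<le> V t" by (simp add: V_def ennreal_le_iff)
    then show ?thesis using t by (simp add: field_simps)
  qed
  moreover have "\<forall>\<^sub>F t in at_left (1::real). 0 \<le> t \<and> t < 1"
    using eventually_at_left[of 0 "1::real"] by (auto intro!: exI[of _ 0])
  ultimately have "\<forall>\<^sub>F t in at_left 1. (V t - V 1) / (t - 1) \<le> - e"
    by (auto elim: eventually_mono)
  then have "0 \<le> - e" by (rule tendsto_upperbound[OF lim]) simp
  then have "E = 0" using e by simp
  then have "AE x in perp_lborel u. ennreal (g x) = 0"
    unfolding E_def by (subst (asm) nn_integral_0_iff_AE) auto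
  then show ?thesis using AE_perp_lborel[OF u]
  proof eventually_elim
    case (elim x)
    then have "g x = 0" using g0[of x] by (simp add: ennreal_eq_0_iff)
    then show ?case by (auto simp: g_def indicator_def split: if_splits)
  qed
qed

text \<open>Where the ray through \<open>y\<close> leaves \<open>D\<close>, strict convexity makes the fibre of \<open>B 1\<close> a single point
  while the fibre of \<open>B 0\<close> still has positive length; this persists in a neighbourhood.\<close>

lemma L_0_outside_D:
  assumes AE: "AE x in perp_lborel u. x \<in> D \<longrightarrow> L 0 x = L 1 x"
    and y: "y \<bullet> u = 0" "y \<notin> D"
  shows "L 0 y = 0"
proof (rule ccontr)
  assume "L 0 y \<noteq> 0"
  then have ne: "S 0 y \<noteq> {}" using L_empty by blast
  obtain a b where ab: "a \<le> b" "S 0 y = {a..b}"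
    using compact_convex_real_eq[OF S_compact S_convex ne] by auto
  have "a \<noteq> b" using \<open>L 0 y \<noteq> 0\<close> ab by (auto simp: L_def)
  have mem: "w 0 (y + a *\<^sub>R u) \<le> 1" "w 0 (y + b *\<^sub>R u) \<le> 1"
    using ab by (auto simp: S_def set_eq_iff)
  define s where "s = (a + b) / 2"
  have "y + a *\<^sub>R u + (b - a) *\<^sub>R u = y + (a + (b - a)) *\<^sub>R u"
      "y + a *\<^sub>R u + ((b - a) / 2) *\<^sub>R u = y + (a + (b - a) / 2) *\<^sub>R u"
    by (simp_all only: scaleR_add_left add.assoc)
  moreover have "a + (b - a) = b" "a + (b - a) / 2 = s" by (simp_all add: s_def field_simps)
  ultimately have e: "y + a *\<^sub>R u + (b - a) *\<^sub>R u = y + b *\<^sub>R u" "y + a *\<^sub>R u + ((b - a) / 2) *\<^sub>R u = y + s *\<^sub>R u"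
    by (simp_all only:)
  have "w 0 (y + s *\<^sub>R u) < (w 0 (y + a *\<^sub>R u) + w 0 (y + b *\<^sub>R u)) / 2"
    using w_strict[of 0 "b - a" "y + a *\<^sub>R u"] \<open>a \<noteq> b\<close> unfolding e by simp
  then have s: "w 0 (y + s *\<^sub>R u) < 1" using mem by simp
  \<comment> \<open>The last parameter \<open>r\<close> at which the ray through \<open>y\<close> is
    in \<open>D\<close> is less than 1, because \<open>y\<close> is outside.\<close>
  define T where "T = {r \<in> {0..1}. r *\<^sub>R y \<in> D}"
  have "T = {0..1} \<inter> (\<lambda>r. r *\<^sub>R y) -` D" by (auto simp: T_def)
  moreover have "closed ((\<lambda>r. r *\<^sub>R y) -` D)"
    by (intro continuous_closed_vimage D_closed) (intro continuous_intros)
  ultimately have T: "compact T" by (simp add: compact_Int_closed)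
  have "0 \<in> D" using D_interior interior_subset by blast
  then have T0: "0 \<in> T" by (simp add: T_def)
  then obtain r where r: "r \<in> T" "\<And>r'. r' \<in> T \<Longrightarrow> r' \<le> r"
    using compact_attains_sup[OF T] by blast
  have r01: "0 \<le> r" "r < 1"
    using r(1) y(2) unfolding T_def by (auto simp: order_le_less)
  define x\<^sub>0 where "x\<^sub>0 = r *\<^sub>R y"
  have x0u: "x\<^sub>0 \<bullet> u = 0" by (simp add: x\<^sub>0_def y)
  have x0D: "x\<^sub>0 \<in> D" using r(1) by (simp add: T_def x\<^sub>0_def)
  \<comment> \<open>A value below 1 would persist slightly beyond \<open>r\<close>, and the ray
    would still be in \<open>D\<close> there.\<close>
  have ge1: "1 \<le> w 1 (x\<^sub>0 + \<sigma> *\<^sub>R u)" for \<sigma>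
  proof (rule ccontr)
    assume "\<not> ?thesis"
    then have lt: "w 1 (r *\<^sub>R y + \<sigma> *\<^sub>R u) < 1" by (simp add: x\<^sub>0_def)
    have "((\<lambda>r'. w 1 (r' *\<^sub>R y + \<sigma> *\<^sub>R u)) \<longlongrightarrow> w 1 (r *\<^sub>R y + \<sigma> *\<^sub>R u)) (at_right r)"
      by (intro continuous_on_tendsto_compose[OF w_cont[of 1 UNIV]] tendsto_intros) auto
    then have "\<forall>\<^sub>F r' in at_right r. w 1 (r' *\<^sub>R y + \<sigma> *\<^sub>R u) < 1" using lt by (rule order_tendstoD(2))
    moreover have "\<forall>\<^sub>F r' in at_right r. r < r' \<and> r' < 1"
      using eventually_at_right[OF r01(2)] r01(2) by blast
    ultimately have "\<forall>\<^sub>F r' in at_right r. w 1 (r' *\<^sub>R y + \<sigma> *\<^sub>R u) < 1 \<and> r < r' \<and> r' < 1"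
      by eventually_elim simp
    then obtain r' where r': "w 1 (r' *\<^sub>R y + \<sigma> *\<^sub>R u) < 1" "r < r'" "r' < 1"
      using eventually_happens'[OF trivial_limit_at_right_real] by blast
    have "\<sigma> \<in> S 1 (r' *\<^sub>R y)" using r'(1) by (simp add: S_def)
    then have "r' \<in> T" using r' r01 by (auto simp: T_def D_def)
    then show False using r(2) r'(2) by fastforce
  qed
  have uniq: "\<sigma> = \<tau>" if st: "\<sigma> \<in> S 1 x\<^sub>0" "\<tau> \<in> S 1 x\<^sub>0" for \<sigma> \<tau>
  proof (rule ccontr)
    assume "\<sigma> \<noteq> \<tau>"
    have "x\<^sub>0 + \<sigma> *\<^sub>R u + (\<tau> - \<sigma>) *\<^sub>R u = x\<^sub>0 + (\<sigma> + (\<tau> - \<sigma>)) *\<^sub>R u"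
      "x\<^sub>0 + \<sigma> *\<^sub>R u + ((\<tau> - \<sigma>) / 2) *\<^sub>R u = x\<^sub>0 + (\<sigma> + (\<tau> - \<sigma>) / 2) *\<^sub>R u"
      by (simp_all only: scaleR_add_left add.assoc)
    moreover have "\<sigma> + (\<tau> - \<sigma>) = \<tau>" "\<sigma> + (\<tau> - \<sigma>) / 2 = (\<sigma> + \<tau>) / 2" by (simp_all add: field_simps)
    ultimately have e: "x\<^sub>0 + \<sigma> *\<^sub>R u + (\<tau> - \<sigma>) *\<^sub>R u = x\<^sub>0 + \<tau> *\<^sub>R u"
      "x\<^sub>0 + \<sigma> *\<^sub>R u + ((\<tau> - \<sigma>) / 2) *\<^sub>R u = x\<^sub>0 + ((\<sigma> + \<tau>) / 2) *\<^sub>R u"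
      by (simp_all only:)
    have "w 1 (x\<^sub>0 + ((\<sigma> + \<tau>) / 2) *\<^sub>R u) < (w 1 (x\<^sub>0 + \<sigma> *\<^sub>R u) + w 1 (x\<^sub>0 + \<tau> *\<^sub>R u)) / 2"
      using w_strict[of 1 "\<tau> - \<sigma>" "x\<^sub>0 + \<sigma> *\<^sub>R u"] \<open>\<sigma> \<noteq> \<tau>\<close> unfolding e by simp
    then have "w 1 (x\<^sub>0 + ((\<sigma> + \<tau>) / 2) *\<^sub>R u) < 1" using st by (simp add: S_def)
    then show False using ge1[of "(\<sigma> + \<tau>) / 2"] by simp
  qed
  \<comment> \<open>The value at \<open>y + s *\<^sub>R u\<close> is below 1 at time 0, and by
    homogeneity scaling the point by \<open>r < 1\<close> keeps it below 1.\<close>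
  have w0: "w 0 (x\<^sub>0 + (r * s) *\<^sub>R u) < 1"
  proof -
    have "x\<^sub>0 + (r * s) *\<^sub>R u = r *\<^sub>R (y + s *\<^sub>R u)" by (simp add: x\<^sub>0_def algebra_simps)
    then have "w 0 (x\<^sub>0 + (r * s) *\<^sub>R u) = r powr p * w 0 (y + s *\<^sub>R u)"
      using w_scale[of 0 r "y + s *\<^sub>R u"] r01 by simp
    also have "\<dots> \<le> r powr p * 1" using s by (intro mult_left_mono) auto
    also have "\<dots> < 1" using powr_less_mono2[of p r 1] r01 p by simp
    finally show ?thesis .
  qed
  have "open {v. w 0 v < 1}" by (intro open_Collect_less w_cont continuous_on_const) simp
  then obtain \<delta> where \<delta>: "0 < \<delta>" "ball (x\<^sub>0 + (r * s) *\<^sub>R u) (2 * \<delta>) \<subseteq> {v. w 0 v < 1}"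
    using w0 open_contains_ball[of "{v. w 0 v < 1}"] by (metis field_sum_of_halves half_gt_zero mem_Collect_eq mult_2)
  have L0: "\<delta> \<le> L 0 x" if x: "dist x\<^sub>0 x < \<delta>" for x
  proof -
    have "{r * s .. r * s + \<delta>} \<subseteq> S 0 x"
    proof
      fix \<sigma> assume \<sigma>: "\<sigma> \<in> {r * s .. r * s + \<delta>}"
      have "norm ((x\<^sub>0 + (r * s) *\<^sub>R u) - (x + \<sigma> *\<^sub>R u)) = norm ((x\<^sub>0 - x) + (r * s - \<sigma>) *\<^sub>R u)"
        by (simp add: algebra_simps)
      also have "\<dots> \<le> norm (x\<^sub>0 - x) + norm ((r * s - \<sigma>) *\<^sub>R u)" by (rule norm_triangle_ineq)
      also have "\<dots> < \<delta> + \<delta>" using x \<sigma> unfolding norm_scaleR u dist_norm by auto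
      finally have "x + \<sigma> *\<^sub>R u \<in> ball (x\<^sub>0 + (r * s) *\<^sub>R u) (2 * \<delta>)" by (simp add: dist_norm)
      then show "\<sigma> \<in> S 0 x" using \<delta>(2) by (auto simp: S_def less_imp_le)
    qed
    moreover have "S 0 x \<in> fmeasurable lborel"
      using S_compact[of 0 x] by (intro fmeasurable_compact) auto
    ultimately have "measure lborel {r * s .. r * s + \<delta>} \<le> measure lborel (S 0 x)"
      by (intro measure_mono_fmeasurable) auto
    then show ?thesis using \<delta>(1) by (simp add: L_def)
  qed
  \<comment> \<open>Pairs in \<open>B 1\<close> on a common line with gap at least \<delta> form a
    compact set, so their projection is closed. It misses \<open>x\<^sub>0\<close>, whose fibre is a
    single point; hence on all nearby lines the fibre at time 1 is shorter than \<delta>.\<close>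
  define C where "C = {z \<in> B 1 \<times> B 1. perp_part u (fst z) = perp_part u (snd z) \<and> \<delta> \<le> (snd z - fst z) \<bullet> u}"
  have C: "compact C"
  proof -
    have "C = (B 1 \<times> B 1) \<inter> {z. perp_part u (fst z) = perp_part u (snd z) \<and> \<delta> \<le> (snd z - fst z) \<bullet> u}"
      by (auto simp: C_def)
    moreover have "closed {z. perp_part u (fst z) = perp_part u (snd z) \<and> \<delta> \<le> (snd z - fst z) \<bullet> u}"
      by (intro closed_Collect_conj closed_Collect_eq closed_Collect_le continuous_intros)
    ultimately show ?thesis by (simp add: compact_Int_closed compact_Times B_compact)
  qed
  let ?PC = "(\<lambda>z. perp_part u (fst z)) ` C"
  have PC: "closed ?PC"
    by (intro compact_imp_closed compact_continuous_image C continuous_intros)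
  have "x\<^sub>0 \<notin> ?PC"
  proof
    assume "x\<^sub>0 \<in> ?PC"
    then obtain v v' where v: "v \<in> B 1" "v' \<in> B 1" "perp_part u v = x\<^sub>0" "perp_part u v' = x\<^sub>0"
        "\<delta> \<le> (v' - v) \<bullet> u"
      by (auto simp: C_def)
    have "v \<bullet> u \<in> S 1 x\<^sub>0" "v' \<bullet> u \<in> S 1 x\<^sub>0"
      unfolding S_eq using v perp_part_decomp[of u v] perp_part_decomp[of u v'] by auto
    then have "v \<bullet> u = v' \<bullet> u" by (rule uniq)
    then show False using v(5) \<delta>(1) by (simp add: inner_diff_left)
  qed
  then obtain \<delta>' where \<delta>': "0 < \<delta>'" "ball x\<^sub>0 \<delta>' \<subseteq> - ?PC"
    using PC open_contains_ball[of "- ?PC"] by (metis ComplI open_Compl)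
  have L1: "L 1 x < \<delta>" if x: "x \<in> ball x\<^sub>0 \<delta>'" "x \<bullet> u = 0" for x
  proof (rule ccontr)
    assume n: "\<not> L 1 x < \<delta>"
    then have ne: "S 1 x \<noteq> {}" using \<delta>(1) L_empty by fastforce
    have "compact (S 1 x)" "convex (S 1 x)" by (simp_all add: S_compact S_convex)
    from compact_convex_real_eq[OF this ne] obtain a b where ab: "a \<le> b" "S 1 x = {a..b}" by blast
    then have "\<delta> \<le> b - a" using n by (simp add: L_def)
    moreover have "x + a *\<^sub>R u \<in> B 1" "x + b *\<^sub>R u \<in> B 1" using ab unfolding S_eq by auto
    ultimately have "(x + a *\<^sub>R u, x + b *\<^sub>R u) \<in> C"
      unfolding C_def using unit_inner_self[OF u]
      by (simp add: perp_part_add_dir[OF u] inner_diff_left inner_add_left)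
    then have "perp_part u (x + a *\<^sub>R u) \<in> ?PC" by (rule image_eqI[rotated]) simp
    then have "x \<in> ?PC" by (simp only: perp_part_add_dir[OF u] perp_part_eq[OF x(2)])
    then show False using \<delta>'(2) x(1) by blast
  qed
  define \<rho> where "\<rho> = min \<delta> \<delta>'"
  have \<rho>: "0 < \<rho>" using \<delta> \<delta>' by (simp add: \<rho>_def)
  define W where "W = interior D \<inter> ball x\<^sub>0 \<rho>"
  have W: "open W" by (simp add: W_def open_Int)
  \<comment> \<open>A short step from \<open>x\<^sub>0\<close> towards the interior point 0 leads
    into the interior of \<open>D\<close> without leaving the ball.\<close>
  define e where "e = min 1 (\<rho> / (2 * (norm x\<^sub>0 + 1)))"
  have e: "0 < e" "e \<le> 1" using \<rho> by (auto simp: e_def add_nonneg_pos)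
  have "x\<^sub>0 - e *\<^sub>R (x\<^sub>0 - 0) \<in> interior D"
    by (intro mem_interior_convex_shrink D_convex D_interior x0D e)
  moreover have "x\<^sub>0 - e *\<^sub>R (x\<^sub>0 - 0) \<in> ball x\<^sub>0 \<rho>"
  proof -
    have "e * norm x\<^sub>0 \<le> (\<rho> / (2 * (norm x\<^sub>0 + 1))) * (norm x\<^sub>0 + 1)"
      using \<rho> by (intro mult_mono) (auto simp: e_def)
    also have "\<dots> = \<rho> / 2" by (simp add: field_simps add_nonneg_eq_0_iff)
    finally show ?thesis using \<rho> e by (simp add: dist_norm)
  qed
  ultimately have "x\<^sub>0 - e *\<^sub>R (x\<^sub>0 - 0) \<in> W" by (simp add: W_def)
  then have "0 < emeasure (perp_lborel u) W"
    by (rule emeasure_perp_lborel_open_pos[OF u W]) (simp add: inner_diff_left x0u)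
  moreover have "emeasure (perp_lborel u) W = 0"
  proof -
    have "AE x in perp_lborel u. x \<notin> W"
      using AE AE_perp_lborel[OF u]
    proof eventually_elim
      case (elim x)
      show ?case
      proof
        assume xW: "x \<in> W"
        then have "x \<in> D" using interior_subset by (auto simp: W_def)
        then have "L 0 x = L 1 x" using elim by blast
        moreover have "\<delta> \<le> L 0 x" using xW by (intro L0) (auto simp: W_def \<rho>_def)
        moreover have "L 1 x < \<delta>" using xW elim by (intro L1) (auto simp: W_def \<rho>_def)
        ultimately show False by simp
      qed
    qed
    then show ?thesis using W by (intro AE_iff_measurable[THEN iffD1, of W "perp_lborel u" "\<lambda>x. x \<notin> W"]) auto
  qed
  ultimately show False by simp
qed

theorem V_constant:
  assumes lim: "((\<lambda>t. (V t - V 1) / (t - 1)) \<longlongrightarrow> 0) (at_left 1)"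
  shows "t \<in> {-1..1} \<Longrightarrow> V t = V 1"
proof -
  note AE = L_eq_on_D[OF lim]
  have "ennreal (V 0) \<le> ennreal (V 1)"
    unfolding ennreal_V[of 0, simplified] ennreal_V[of 1, simplified]
  proof (rule nn_integral_mono_AE)
    show "AE x in perp_lborel u. ennreal (L 0 x) \<le> ennreal (L 1 x)"
      using AE AE_perp_lborel[OF u]
    proof eventually_elim
      case (elim x)
      then show ?case using L_0_outside_D[OF AE, of x] by (cases "x \<in> D") auto
    qed
  qed
  then have 01: "V 0 \<le> V 1" by (simp add: V_def ennreal_le_iff)
  assume t: "t \<in> {-1..1}"
  have "V 1 \<le> V t" using t by (intro V_mono) auto
  moreover have "V t \<le> V 0" using t by (intro V_mono) auto
  ultimately show "V t = V 1" using 01 by simp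
qed

end

section \<open>Smooth strictly convex bodies\<close>

lemma outer_unit_normal_exists:
  fixes K :: "'a::euclidean_space set"
  assumes K: "convex K" "interior K \<noteq> {}" and x: "x \<in> K" "x \<notin> interior K"
  obtains \<theta> where "outer_unit_normal K x \<theta>"
proof -
  have "x \<notin> rel_interior K" using x(2) rel_interior_nonempty_interior[OF K(2)] by simp
  then obtain a where a: "a \<noteq> 0" "\<And>y. y \<in> K \<Longrightarrow> a \<bullet> x \<le> a \<bullet> y"
    using supporting_hyperplane_rel_boundary[OF K(1) x(1)] closure_subset by metis
  have "outer_unit_normal K x (- (1 / norm a) *\<^sub>R a)"
    unfolding outer_unit_normal_def
  proof (intro conjI ballI)
    show "norm (- (1 / norm a) *\<^sub>R a) = 1" using a(1) by simp
    fix y assume "y \<in> K"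
    then have "(1 / norm a) * (x \<bullet> a) \<le> (1 / norm a) * (y \<bullet> a)"
      using a(2)[of y] by (intro mult_left_mono) (auto simp: inner_commute)
    then show "y \<bullet> (- (1 / norm a) *\<^sub>R a) \<le> x \<bullet> (- (1 / norm a) *\<^sub>R a)" by simp
  qed (rule x(1))
  then show thesis by (rule that)
qed

lemma outer_unit_normal_interior:
  fixes K :: "'a::euclidean_space set"
  assumes n: "outer_unit_normal K x \<theta>" and y: "y \<in> interior K"
  shows "y \<bullet> \<theta> < x \<bullet> \<theta>"
proof -
  have n1: "norm \<theta> = 1" using n by (simp add: outer_unit_normal_def)
  obtain e where e: "e > 0" "ball y e \<subseteq> K" using y by (auto simp: mem_interior)
  have "y + (e/2) *\<^sub>R \<theta> \<in> ball y e" using e(1) by (simp add: dist_norm n1)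
  then have "(y + (e/2) *\<^sub>R \<theta>) \<bullet> \<theta> \<le> x \<bullet> \<theta>" using e(2) n by (auto simp: outer_unit_normal_def)
  then have "y \<bullet> \<theta> + e/2 \<le> x \<bullet> \<theta>"
    unfolding inner_add_left inner_scaleR_left unit_inner_self[OF n1] by simp
  then show ?thesis using e(1) by linarith
qed

lemma outer_unit_normal_frontier:
  fixes K :: "'a::euclidean_space set"
  assumes n: "outer_unit_normal K x \<theta>" shows "x \<in> frontier K"
proof -
  have "x \<in> K" using n by (simp add: outer_unit_normal_def)
  moreover have "x \<notin> interior K" using outer_unit_normal_interior[OF n, of x] by blast
  ultimately show ?thesis using closure_subset unfolding frontier_def by blast
qed

text \<open>The hypothesis concerns the open half-space, which is what negative directional
  derivatives provide; the directions orthogonal to \<open>g\<close> are reached by subtracting a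
  small multiple of \<open>g\<close>.\<close>

lemma eq_normalized_of_halfspace:
  fixes g \<theta> :: "'a::real_inner"
  assumes g: "g \<noteq> 0" and \<theta>: "norm \<theta> = 1" and le: "\<And>v. v \<bullet> g < 0 \<Longrightarrow> v \<bullet> \<theta> \<le> 0"
  shows "\<theta> = (1 / norm g) *\<^sub>R g"
proof -
  have gg: "0 < g \<bullet> g" using g by simp
  have le0: "v \<bullet> \<theta> \<le> 0" if v: "v \<bullet> g = 0" for v
  proof (rule field_le_epsilon)
    fix e :: real assume e: "0 < e"
    define d where "d = e / (\<bar>g \<bullet> \<theta>\<bar> + 1)"
    have d: "0 < d" using e by (simp add: d_def)
    have "(v - d *\<^sub>R g) \<bullet> g < 0" using v d gg by (simp add: inner_diff_left)
    then have "(v - d *\<^sub>R g) \<bullet> \<theta> \<le> 0" by (rule le)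
    then have "v \<bullet> \<theta> \<le> d * (g \<bullet> \<theta>)" by (simp add: inner_diff_left)
    also have "\<dots> \<le> d * (\<bar>g \<bullet> \<theta>\<bar> + 1)" using d by (intro mult_left_mono) auto
    also have "\<dots> = e" by (simp add: d_def)
    finally show "v \<bullet> \<theta> \<le> 0 + e" by simp
  qed
  define c where "c = (\<theta> \<bullet> g) / (g \<bullet> g)"
  define w where "w = \<theta> - c *\<^sub>R g"
  have wg: "w \<bullet> g = 0" using gg by (simp add: w_def c_def inner_diff_left)
  have "w \<bullet> \<theta> = 0" using le0[OF wg] le0[of "- w"] wg by simp
  moreover have "w \<bullet> w = w \<bullet> \<theta> - c * (w \<bullet> g)" by (subst (2) w_def) (simp add: inner_diff_right)
  ultimately have "w \<bullet> w = 0" using wg by simp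
  then have tc: "\<theta> = c *\<^sub>R g" by (simp add: w_def)
  have "(- g) \<bullet> \<theta> \<le> 0" using gg by (intro le) simp
  then have c0: "0 \<le> c" using gg by (simp add: c_def inner_commute)
  have "c * norm g = 1" using \<theta> c0 unfolding tc by simp
  then have "c = 1 / norm g" using g by (simp add: field_simps)
  then show ?thesis using tc by simp
qed

text \<open>In a direction along which the defining function decreases, points near \<open>x\<close>
  belong to \<open>K\<close>, so a normal has no positive product with that direction. This leaves
  only the direction of the gradient.\<close>

lemma C2_boundary_regular:
  fixes K :: "'a::euclidean_space set"
  assumes C2: "C2_boundary K" and K: "convex K" "closed K" "interior K \<noteq> {}"
  shows "frontier K \<subseteq> regular_boundary K"
proof
  fix x assume x: "x \<in> frontier K"
  then have xK: "x \<in> K" "x \<notin> interior K" using K frontier_subset_closed by (auto simp: frontier_def)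
  obtain U and F :: "'a \<Rightarrow> real" and G where U: "open U" "x \<in> U" and G: "GDERIV F x :> G x" "G x \<noteq> 0"
    and KU: "K \<inter> U = {y \<in> U. F y \<le> 0}"
    using C2 x unfolding C2_boundary_def by metis
  have dF: "(F has_derivative (\<lambda>h. h \<bullet> G x)) (at x)" using G(1) by (simp add: gderiv_def)
  have "x \<in> K \<inter> U" using xK(1) U(2) by blast
  then have "F x \<le> 0" unfolding KU by simp
  \<comment> \<open>A negative value would persist nearby and make \<open>x\<close> an interior
    point.\<close>
  have "F x = 0"
  proof (rule ccontr)
    assume "F x \<noteq> 0"
    then have "F x < 0" using \<open>F x \<le> 0\<close> by simp
    moreover have "isCont F x" using dF by (rule has_derivative_continuous)
    ultimately have "\<forall>\<^sub>F y in nhds x. F y < 0"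
      unfolding continuous_at tendsto_at_iff_tendsto_nhds by (rule order_tendstoD(2)[rotated])
    moreover have "\<forall>\<^sub>F y in nhds x. y \<in> U" using U by (rule eventually_nhds_in_open)
    ultimately have "\<forall>\<^sub>F y in nhds x. y \<in> K" 
    proof eventually_elim
      case (elim y)
      then have "y \<in> {y \<in> U. F y \<le> 0}" by simp
      then show ?case using KU by blast
    qed
    then show False using xK(2) by (meson eventually_nhds interiorI subsetI)
  qed
  have uniq: "\<theta> = (1 / norm (G x)) *\<^sub>R G x" if n: "outer_unit_normal K x \<theta>" for \<theta>
  proof (rule eq_normalized_of_halfspace[OF G(2)])
    show "norm \<theta> = 1" using n by (simp add: outer_unit_normal_def)
    fix v assume v: "v \<bullet> G x < 0"
    have "((\<lambda>h. x + h *\<^sub>R v) has_derivative (\<lambda>h. h *\<^sub>R v)) (at (0::real))"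
      by (auto intro!: derivative_eq_intros)
    moreover have "(F has_derivative (\<lambda>h. h \<bullet> G x)) (at (x + 0 *\<^sub>R v))" using dF by simp
    ultimately have "((\<lambda>h. F (x + h *\<^sub>R v)) has_derivative (\<lambda>h. (h *\<^sub>R v) \<bullet> G x)) (at 0)"
      by (rule has_derivative_compose)
    then have "((\<lambda>h. F (x + h *\<^sub>R v)) has_real_derivative (v \<bullet> G x)) (at 0)"
      unfolding has_field_derivative_def
      by (rule has_derivative_eq_rhs) (simp add: fun_eq_iff mult.commute)
    from DERIV_neg_dec_right[OF this v] obtain d where d: "0 < d" "\<And>h. 0 < h \<Longrightarrow> h < d \<Longrightarrow> F (x + h *\<^sub>R v) < 0"
      using \<open>F x = 0\<close> by auto
    have "((\<lambda>h. x + h *\<^sub>R v) \<longlongrightarrow> x + 0 *\<^sub>R v) (at_right (0::real))" by (intro tendsto_intros)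
    then have "\<forall>\<^sub>F h in at_right (0::real). x + h *\<^sub>R v \<in> U" using U by (intro topological_tendstoD) auto
    moreover have "\<forall>\<^sub>F h in at_right (0::real). 0 < h \<and> h < d"
      using eventually_at_right[OF d(1)] d(1) by blast
    ultimately have "\<forall>\<^sub>F h in at_right (0::real). x + h *\<^sub>R v \<in> U \<and> 0 < h \<and> h < d" by eventually_elim simp
    then obtain h where h: "x + h *\<^sub>R v \<in> U" "0 < h" "h < d"
      using eventually_happens'[OF trivial_limit_at_right_real] by blast
    then have "x + h *\<^sub>R v \<in> {y \<in> U. F y \<le> 0}" using d(2)[OF h(2,3)] by simp
    then have "x + h *\<^sub>R v \<in> K" using KU by blast
    then have "(x + h *\<^sub>R v) \<bullet> \<theta> \<le> x \<bullet> \<theta>" using n by (simp add: outer_unit_normal_def)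
    then show "v \<bullet> \<theta> \<le> 0" using h(2) by (simp add: inner_add_left mult_le_0_iff)
  qed
  obtain \<theta> where "outer_unit_normal K x \<theta>" using outer_unit_normal_exists[OF K(1,3) xK] .
  then show "x \<in> regular_boundary K" using x uniq unfolding regular_boundary_def by blast
qed

text \<open>The derivative of a Gauss map that is constant along a segment kills the direction of
  the segment. This direction is tangential, so the endomorphism whose determinant is the curvature
  has a nontrivial kernel.\<close>

lemma gauss_curvature_no_segment:
  fixes K :: "(real^'n) set"
  assumes gc: "has_gauss_curvature K m \<kappa>" "\<kappa> \<noteq> 0" and d: "d \<noteq> 0" "d \<bullet> gauss_map K m = 0"
    and seg: "\<And>h. \<bar>h\<bar> \<le> 1 \<Longrightarrow> m + h *\<^sub>R d \<in> frontier K \<and> gauss_map K (m + h *\<^sub>R d) = gauss_map K m"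
  shows False
proof -
  let ?\<nu> = "gauss_map K m"
  obtain W where W: "(gauss_map K has_derivative W) (at m within frontier K)"
    and \<kappa>: "\<kappa> = det (matrix (\<lambda>v. W (v - (v \<bullet> ?\<nu>) *\<^sub>R ?\<nu>) + (v \<bullet> ?\<nu>) *\<^sub>R ?\<nu>))"
    using gc(1) unfolding has_gauss_curvature_def Let_def by blast
  have lW: "linear W" using W by (simp add: has_derivative_linear)
  \<comment> \<open>The derivative is taken within the boundary and can be tested on differences of
    boundary points only; the segment supplies them.\<close>
  have "norm (W d) \<le> e * norm d" if e: "0 < e" for e
  proof -
    obtain \<delta> where \<delta>: "0 < \<delta>" "\<And>y. y \<in> frontier K \<Longrightarrow> norm (y - m) < \<delta> \<Longrightarrow>
        norm (gauss_map K y - ?\<nu> - W (y - m)) \<le> e * norm (y - m)"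
      using W e unfolding has_derivative_within_alt by blast
    define h where "h = min 1 (\<delta> / (2 * norm d))"
    have h: "0 < h" "h \<le> 1" using \<delta>(1) d(1) by (auto simp: h_def)
    have "h * norm d \<le> (\<delta> / (2 * norm d)) * norm d" by (intro mult_right_mono) (auto simp: h_def)
    also have "\<dots> = \<delta> / 2" using d(1) by simp
    finally have "norm (m + h *\<^sub>R d - m) < \<delta>" using \<delta>(1) h by simp
    moreover have "\<bar>h\<bar> \<le> 1" using h by simp
    ultimately have "norm (gauss_map K (m + h *\<^sub>R d) - ?\<nu> - W (m + h *\<^sub>R d - m)) \<le> e * norm (m + h *\<^sub>R d - m)"
      using \<delta>(2) seg by blast
    moreover have "gauss_map K (m + h *\<^sub>R d) = ?\<nu>" using seg \<open>\<bar>h\<bar> \<le> 1\<close> by blast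
    ultimately have "h * norm (W d) \<le> h * (e * norm d)"
      using h by (simp add: linear_scale[OF lW] mult.left_commute)
    then show ?thesis using h(1) by simp
  qed
  have Wd: "W d = 0"
  proof (rule ccontr)
    assume "W d \<noteq> 0"
    then have "norm (W d) \<le> norm (W d) / (2 * norm d) * norm d"
      using d(1) \<open>\<And>e. 0 < e \<Longrightarrow> norm (W d) \<le> e * norm d\<close>[of "norm (W d) / (2 * norm d)"] by simp
    then show False using d(1) \<open>W d \<noteq> 0\<close> by simp
  qed
  define A where "A v = W (v - (v \<bullet> ?\<nu>) *\<^sub>R ?\<nu>) + (v \<bullet> ?\<nu>) *\<^sub>R ?\<nu>" for v
  have lA: "linear A"
    unfolding A_def
    by (intro linear_compose_add linear_compose[OF _ lW, unfolded o_def] linear_compose_sub linear_ident)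
       (auto intro!: linearI simp: inner_add_left scaleR_add_left)
  have "A d = 0" unfolding A_def d(2) by (simp add: Wd)
  then have Md: "matrix A *v d = 0" using matrix_works[OF lA[unfolded linear_matrix_vector_mul_eq[symmetric]]] by simp
  have "det (matrix A) \<noteq> 0" using \<kappa> gc(2) unfolding A_def[abs_def] by simp
  then have "inj ((*v) (matrix A))" by (simp add: invertible_det_nz inj_matrix_vector_mult)
  then have "d = 0" using Md by (metis injD matrix_vector_mult_0_right)
  then show False using d(1) by blast
qed

locale smooth_strict_body =
  fixes K :: "(real^'n) set"
  assumes body: "convex_body K" and zero: "0 \<in> interior K"
    and smooth: "frontier K \<subseteq> regular_boundary K"
    and strict: "\<And>a b. a \<in> K \<Longrightarrow> b \<in> K \<Longrightarrow> a \<noteq> b \<Longrightarrow> (1/2) *\<^sub>R (a + b) \<in> interior K"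

lemma zero_interior_of_symmetric:
  fixes K :: "'a::euclidean_space set"
  assumes "convex_body K" "origin_symmetric K"
  shows "0 \<in> interior K"
proof -
  obtain a where a: "a \<in> interior K" using assms(1) by (auto simp: convex_body_def)
  then have "a \<in> K" using interior_subset by blast
  then have "- a \<in> uminus ` K" by (rule imageI)
  then have "- a \<in> K" using assms(2) by (simp add: origin_symmetric_def)
  then have "- a - (1/2) *\<^sub>R (- a - a) \<in> interior K"
    using assms(1) a by (intro mem_interior_convex_shrink) (auto simp: convex_body_def)
  moreover have "- a - (1/2) *\<^sub>R (- a - a) = 0"
  proof -
    have "- a - a = (-2) *\<^sub>R a" by (metis add_uminus_conv_diff scaleR_2 scaleR_minus_left minus_add_distrib)
    then show ?thesis by simp
  qed
  ultimately show ?thesis by simp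
qed

text \<open>For strict convexity: if the midpoint of a chord were on the boundary, its normal would
  be orthogonal to the chord, since both ends lie on one side of the supporting hyperplane. It would
  then be the normal along the whole chord, against positive curvature.\<close>

lemma smooth_strict_body_of_class_C2_plus:
  fixes K :: "(real^'n) set"
  assumes K: "convex_body K" "origin_symmetric K" "class_C2_plus K"
  shows "smooth_strict_body K"
proof
  show "convex_body K" by fact
  show "0 \<in> interior K" by (rule zero_interior_of_symmetric[OF K(1,2)])
  have cK: "convex K" "closed K" "interior K \<noteq> {}"
    using K(1) compact_imp_closed by (auto simp: convex_body_def)
  show sm: "frontier K \<subseteq> regular_boundary K"
    using K(3) cK by (intro C2_boundary_regular) (auto simp: class_C2_plus_def)
  fix a b assume ab: "a \<in> K" "b \<in> K" "a \<noteq> b"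
  define m where "m = (1/2) *\<^sub>R (a + b)"
  define d where "d = (1/2) *\<^sub>R (b - a)"
  have am: "a = m + (-1) *\<^sub>R d" and bm: "b = m + 1 *\<^sub>R d"
    by (simp_all add: m_def d_def algebra_simps flip: scaleR_add_left)
  have seg: "m + h *\<^sub>R d \<in> K" if "\<bar>h\<bar> \<le> 1" for h
  proof -
    have "((1 - h) / 2) *\<^sub>R a + ((1 + h) / 2) *\<^sub>R b \<in> K"
      using that by (intro convexD[OF cK(1) ab(1,2)]) (auto simp: field_simps)
    also have "((1 - h) / 2) *\<^sub>R a + ((1 + h) / 2) *\<^sub>R b
        = ((1 - h) / 2 + (1 + h) / 2) *\<^sub>R m + ((1 + h) / 2 - (1 - h) / 2) *\<^sub>R d"
      unfolding am bm by (simp add: algebra_simps)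
    also have "(1 - h) / 2 + (1 + h) / 2 = 1" by (simp add: field_simps)
    also have "(1 + h) / 2 - (1 - h) / 2 = h" by (simp add: field_simps)
    finally show ?thesis by simp
  qed
  have mK: "m \<in> K" using seg[of 0] by simp
  show "(1/2) *\<^sub>R (a + b) \<in> interior K"
  proof (rule ccontr)
    assume "(1/2) *\<^sub>R (a + b) \<notin> interior K"
    then have "m \<in> frontier K" using mK closure_subset unfolding frontier_def m_def by blast
    then have mR: "m \<in> regular_boundary K" using sm by blast
    let ?\<nu> = "gauss_map K m"
    have n: "outer_unit_normal K m ?\<nu>" by (rule gauss_map_normal[OF mR])
    have le: "y \<bullet> ?\<nu> \<le> m \<bullet> ?\<nu>" if "y \<in> K" for y using n that by (simp add: outer_unit_normal_def)
    have "(m + (-1) *\<^sub>R d) \<bullet> ?\<nu> \<le> m \<bullet> ?\<nu>" "(m + 1 *\<^sub>R d) \<bullet> ?\<nu> \<le> m \<bullet> ?\<nu>"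
      using le ab(1,2) am bm by metis+
    then have dn: "d \<bullet> ?\<nu> = 0" by (simp add: inner_add_left inner_diff_left)
    have "m + h *\<^sub>R d \<in> frontier K \<and> gauss_map K (m + h *\<^sub>R d) = ?\<nu>" if h: "\<bar>h\<bar> \<le> 1" for h
    proof -
      have "outer_unit_normal K (m + h *\<^sub>R d) ?\<nu>"
        using n seg[OF h] unfolding outer_unit_normal_def by (simp add: inner_add_left dn)
      then show ?thesis using outer_unit_normal_frontier gauss_map_eqI sm by blast
    qed
    moreover obtain \<kappa> where "0 < \<kappa>" "has_gauss_curvature K m \<kappa>"
      using K(3) \<open>m \<in> frontier K\<close> unfolding class_C2_plus_def by blast
    moreover have "d \<noteq> 0" using ab(3) by (simp add: d_def)
    ultimately show False using gauss_curvature_no_segment[of K m \<kappa> d] dn by auto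
  qed
qed

section \<open>The upper graph function of the body and its gradient\<close>

context smooth_strict_body
begin

lemma K_compact: "compact K" and K_convex: "convex K" and K_closed: "closed K"
  using body compact_imp_closed by (auto simp: convex_body_def)

definition shadow :: "real^'n \<Rightarrow> (real^'n) set" where "shadow u = perp_part u ` K"

definition shadow_int :: "real^'n \<Rightarrow> (real^'n) set" where "shadow_int u = perp_part u ` interior K"

abbreviation top_f :: "real^'n \<Rightarrow> real^'n \<Rightarrow> real" where "top_f \<equiv> \<lambda>u. upper_graph u K"

text \<open>The normal to the graph of a function \<open>f\<close> is proportional to
  \<open>u - \<nabla>f\<close>, so the gradient is minus the tangential part of the normal divided
  by its component along \<open>u\<close>.\<close>

definition top_grad :: "real^'n \<Rightarrow> real^'n \<Rightarrow> real^'n" where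
  "top_grad u x = (let \<nu> = gauss_map K (graph_map u (top_f u) x) in - (1 / (\<nu> \<bullet> u)) *\<^sub>R perp_part u \<nu>)"

lemma shadow_uminus: "shadow (- u) = shadow u" "shadow_int (- u) = shadow_int u"
  by (simp_all add: shadow_def shadow_int_def perp_part_uminus_dir)

lemma lower_graph_eq: "lower_graph u K x = - upper_graph (- u) K x"
proof -
  have "{s. x + s *\<^sub>R (- u) \<in> K} = uminus ` {s. x + s *\<^sub>R u \<in> K}"
  proof (intro set_eqI iffI)
    fix s assume "s \<in> {s. x + s *\<^sub>R (- u) \<in> K}"
    then have "- s \<in> {s. x + s *\<^sub>R u \<in> K}" by simp
    then have "- (- s) \<in> uminus ` {s. x + s *\<^sub>R u \<in> K}" by (rule imageI)
    then show "s \<in> uminus ` {s. x + s *\<^sub>R u \<in> K}" by simp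
  qed auto
  then show ?thesis unfolding lower_graph_def upper_graph_def Inf_real_def by simp
qed

context
  fixes u :: "real^'n" assumes u: "norm u = 1"
begin

lemma shadow_perp: "x \<in> shadow u \<Longrightarrow> x \<bullet> u = 0"
  by (auto simp: shadow_def inner_perp_part[OF u])

lemma shadow_int_sub: "shadow_int u \<subseteq> shadow u"
  using interior_subset by (auto simp: shadow_def shadow_int_def)

lemma fibre_compact: "compact {s. x + s *\<^sub>R u \<in> K}"
proof -
  have "{s. x + s *\<^sub>R u \<in> K} = (\<lambda>s. x + s *\<^sub>R u) -` K" by auto
  moreover have "closed ((\<lambda>s. x + s *\<^sub>R u) -` K)"
    by (intro continuous_closed_vimage K_closed) (intro continuous_intros)
  moreover have "bounded {s. x + s *\<^sub>R u \<in> K}"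
  proof -
    obtain b where b: "\<And>v. v \<in> K \<Longrightarrow> norm v \<le> b"
      using compact_imp_bounded[OF K_compact] by (auto simp: bounded_iff)
    have "\<bar>s\<bar> \<le> b + norm x" if "x + s *\<^sub>R u \<in> K" for s
    proof -
      have "norm (s *\<^sub>R u) \<le> norm (x + s *\<^sub>R u) + norm x"
        using norm_triangle_ineq4[of "x + s *\<^sub>R u" x] by simp
      then show ?thesis using b[OF that] unfolding norm_scaleR u by simp
    qed
    then show ?thesis unfolding bounded_iff by (auto intro!: exI[of _ "b + norm x"])
  qed
  ultimately show ?thesis by (simp add: compact_eq_bounded_closed)
qed

lemma fibre_nonempty: "x \<in> shadow u \<Longrightarrow> {s. x + s *\<^sub>R u \<in> K} \<noteq> {}"
proof -
  assume "x \<in> shadow u"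
  then obtain k where "k \<in> K" "x = perp_part u k" by (auto simp: shadow_def)
  then have "x + (k \<bullet> u) *\<^sub>R u \<in> K" by (simp add: perp_part_decomp)
  then show ?thesis by blast
qed

lemma top_mem: "x \<in> shadow u \<Longrightarrow> x + top_f u x *\<^sub>R u \<in> K"
proof -
  assume "x \<in> shadow u"
  then have "Sup {s. x + s *\<^sub>R u \<in> K} \<in> {s. x + s *\<^sub>R u \<in> K}"
    by (intro closed_contains_Sup fibre_nonempty bounded_imp_bdd_above compact_imp_bounded
        compact_imp_closed fibre_compact)
  then show ?thesis by (simp add: upper_graph_def)
qed

lemma top_ge: "x + s *\<^sub>R u \<in> K \<Longrightarrow> s \<le> top_f u x"
  unfolding upper_graph_def
  by (rule cSup_upper) (use bounded_imp_bdd_above[OF compact_imp_bounded[OF fibre_compact]] in auto)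

lemma mem_shadow_int: "x \<bullet> u = 0 \<Longrightarrow> x + s *\<^sub>R u \<in> interior K \<Longrightarrow> x \<in> shadow_int u"
  unfolding shadow_int_def by (metis image_eqI perp_part_add_dir[OF u] perp_part_eq)

lemma shadow_int_obtain:
  assumes "x \<in> shadow_int u" obtains s where "x + s *\<^sub>R u \<in> interior K"
proof -
  obtain k where "k \<in> interior K" "x = perp_part u k" using assms by (auto simp: shadow_int_def)
  then have "x + (k \<bullet> u) *\<^sub>R u \<in> interior K" by (simp add: perp_part_decomp)
  then show thesis by (rule that)
qed

lemma shadow_int_open: "\<exists>C. open C \<and> shadow_int u = C \<inter> {x. x \<bullet> u = 0}"
proof (intro exI conjI)
  define C where "C = (\<Union>s. (\<lambda>x. x + s *\<^sub>R u) -` interior K)"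
  show "open C" unfolding C_def
    by (intro open_UN ballI continuous_open_vimage open_interior) (intro continuous_intros)
  show "shadow_int u = C \<inter> {x. x \<bullet> u = 0}"
  proof (intro set_eqI iffI)
    fix x assume x: "x \<in> shadow_int u"
    then obtain s where "x + s *\<^sub>R u \<in> interior K" by (rule shadow_int_obtain)
    then show "x \<in> C \<inter> {x. x \<bullet> u = 0}" using shadow_perp shadow_int_sub x by (auto simp: C_def)
  next
    fix x assume "x \<in> C \<inter> {x. x \<bullet> u = 0}"
    then show "x \<in> shadow_int u" using mem_shadow_int by (auto simp: C_def)
  qed
qed

lemma interior_lt_top:
  assumes "x + s *\<^sub>R u \<in> interior K" shows "s < top_f u x"
proof -
  obtain e where e: "e > 0" "ball (x + s *\<^sub>R u) e \<subseteq> K" using assms by (auto simp: mem_interior)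
  have "(x + s *\<^sub>R u) + (e/2) *\<^sub>R u \<in> ball (x + s *\<^sub>R u) e" using e(1) by (simp add: dist_norm u)
  then have "x + (s + e/2) *\<^sub>R u \<in> K" using e(2) by (simp add: scaleR_add_left add.assoc subset_iff)
  then show ?thesis using top_ge[of x "s + e/2"] e(1) by linarith
qed

lemma top_frontier:
  assumes x: "x \<in> shadow_int u" shows "graph_map u (top_f u) x \<in> frontier K"
proof -
  have "graph_map u (top_f u) x \<in> K" using top_mem shadow_int_sub x by (auto simp: graph_map_def)
  moreover have "graph_map u (top_f u) x \<notin> interior K"
    using interior_lt_top[of x "top_f u x"] by (auto simp: graph_map_def)
  ultimately show ?thesis using closure_subset unfolding frontier_def by blast
qed

lemma top_normal_pos:
  assumes x: "x \<in> shadow_int u" shows "0 < gauss_map K (graph_map u (top_f u) x) \<bullet> u"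
proof -
  let ?\<nu> = "gauss_map K (graph_map u (top_f u) x)"
  have n: "outer_unit_normal K (graph_map u (top_f u) x) ?\<nu>"
    using top_frontier[OF x] smooth by (intro gauss_map_normal) blast
  obtain s where s: "x + s *\<^sub>R u \<in> interior K" using shadow_int_obtain[OF x] .
  have "(x + s *\<^sub>R u) \<bullet> ?\<nu> < (x + top_f u x *\<^sub>R u) \<bullet> ?\<nu>"
    using outer_unit_normal_interior[OF n s] by (simp add: graph_map_def)
  then have "0 < (top_f u x - s) * (u \<bullet> ?\<nu>)" by (simp add: inner_add_left left_diff_distrib)
  then show ?thesis using interior_lt_top[OF s] by (simp add: zero_less_mult_iff inner_commute)
qed

lemma top_grad_perp: "x \<in> shadow_int u \<Longrightarrow> top_grad u x \<bullet> u = 0"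
  by (simp add: top_grad_def Let_def inner_perp_part[OF u])

lemma top_supergradient:
  assumes x: "x \<in> shadow_int u" and z: "z \<in> shadow u"
  shows "top_f u z \<le> top_f u x + top_grad u x \<bullet> (z - x)"
proof -
  let ?\<nu> = "gauss_map K (graph_map u (top_f u) x)"
  have n: "outer_unit_normal K (graph_map u (top_f u) x) ?\<nu>"
    using top_frontier[OF x] smooth by (intro gauss_map_normal) blast
  have pos: "0 < ?\<nu> \<bullet> u" by (rule top_normal_pos[OF x])
  have xz: "x \<bullet> u = 0" "z \<bullet> u = 0" using shadow_perp shadow_int_sub x z by auto
  have "(z + top_f u z *\<^sub>R u) \<bullet> ?\<nu> \<le> (x + top_f u x *\<^sub>R u) \<bullet> ?\<nu>"
    using n top_mem[OF z] by (simp add: outer_unit_normal_def graph_map_def)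
  then have 1: "(?\<nu> \<bullet> u) * (top_f u z - top_f u x) \<le> - (?\<nu> \<bullet> (z - x))"
    by (simp add: inner_add_left inner_commute inner_diff_right algebra_simps)
  have "perp_part u ?\<nu> \<bullet> (z - x) = ?\<nu> \<bullet> (z - x)"
    using xz by (simp add: perp_part_def inner_diff_left inner_diff_right inner_commute)
  then have "(?\<nu> \<bullet> u) * (top_grad u x \<bullet> (z - x)) = - (?\<nu> \<bullet> (z - x))"
    using pos by (simp add: top_grad_def Let_def)
  with 1 have "(?\<nu> \<bullet> u) * (top_f u z - top_f u x) \<le> (?\<nu> \<bullet> u) * (top_grad u x \<bullet> (z - x))" by simp
  then show ?thesis using pos by simp
qed

lemma top_cont: "continuous_on (shadow_int u) (top_f u)"
proof -
  \<comment> \<open>Extended constantly along \<open>u\<close>, the concave function lives on an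
    open convex set of the whole space, where concave functions are continuous.\<close>
  define C where "C = perp_part u -` shadow_int u"
  obtain C' where C': "open C'" "shadow_int u = C' \<inter> {x. x \<bullet> u = 0}" using shadow_int_open by blast
  have "C = perp_part u -` C'" using C' inner_perp_part[OF u] by (auto simp: C_def)
  then have oC: "open C"
    using C'(1) continuous_on_perp_part[OF continuous_on_id, of UNIV u] by (auto intro: open_vimage)
  have cC: "convex C"
    unfolding C_def shadow_int_def
    by (intro convex_linear_vimage convex_linear_image linear_perp_part convex_interior K_convex)
  have "convex_on C (\<lambda>x. - top_f u (perp_part u x))"
  proof (rule convex_onI)
    fix t x y assume t: "0 < t" "t < (1::real)" and xy: "x \<in> C" "y \<in> C"
    let ?x = "perp_part u x" and ?y = "perp_part u y"
    have "?x \<in> shadow u" "?y \<in> shadow u" using xy shadow_int_sub by (auto simp: C_def)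
    then have "(1 - t) *\<^sub>R (?x + top_f u ?x *\<^sub>R u) + t *\<^sub>R (?y + top_f u ?y *\<^sub>R u) \<in> K"
      using t by (intro convexD[OF K_convex] top_mem) auto
    also have "(1 - t) *\<^sub>R (?x + top_f u ?x *\<^sub>R u) + t *\<^sub>R (?y + top_f u ?y *\<^sub>R u)
      = perp_part u ((1 - t) *\<^sub>R x + t *\<^sub>R y) + ((1 - t) * top_f u ?x + t * top_f u ?y) *\<^sub>R u"
      unfolding perp_part_add perp_part_scale by (simp add: algebra_simps)
    finally have "(1 - t) * top_f u ?x + t * top_f u ?y \<le> top_f u (perp_part u ((1 - t) *\<^sub>R x + t *\<^sub>R y))"
      by (rule top_ge)
    then show "- top_f u (perp_part u ((1 - t) *\<^sub>R x + t *\<^sub>R y)) \<le> (1 - t) * - top_f u ?x + t * - top_f u ?y"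
      by simp
  qed (rule cC)
  then have "continuous_on C (\<lambda>x. - top_f u (perp_part u x))" by (rule convex_on_continuous[OF oC])
  moreover have PC: "perp_part u x = x" if "x \<in> shadow_int u" for x
    using that shadow_perp shadow_int_sub by (intro perp_part_eq) auto
  then have "shadow_int u \<subseteq> C" by (auto simp: C_def)
  ultimately have "continuous_on (shadow_int u) (\<lambda>x. - top_f u (perp_part u x))" by (rule continuous_on_subset)
  then have "continuous_on (shadow_int u) (\<lambda>x. - (- top_f u (perp_part u x)))" by (rule continuous_on_minus)
  then show ?thesis by (rule continuous_on_eq) (simp add: PC)
qed

lemma top_grad_cont: "continuous_on (shadow_int u) (top_grad u)"
proof -
  have g: "continuous_on (shadow_int u) (\<lambda>x. gauss_map K (graph_map u (top_f u) x))"
  proof (rule continuous_on_compose2[OF continuous_on_gauss_map[OF K_compact]])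
    show "continuous_on (shadow_int u) (graph_map u (top_f u))"
      unfolding graph_map_def[abs_def] by (intro continuous_intros top_cont)
    show "graph_map u (top_f u) ` shadow_int u \<subseteq> regular_boundary K" using top_frontier smooth by blast
  qed
  show ?thesis
    unfolding top_grad_def[abs_def] Let_def
    by (intro continuous_intros g) (use top_normal_pos in force)
qed

end

end

section \<open>The perspective of a power function\<close>

text \<open>The strict Bernoulli inequality, from the mean value theorem on the interval between 1
  and \<open>y\<close>. The case \<open>y = 0\<close> is separate because the derivative is used at
  positive arguments only.\<close>

lemma powr_gt_tangent_at_one:
  fixes y p :: real
  assumes p: "1 < p" and y: "0 \<le> y" "y \<noteq> 1"
  shows "1 + p * (y - 1) < y powr p"
proof (cases "y = 0")
  case False
  then have y0: "0 < y" using y by simp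
  have d: "((\<lambda>x. x powr p) has_real_derivative p * x powr (p - 1)) (at x)" if "0 < x" for x :: real
    by (rule has_real_derivative_powr[OF that])
  show ?thesis
  proof (cases "1 < y")
    case True
    obtain z where z: "1 < z" "z < y" "y powr p - 1 powr p = (y - 1) * (p * z powr (p - 1))"
      using MVT2[OF True, of "\<lambda>x. x powr p" "\<lambda>x. p * x powr (p - 1)"] d by force
    have "1 < z powr (p - 1)" using powr_less_mono2[of "p - 1" 1 z] z(1) p by simp
    then have "(y - 1) * (p * 1) < (y - 1) * (p * z powr (p - 1))"
      using True p by (intro mult_strict_left_mono) auto
    then show ?thesis using z(3) by (simp add: mult.commute)
  next
    case False
    then have y1: "y < 1" using y by simp
    obtain z where z: "y < z" "z < 1" "1 powr p - y powr p = (1 - y) * (p * z powr (p - 1))"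
      using MVT2[OF y1, of "\<lambda>x. x powr p" "\<lambda>x. p * x powr (p - 1)"] d y0 by force
    have "z powr (p - 1) < 1" using z y0 p powr_less_mono2[of "p - 1" z 1] by simp
    then have "(1 - y) * (p * z powr (p - 1)) < (1 - y) * (p * 1)"
      using y1 p by (intro mult_strict_left_mono) auto
    then show ?thesis using z(3) by (simp add: algebra_simps)
  qed
qed (use p in simp)

text \<open>The perspective \<open>|a|\<^sup>p b\<^sup>1\<^sup>-\<^sup>p\<close> is the supremum over \<open>c \<ge> 0\<close> of these linear minorants,
  and the supremum is attained only at \<open>c = |a| / b\<close>.\<close>

definition perspective_minorant :: "real \<Rightarrow> real \<Rightarrow> real \<Rightarrow> real \<Rightarrow> real" where
  "perspective_minorant p c a b = p * c powr (p - 1) * \<bar>a\<bar> - (p - 1) * c powr p * b"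

text \<open>After division by \<open>b\<close>, the minorant is the tangent at \<open>c\<close> to
  the strictly convex function \<open>x powr p\<close>, evaluated at
  \<open>x = \<bar>a\<bar> / b\<close>.\<close>

lemma perspective_minorant_less:
  fixes a b c p :: real
  assumes p: "1 < p" and b: "0 < b" and c: "0 \<le> c" "c \<noteq> \<bar>a\<bar> / b"
  shows "perspective_minorant p c a b < \<bar>a\<bar> powr p * b powr (1 - p)"
proof -
  define x where "x = \<bar>a\<bar> / b"
  have x: "0 \<le> x" "\<bar>a\<bar> = x * b" using b by (auto simp: x_def)
  have "(x * b) powr p * b powr (1 - p) = x powr p * (b powr p * b powr (1 - p))"
    using x b by (simp add: powr_mult)
  also have "b powr p * b powr (1 - p) = b" using b by (simp add: powr_add[symmetric])
  finally have eq: "\<bar>a\<bar> powr p * b powr (1 - p) = x powr p * b" using x by simp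
  have cx: "c \<noteq> x" using c(2) unfolding x_def .
  have "p * c powr (p - 1) * x - (p - 1) * c powr p < x powr p"
  proof (cases "c = 0")
    case True
    then have "0 < x" using cx x(1) by simp
    then show ?thesis using True p by simp
  next
    case False
    then have c0: "0 < c" using c by simp
    have "1 + p * (x / c - 1) < (x / c) powr p"
      using c0 x(1) cx p by (intro powr_gt_tangent_at_one) auto
    then have "(1 + p * (x / c - 1)) * c powr p < (x / c) powr p * c powr p"
      using c0 by (intro mult_strict_right_mono) auto
    moreover have "(x / c) powr p * c powr p = x powr p" using c0 x by (simp add: powr_divide)
    moreover have "(1 + p * (x / c - 1)) * c powr p = p * c powr (p - 1) * x - (p - 1) * c powr p"
    proof -
      define k where "k = c powr (p - 1)"
      have k: "c powr p = k * c" using c0 powr_mult_base[of c "p - 1"] by (simp add: k_def mult.commute)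
      have "(1 + p * (x / c - 1)) * (k * c) = p * k * x - (p - 1) * (k * c)" using c0 by (simp add: field_simps)
      then show ?thesis unfolding k k_def[symmetric] .
    qed
    ultimately show ?thesis by simp
  qed
  then have "(p * c powr (p - 1) * x - (p - 1) * c powr p) * b < x powr p * b"
    using b by (rule mult_strict_right_mono)
  then show ?thesis
    unfolding eq unfolding perspective_minorant_def x(2) by (simp add: algebra_simps)
qed

lemma perspective_minorant_eq:
  fixes a b p :: real
  assumes p: "1 < p" and b: "0 < b"
  shows "perspective_minorant p (\<bar>a\<bar> / b) a b = \<bar>a\<bar> powr p * b powr (1 - p)"
proof -
  define x where "x = \<bar>a\<bar> / b"
  have x: "0 \<le> x" "\<bar>a\<bar> = x * b" using b by (auto simp: x_def)
  have "(x * b) powr p * b powr (1 - p) = x powr p * (b powr p * b powr (1 - p))"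
    using x b by (simp add: powr_mult)
  also have "b powr p * b powr (1 - p) = b" using b by (simp add: powr_add[symmetric])
  finally have eq: "\<bar>a\<bar> powr p * b powr (1 - p) = x powr p * b" using x by simp
  have "x powr (p - 1) * x = x powr p"
    using powr_mult_base[of x "p - 1"] x(1) by (simp add: mult.commute)
  then have "p * x powr (p - 1) * (x * b) - (p - 1) * x powr p * b = x powr p * b"
    by (simp add: algebra_simps)
  then show ?thesis unfolding eq perspective_minorant_def x_def[symmetric] using x(2) by simp
qed

lemma perspective_minorant_le:
  fixes a b c p :: real
  assumes "1 < p" "0 < b" "0 \<le> c"
  shows "perspective_minorant p c a b \<le> \<bar>a\<bar> powr p * b powr (1 - p)"
  using perspective_minorant_less[OF assms, of a] perspective_minorant_eq[OF assms(1,2), of a]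
  by (cases "c = \<bar>a\<bar> / b") (simp_all add: less_imp_le)

lemma perspective_minorant_combine:
  fixes p :: real
  assumes p: "1 < p" and c: "0 \<le> c" and l: "0 \<le> l" "l \<le> 1"
  shows "perspective_minorant p c ((1 - l) * a + l * a') ((1 - l) * b + l * b')
    \<le> (1 - l) * perspective_minorant p c a b + l * perspective_minorant p c a' b'"
proof -
  have "\<bar>(1 - l) * a + l * a'\<bar> \<le> (1 - l) * \<bar>a\<bar> + l * \<bar>a'\<bar>"
    using abs_triangle_ineq[of "(1 - l) * a" "l * a'"] l by (simp add: abs_mult)
  then have "p * c powr (p - 1) * \<bar>(1 - l) * a + l * a'\<bar> \<le> p * c powr (p - 1) * ((1 - l) * \<bar>a\<bar> + l * \<bar>a'\<bar>)"
    using p by (intro mult_left_mono) auto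
  then show ?thesis unfolding perspective_minorant_def by (simp add: algebra_simps)
qed

text \<open>The minorant whose parameter is optimal for the combined point touches the perspective
  there, lies below it at the two given points, and is itself convex.\<close>

lemma perspective_convex:
  fixes p :: real
  assumes p: "1 < p" and b: "0 < b" "0 < b'" and l: "0 \<le> l" "l \<le> 1"
  shows "\<bar>(1 - l) * a + l * a'\<bar> powr p * ((1 - l) * b + l * b') powr (1 - p)
    \<le> (1 - l) * (\<bar>a\<bar> powr p * b powr (1 - p)) + l * (\<bar>a'\<bar> powr p * b' powr (1 - p))"
proof -
  let ?a = "(1 - l) * a + l * a'" and ?b = "(1 - l) * b + l * b'"
  have b0: "0 < ?b"
    using b l by (cases "l = 0") (auto intro!: add_nonneg_pos mult_nonneg_nonneg)
  let ?c = "\<bar>?a\<bar> / ?b"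
  have c0: "0 \<le> ?c" using b0 by simp
  have "\<bar>?a\<bar> powr p * ?b powr (1 - p) = perspective_minorant p ?c ?a ?b"
    by (rule perspective_minorant_eq[OF p b0, symmetric])
  also have "\<dots> \<le> (1 - l) * perspective_minorant p ?c a b + l * perspective_minorant p ?c a' b'"
    by (rule perspective_minorant_combine[OF p c0 l])
  also have "\<dots> \<le> (1 - l) * (\<bar>a\<bar> powr p * b powr (1 - p)) + l * (\<bar>a'\<bar> powr p * b' powr (1 - p))"
    using l by (intro add_mono mult_left_mono perspective_minorant_le p b c0) auto
  finally show ?thesis .
qed

lemma perspective_strict:
  fixes p :: real
  assumes p: "1 < p" and b: "0 < b" and a: "a \<noteq> a'"
  shows "\<bar>(a + a') / 2\<bar> powr p * b powr (1 - p)
    < (\<bar>a\<bar> powr p * b powr (1 - p) + \<bar>a'\<bar> powr p * b powr (1 - p)) / 2"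
proof -
  let ?a = "(a + a') / 2"
  let ?c = "\<bar>?a\<bar> / b"
  have c0: "0 \<le> ?c" using b by simp
  have "perspective_minorant p ?c ((1 - 1/2) * a + (1/2) * a') ((1 - 1/2) * b + (1/2) * b)
    \<le> (1 - 1/2) * perspective_minorant p ?c a b + (1/2) * perspective_minorant p ?c a' b"
    by (rule perspective_minorant_combine[OF p c0]) auto
  moreover have "(1 - 1/2) * a + (1/2) * a' = ?a" "(1 - 1/2) * b + (1/2) * b = b" by (simp_all add: field_simps)
  ultimately have 1: "perspective_minorant p ?c ?a b
      \<le> (perspective_minorant p ?c a b + perspective_minorant p ?c a' b) / 2"
    by (simp only:) (simp add: field_simps)
  \<comment> \<open>The parameter is optimal at both ends only if \<open>\<bar>a\<bar>\<close>,
    \<open>\<bar>a'\<bar>\<close> and the modulus of their mean coincide, which forces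
    \<open>a = a'\<close>.\<close>
  have "?c \<noteq> \<bar>a\<bar> / b \<or> ?c \<noteq> \<bar>a'\<bar> / b" using a b by (auto simp: abs_if field_simps split: if_splits)
  then have "perspective_minorant p ?c a b + perspective_minorant p ?c a' b
      < \<bar>a\<bar> powr p * b powr (1 - p) + \<bar>a'\<bar> powr p * b powr (1 - p)"
    using perspective_minorant_less[OF p b c0, of a] perspective_minorant_le[OF p b c0, of a]
      perspective_minorant_less[OF p b c0, of a'] perspective_minorant_le[OF p b c0, of a']
    by linarith
  then have 2: "(perspective_minorant p ?c a b + perspective_minorant p ?c a' b) / 2
      < (\<bar>a\<bar> powr p * b powr (1 - p) + \<bar>a'\<bar> powr p * b powr (1 - p)) / 2"
    by (rule divide_strict_right_mono) simp
  show ?thesis using le_less_trans[OF 1 2] unfolding perspective_minorant_eq[OF p b] .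
qed

section \<open>The polar projection body as a sublevel set\<close>

lemma support_fun_upper:
  assumes "bounded L" "x \<in> L" shows "x \<bullet> v \<le> support_fun L v"
proof -
  obtain B where B: "\<And>y. y \<in> L \<Longrightarrow> norm y \<le> B" using assms(1) by (auto simp: bounded_iff)
  have "y \<bullet> v \<le> B * norm v" if "y \<in> L" for y
    using Cauchy_Schwarz_ineq2[of y v] mult_right_mono[OF B[OF that], of "norm v"] by simp
  then have "bdd_above ((\<lambda>y. y \<bullet> v) ` L)" by (auto intro!: bdd_aboveI)
  then show ?thesis unfolding support_fun_def using assms(2) by (intro cSUP_upper)
qed

lemma convex_body_eq_halfspaces:
  assumes L: "convex_body L" shows "L = {x. \<forall>v. x \<bullet> v \<le> support_fun L v}"
proof
  have b: "bounded L" and c: "closed L" "convex L" and ne: "L \<noteq> {}"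
    using L compact_imp_bounded compact_imp_closed interior_subset by (auto simp: convex_body_def)
  show "L \<subseteq> {x. \<forall>v. x \<bullet> v \<le> support_fun L v}" using support_fun_upper[OF b] by auto
  show "{x. \<forall>v. x \<bullet> v \<le> support_fun L v} \<subseteq> L"
  proof
    fix x assume x: "x \<in> {x. \<forall>v. x \<bullet> v \<le> support_fun L v}"
    show "x \<in> L"
    proof (rule ccontr)
      assume "x \<notin> L"
      then obtain a e where a: "a \<bullet> x < e" "\<forall>y\<in>L. e < a \<bullet> y"
        using separating_hyperplane_closed_point[OF c(2,1)] by metis
      have "support_fun L (- a) \<le> - e"
        unfolding support_fun_def using ne a(2) by (intro cSUP_least) (auto simp: inner_commute less_imp_le)
      moreover have "x \<bullet> (- a) \<le> support_fun L (- a)" using x by blast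
      ultimately show False using a(1) by (simp add: inner_commute)
    qed
  qed
qed

text \<open>\<open>lp_projection_body\<close> is a definite description, so a body with the required
  support function must be exhibited: it is the intersection \<open>L\<close> of the half-spaces
  given by \<open>h\<close>. That \<open>h\<close> is attained as the support function of
  \<open>L\<close> follows from supporting hyperplanes of the sublevel set \<open>C\<close>, for
  which convexity of \<open>w\<close> suffices.\<close>

lemma polar_lp_projection_body_eq:
  fixes M :: "'a::euclidean_space set" and w :: "'a \<Rightarrow> real"
  assumes p: "1 < p"
    and supp: "\<And>v. lp_projection_support p M v = w v powr (1 / p)"
    and w_pos: "\<And>v. v \<noteq> 0 \<Longrightarrow> 0 < w v"
    and w_scale: "\<And>c v. w (c *\<^sub>R v) = \<bar>c\<bar> powr p * w v"
    and w_convex: "convex_on UNIV w"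
  shows "polar_body (lp_projection_body p M) = {v. w v \<le> 1}"
proof -
  have w0: "w 0 = 0" using w_scale[of 0 0] p by simp
  have wn: "0 \<le> w v" for v using w_pos[of v] w0 by (cases "v = 0") auto
  have wc: "continuous_on X w" for X
    using convex_on_continuous[OF open_UNIV w_convex] continuous_on_subset by blast
  define h where "h v = w v powr (1 / p)" for v
  have h0: "h 0 = 0" using w0 p by (simp add: h_def)
  have hpos: "0 < h v" if "v \<noteq> 0" for v using w_pos[OF that] by (simp add: h_def)
  have hn: "0 \<le> h v" for v by (simp add: h_def)
  have hs: "h (c *\<^sub>R v) = \<bar>c\<bar> * h v" for c v
    using p wn[of v] by (simp add: h_def w_scale powr_mult powr_powr)
  have h1: "h v \<le> 1 \<longleftrightarrow> w v \<le> 1" for v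
  proof
    assume "h v \<le> 1"
    then have "h v powr p \<le> 1" using hn[of v] p by (simp add: powr_le1)
    then show "w v \<le> 1" using wn[of v] p by (simp add: h_def powr_powr)
  next
    assume "w v \<le> 1" then show "h v \<le> 1" using wn[of v] p by (simp add: h_def powr_le1)
  qed
  have hc: "continuous_on X h" for X
    unfolding h_def[abs_def] using p wn by (intro continuous_on_powr' wc continuous_on_const) auto
  obtain e :: 'a where e: "e \<in> Basis" using nonempty_Basis by blast
  then have "e \<in> sphere 0 1" by simp
  then have ne: "sphere (0::'a) 1 \<noteq> {}" by blast
  obtain z where z: "z \<in> sphere 0 1" "\<And>v. v \<in> sphere 0 1 \<Longrightarrow> h z \<le> h v"
    using continuous_attains_inf[OF compact_sphere ne hc] by metis
  obtain z' where z': "\<And>v. v \<in> sphere 0 1 \<Longrightarrow> h v \<le> h z'"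
    using continuous_attains_sup[OF compact_sphere ne hc] by metis
  have hz: "0 < h z" using z(1) by (intro hpos) auto
  have lower: "h z * norm v \<le> h v" and upper: "h v \<le> h z' * norm v" for v
  proof -
    show "h z * norm v \<le> h v"
    proof (cases "v = 0")
      case False
      then have "h z \<le> h ((1 / norm v) *\<^sub>R v)" by (intro z(2)) simp
      then show ?thesis using False unfolding hs by (simp add: field_simps)
    qed (simp add: h0)
    show "h v \<le> h z' * norm v"
    proof (cases "v = 0")
      case False
      then have "h ((1 / norm v) *\<^sub>R v) \<le> h z'" by (intro z') simp
      then show ?thesis using False unfolding hs by (simp add: field_simps)
    qed (simp add: h0)
  qed
  define L where "L = {x. \<forall>v. x \<bullet> v \<le> h v}"
  have L_eq: "L = (\<Inter>v. {x. x \<bullet> v \<le> h v})" by (auto simp: L_def)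
  have "closed L" unfolding L_eq by (intro closed_INT ballI closed_Collect_le continuous_intros)
  moreover have "norm x \<le> h z'" if "x \<in> L" for x
  proof (cases "x = 0")
    case False
    have "x \<bullet> x \<le> h z' * norm x" using that upper[of x] by (auto simp: L_def intro: order_trans)
    then have "norm x * norm x \<le> h z' * norm x" by (simp add: dot_square_norm power2_eq_square)
    then show ?thesis using False by simp
  qed (simp add: hn)
  ultimately have Lc: "compact L" by (auto simp: compact_eq_bounded_closed bounded_iff)
  have Lconv: "convex L"
    unfolding L_eq
  proof (rule convex_INT)
    show "convex {x. x \<bullet> v \<le> h v}" for v using convex_halfspace_le[of v "h v"] by (simp add: inner_commute)
  qed
  have "ball 0 (h z) \<subseteq> L"
  proof
    fix x :: 'a assume "x \<in> ball 0 (h z)"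
    then have "x \<bullet> v \<le> h z * norm v" for v
      using Cauchy_Schwarz_ineq2[of x v] mult_right_mono[of "norm x" "h z" "norm v"] by simp
    then show "x \<in> L" using lower order_trans by (fastforce simp: L_def)
  qed
  then have "0 \<in> interior L" using hz by (auto simp: mem_interior)
  then have Lb: "convex_body L" using Lc Lconv by (auto simp: convex_body_def)
  have L0: "0 \<in> L" by (simp add: L_def hn)
  then have Lne: "L \<noteq> {}" by blast
  define C where "C = {v. w v \<le> 1}"
  have Cconv: "convex C"
  proof (rule convexI)
    fix x y and a b :: real assume *: "x \<in> C" "y \<in> C" "0 \<le> a" "0 \<le> b" "a + b = 1"
    have "w (a *\<^sub>R x + b *\<^sub>R y) \<le> max (w x) (w y)"
      by (rule convex_lower[OF w_convex UNIV_I UNIV_I *(3-5)])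
    then show "a *\<^sub>R x + b *\<^sub>R y \<in> C" using *(1,2) by (simp add: C_def)
  qed
  have C0: "0 \<in> interior C"
  proof (rule interiorI)
    show "open {v. w v < 1}" by (intro open_Collect_less wc continuous_on_const)
  qed (use w0 in \<open>auto simp: C_def\<close>)
  have Ls: "support_fun L v = h v" for v
  proof (rule antisym)
    show "support_fun L v \<le> h v"
      unfolding support_fun_def by (intro cSUP_least Lne) (simp add: L_def)
    show "h v \<le> support_fun L v"
    proof (cases "v = 0")
      case True
      then show ?thesis using support_fun_upper[OF compact_imp_bounded[OF Lc] L0, of v] by (simp add: h0)
    next
      case False
      have hv: "0 < h v" by (rule hpos[OF False])
      define y where "y = (1 / h v) *\<^sub>R v"
      have hy: "h y = 1" using hv by (simp add: y_def hs)
      have yC: "y \<in> C" using hy h1[of y] by (simp add: C_def)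
      have "y \<notin> interior C"
      proof
        assume "y \<in> interior C"
        then obtain r where r: "0 < r" "ball y r \<subseteq> C" by (auto simp: mem_interior)
        have "y \<noteq> 0" using hy h0 by auto
        define c where "c = r / (2 * norm y)"
        have c: "0 < c" using r(1) \<open>y \<noteq> 0\<close> by (simp add: c_def)
        have "c * norm y = r / 2" using \<open>y \<noteq> 0\<close> by (simp add: c_def)
        then have "y + c *\<^sub>R y \<in> ball y r" using r(1) c by (simp add: dist_norm)
        then have "w (y + c *\<^sub>R y) \<le> 1" using r(2) by (auto simp: C_def)
        then have "h ((1 + c) *\<^sub>R y) \<le> 1" by (simp add: h1 scaleR_add_left)
        then show False using c by (simp add: hs hy)
      qed
      then obtain \<theta> where \<theta>: "outer_unit_normal C y \<theta>"
        using outer_unit_normal_exists[OF Cconv _ yC] C0 by blast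
      have m: "0 < y \<bullet> \<theta>" using outer_unit_normal_interior[OF \<theta> C0] by simp
      \<comment> \<open>The normal of \<open>C\<close> at \<open>y\<close>, scaled to have product 1
        with \<open>y\<close>, is a point of \<open>L\<close> at which the support in direction
        \<open>v\<close> is attained.\<close>
      define x where "x = (1 / (y \<bullet> \<theta>)) *\<^sub>R \<theta>"
      have "x \<bullet> v' \<le> h v'" for v'
      proof (cases "v' = 0")
        case False
        have hv': "0 < h v'" by (rule hpos[OF False])
        have "h ((1 / h v') *\<^sub>R v') = 1" using hv' by (simp add: hs)
        then have "h ((1 / h v') *\<^sub>R v') \<le> 1" by simp
        then have "(1 / h v') *\<^sub>R v' \<in> C" unfolding h1 C_def by simp
        then have "((1 / h v') *\<^sub>R v') \<bullet> \<theta> \<le> y \<bullet> \<theta>"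
          using \<theta>[unfolded outer_unit_normal_def] by blast
        then have "v' \<bullet> \<theta> \<le> h v' * (y \<bullet> \<theta>)" using hv' by (simp add: field_simps)
        then show ?thesis using m by (simp add: x_def field_simps inner_commute)
      qed (simp add: h0)
      then have "x \<in> L" by (simp add: L_def)
      have "v = h v *\<^sub>R y" using hv by (simp add: y_def)
      then have "x \<bullet> v = h v * (x \<bullet> y)" by (metis inner_scaleR_right)
      also have "x \<bullet> y = 1" using m by (simp add: x_def inner_commute)
      finally have "x \<bullet> v = h v" by simp
      then show ?thesis using support_fun_upper[OF compact_imp_bounded[OF Lc] \<open>x \<in> L\<close>, of v] by simp
    qed
  qed
  have "lp_projection_body p M = L"
    unfolding lp_projection_body_def
  proof (rule the_equality)
    show "convex_body L \<and> (\<forall>v. support_fun L v = lp_projection_support p M v)"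
      using Lb Ls supp by (simp add: h_def)
    fix L' assume L': "convex_body L' \<and> (\<forall>v. support_fun L' v = lp_projection_support p M v)"
    then have "L' = {x. \<forall>v. x \<bullet> v \<le> support_fun L' v}" by (intro convex_body_eq_halfspaces) simp
    also have "\<dots> = L" using L' supp by (simp add: L_def h_def)
    finally show "L' = L" .
  qed
  moreover have "polar_body L = C"
  proof (intro set_eqI iffI)
    fix v assume "v \<in> polar_body L"
    then have "support_fun L v \<le> 1"
      unfolding support_fun_def by (intro cSUP_least Lne) (simp add: polar_body_def)
    then show "v \<in> C" using Ls h1 by (simp add: C_def)
  next
    fix v assume "v \<in> C"
    then have "h v \<le> 1" using h1 by (simp add: C_def)
    moreover have "x \<bullet> v \<le> h v" if "x \<in> L" for x using that by (simp add: L_def)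
    ultimately have "x \<bullet> v \<le> 1" if "x \<in> L" for x using that order_trans by blast
    then show "v \<in> polar_body L" by (simp add: polar_body_def)
  qed
  ultimately show ?thesis by (simp add: C_def)
qed

section \<open>The polar projection body of a body bounded by two graphs\<close>

lemma support_fun_outer_unit_normal:
  assumes "outer_unit_normal M y \<theta>" shows "support_fun M \<theta> = y \<bullet> \<theta>"
  unfolding support_fun_def
  using assms by (intro cSup_eq_maximum) (auto simp: outer_unit_normal_def)

lemma support_fun_measurable:
  fixes M :: "'a::euclidean_space set"
  assumes b: "bounded M" and ne: "M \<noteq> {}"
  shows "support_fun M \<in> borel_measurable borel"
proof -
  obtain B where B: "\<And>y. y \<in> M \<Longrightarrow> norm y \<le> B" using b by (auto simp: bounded_iff)
  have B0: "0 \<le> B" using B ne by (meson all_not_in_conv norm_ge_zero order_trans)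
  have le: "support_fun M v \<le> support_fun M w + B * norm (v - w)" for v w
    unfolding support_fun_def[of M v]
  proof (rule cSUP_least[OF ne])
    fix x assume x: "x \<in> M"
    have "x \<bullet> (v - w) \<le> B * norm (v - w)"
      using Cauchy_Schwarz_ineq2[of x "v - w"] mult_right_mono[OF B[OF x], of "norm (v - w)"] by simp
    then show "x \<bullet> v \<le> support_fun M w + B * norm (v - w)"
      using support_fun_upper[OF b x, of w] by (simp add: inner_diff_right)
  qed
  have "B-lipschitz_on UNIV (support_fun M)"
  proof (rule lipschitz_onI)
    fix v w
    show "dist (support_fun M v) (support_fun M w) \<le> B * dist v w"
      using le[of v w] le[of w v] by (simp add: dist_norm norm_minus_commute abs_le_iff)
  qed (rule B0)
  then show ?thesis by (intro borel_measurable_continuous_onI lipschitz_on_continuous_on)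
qed

locale graph_body0 = graph_body u M K' U F G qF qG
  for u :: "real^'n" and M K' U F G qF qG +
  fixes p :: real
  assumes zero: "0 \<in> interior M" and p: "1 < p"
begin

section \<open>The contribution of the upper graph to the surface integral\<close>

lemma flip0: "graph_body0 (- u) M K' U G F qG qF p"
  using flip zero p by (simp add: graph_body0_def graph_body0_axioms_def)

definition dens :: "real^'n \<Rightarrow> real^'n \<Rightarrow> real" where
  "dens v x = \<bar>v \<bullet> (u - qF x)\<bar> powr p * (F x - x \<bullet> qF x) powr (1 - p)"

definition lp_kernel :: "real^'n \<Rightarrow> real^'n \<Rightarrow> real" where
  "lp_kernel v \<theta> = \<bar>v \<bullet> \<theta>\<bar> powr p * support_fun M \<theta> powr (1 - p)"

lemma graph_inner_normal: "x \<in> U \<Longrightarrow> graph_map u F x \<bullet> (u - qF x) = F x - x \<bullet> qF x"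
proof -
  assume x: "x \<in> U"
  have "x \<bullet> u = 0" "u \<bullet> qF x = 0" using U_perp[OF x] qF_perp[OF x] by (auto simp: inner_commute)
  then show ?thesis unfolding graph_map_def
    by (simp add: inner_add_left inner_diff_right unit_inner_self[OF u])
qed

lemma support_fun_normal:
  assumes x: "x \<in> U"
  shows "support_fun M ((1 / norm (u - qF x)) *\<^sub>R (u - qF x)) = (F x - x \<bullet> qF x) / norm (u - qF x)"
proof -
  have "outer_unit_normal M (graph_map u F x) ((1 / norm (u - qF x)) *\<^sub>R (u - qF x))"
    unfolding outer_unit_normal_graph[OF x] ..
  from support_fun_outer_unit_normal[OF this] show ?thesis
    by (simp add: graph_inner_normal[OF x])
qed

lemma height_pos:
  assumes x: "x \<in> U" shows "0 < F x - x \<bullet> qF x"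
proof -
  have "outer_unit_normal M (graph_map u F x) ((1 / norm (u - qF x)) *\<^sub>R (u - qF x))"
    unfolding outer_unit_normal_graph[OF x] ..
  from outer_unit_normal_interior[OF this zero]
  have "0 < (F x - x \<bullet> qF x) / norm (u - qF x)" by (simp add: graph_inner_normal[OF x])
  then show ?thesis using normal_nz[OF x] by (simp add: zero_less_divide_iff)
qed

lemma dens_nonneg: "0 \<le> dens v x"
  by (simp add: dens_def)

text \<open>The kernel is homogeneous of degree \<open>p + (1 - p) = 1\<close> in the normal, so the
  area factor \<open>norm (u - qF x)\<close> turns the unit normal into
  \<open>u - qF x\<close>.\<close>

lemma dens_eq:
  assumes x: "x \<in> U"
  shows "norm (u - qF x) * lp_kernel v ((1 / norm (u - qF x)) *\<^sub>R (u - qF x)) = dens v x"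
proof -
  let ?N = "norm (u - qF x)" and ?b = "F x - x \<bullet> qF x" and ?a = "\<bar>v \<bullet> (u - qF x)\<bar>"
  have N: "0 < ?N" using normal_nz[OF x] by linarith
  have b: "0 < ?b" by (rule height_pos[OF x])
  have "\<bar>v \<bullet> ((1 / ?N) *\<^sub>R (u - qF x))\<bar> = ?a / ?N" using N by (simp add: abs_mult)
  then have "lp_kernel v ((1 / ?N) *\<^sub>R (u - qF x)) = (?a / ?N) powr p * (?b / ?N) powr (1 - p)"
    unfolding lp_kernel_def support_fun_normal[OF x] by simp
  also have "\<dots> = (?a powr p * ?b powr (1 - p)) / (?N powr p * ?N powr (1 - p))"
    using N b by (simp add: powr_divide)
  also have "?N powr p * ?N powr (1 - p) = ?N" using N by (simp add: powr_add[symmetric])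
  finally show ?thesis using N by (simp add: dens_def)
qed

lemma U_height_cont: "continuous_on U (\<lambda>x. F x - x \<bullet> qF x)"
  by (intro continuous_intros cont_F cont_qF)

lemma dens_measurable: "(\<lambda>x. indicator U x * dens v x) \<in> borel_measurable borel"
proof -
  have "continuous_on U (dens v)"
    unfolding dens_def[abs_def] using p height_pos
    by (intro continuous_on_mult continuous_on_powr' U_height_cont continuous_on_const continuous_on_rabs
        continuous_intros cont_qF) (auto simp: less_imp_le, force)
  from borel_measurable_continuous_on_indicator[OF U_borel this] show ?thesis by simp
qed

lemma lp_kernel_measurable: "lp_kernel v \<in> borel_measurable borel"
proof -
  have [measurable]: "support_fun M \<in> borel_measurable borel"
    using cb by (intro support_fun_measurable) (auto simp: convex_body_def compact_imp_bounded)
  show ?thesis unfolding lp_kernel_def[abs_def] by measurable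
qed

text \<open>A ball of radius \<open>r\<close> about the origin inside \<open>M\<close> keeps the
  support function at least \<open>r\<close> on unit vectors, which bounds its negative power
  \<open>1 - p\<close>.\<close>

lemma lp_kernel_bound:
  obtains B where "0 \<le> B" "\<And>\<theta>. norm \<theta> = 1 \<Longrightarrow> lp_kernel v \<theta> \<le> B"
proof -
  obtain r where r: "0 < r" "cball 0 r \<subseteq> M" using zero by (auto simp: mem_interior_cball)
  have Mb: "bounded M" using cb by (simp add: convex_body_def compact_imp_bounded)
  have "lp_kernel v \<theta> \<le> norm v powr p * r powr (1 - p)" if \<theta>: "norm \<theta> = 1" for \<theta>
  proof -
    have "r *\<^sub>R \<theta> \<in> M" using r \<theta> by (intro subsetD[OF r(2)]) simp
    from support_fun_upper[OF Mb this, of \<theta>] have s: "r \<le> support_fun M \<theta>"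
      using unit_inner_self[OF \<theta>] by simp
    have "\<bar>v \<bullet> \<theta>\<bar> powr p \<le> norm v powr p"
      using Cauchy_Schwarz_ineq2[of v \<theta>] p \<theta> by (intro powr_mono2) auto
    moreover have "support_fun M \<theta> powr (1 - p) \<le> r powr (1 - p)"
      using p by (intro powr_mono2' r s) simp
    ultimately show ?thesis unfolding lp_kernel_def by (intro mult_mono) auto
  qed
  then show thesis by (intro that[of "norm v powr p * r powr (1 - p)"]) auto
qed

lemma nn_integral_norm_normal_finite:
  "(\<integral>\<^sup>+x. indicator U x * (hausdorff_ratio u * ennreal (norm (u - qF x))) \<partial>perp_lborel u) < top"
proof -
  have "(\<integral>\<^sup>+x. indicator U x * (hausdorff_ratio u * ennreal (norm (u - qF x))) \<partial>perp_lborel u)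
      = (\<integral>\<^sup>+y. indicator (graph_map u F ` U) y * 1 \<partial>hausdorff_measure (CARD('n) - 1))"
    by (subst nn_integral_surface_half) auto
  also have "\<dots> = hausdorff_outer (CARD('n) - 1) (graph_map u F ` U)"
    using graph_borel by (simp add: emeasure_hausdorff_measure)
  also have "\<dots> \<le> hausdorff_outer (CARD('n) - 1) (frontier M)"
    using graph_frontier by (intro hausdorff_outer_mono) blast
  also have "\<dots> < top" using hausdorff_outer_frontier_convex_body[OF cb] by simp
  finally show ?thesis .
qed

text \<open>The comparison with the area of the graph is made for the product with
  \<open>hausdorff_ratio u\<close>, since only this product is tied to Hausdorff measure. The factor
  can be cancelled because it is not 0.\<close>

lemma nn_integral_dens_finite:
  assumes \<kappa>: "hausdorff_ratio u \<noteq> 0"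
  shows "(\<integral>\<^sup>+x. ennreal (indicator U x * dens v x) \<partial>perp_lborel u) < top"
proof -
  obtain B where B: "0 \<le> B" "\<And>\<theta>. norm \<theta> = 1 \<Longrightarrow> lp_kernel v \<theta> \<le> B" using lp_kernel_bound by blast
  have [measurable]: "(\<lambda>x. indicator U x *\<^sub>R norm (u - qF x)) \<in> borel_measurable borel"
    by (intro borel_measurable_continuous_on_indicator U_borel continuous_intros cont_qF)
  note [measurable] = dens_measurable[of v]
  have "hausdorff_ratio u * (\<integral>\<^sup>+x. ennreal (indicator U x * dens v x) \<partial>perp_lborel u)
      = (\<integral>\<^sup>+x. hausdorff_ratio u * ennreal (indicator U x * dens v x) \<partial>perp_lborel u)"
    by (rule nn_integral_cmult[symmetric]) measurable
  also have "\<dots> \<le> (\<integral>\<^sup>+x. ennreal B * (hausdorff_ratio u * ennreal (indicator U x *\<^sub>R norm (u - qF x))) \<partial>perp_lborel u)"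
  proof (rule nn_integral_mono)
    fix x
    show "hausdorff_ratio u * ennreal (indicator U x * dens v x)
        \<le> ennreal B * (hausdorff_ratio u * ennreal (indicator U x *\<^sub>R norm (u - qF x)))"
    proof (cases "x \<in> U")
      case True
      have "norm (u - qF x) \<noteq> 0" using normal_nz[OF True] by linarith
      then have "norm ((1 / norm (u - qF x)) *\<^sub>R (u - qF x)) = 1" by simp
      then have "dens v x \<le> norm (u - qF x) * B"
        unfolding dens_eq[OF True, symmetric] by (intro mult_left_mono B) auto
      then have "ennreal (dens v x) \<le> ennreal B * ennreal (norm (u - qF x))"
        using B(1) by (simp add: ennreal_mult[symmetric] mult.commute ennreal_leI)
      then have "hausdorff_ratio u * ennreal (dens v x) \<le> hausdorff_ratio u * (ennreal B * ennreal (norm (u - qF x)))"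
        by (rule mult_left_mono) simp
      then show ?thesis using True by (simp add: mult.left_commute)
    qed simp
  qed
  also have "\<dots> = ennreal B * (\<integral>\<^sup>+x. hausdorff_ratio u * ennreal (indicator U x *\<^sub>R norm (u - qF x)) \<partial>perp_lborel u)"
    by (rule nn_integral_cmult) measurable
  also have "(\<integral>\<^sup>+x. hausdorff_ratio u * ennreal (indicator U x *\<^sub>R norm (u - qF x)) \<partial>perp_lborel u)
      = (\<integral>\<^sup>+x. indicator U x * (hausdorff_ratio u * ennreal (norm (u - qF x))) \<partial>perp_lborel u)"
    by (intro nn_integral_cong) (auto simp: indicator_def)
  also have "ennreal B * \<dots> < top" using nn_integral_norm_normal_finite by (simp add: ennreal_mult_less_top)
  finally show ?thesis using \<kappa> by (auto simp: ennreal_mult_less_top)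
qed

lemma dens_integrable:
  assumes \<kappa>: "hausdorff_ratio u \<noteq> 0"
  shows "integrable (perp_lborel u) (\<lambda>x. indicator U x * dens v x)"
proof (rule integrableI_bounded)
  show "(\<lambda>x. indicator U x * dens v x) \<in> borel_measurable (perp_lborel u)"
    using dens_measurable by (simp cong: measurable_cong_sets)
  have "(\<integral>\<^sup>+x. ennreal (norm (indicator U x * dens v x)) \<partial>perp_lborel u)
      = (\<integral>\<^sup>+x. ennreal (indicator U x * dens v x) \<partial>perp_lborel u)"
    by (intro nn_integral_cong) (simp add: dens_nonneg abs_mult)
  then show "(\<integral>\<^sup>+x. ennreal (norm (indicator U x * dens v x)) \<partial>perp_lborel u) < \<infinity>"
    using nn_integral_dens_finite[OF \<kappa>] by simp
qed

definition half :: "real^'n \<Rightarrow> real" where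
  "half v = (LINT x|perp_lborel u. indicator U x * dens v x)"

lemma nn_integral_half:
  assumes \<kappa>: "hausdorff_ratio u \<noteq> 0"
  shows "(\<integral>\<^sup>+x. indicator U x * (hausdorff_ratio u * ennreal (norm (u - qF x)))
          * ennreal (lp_kernel v ((1 / norm (u - qF x)) *\<^sub>R (u - qF x))) \<partial>perp_lborel u)
    = hausdorff_ratio u * ennreal (half v)"
proof -
  note [measurable] = dens_measurable[of v]
  have "(\<integral>\<^sup>+x. indicator U x * (hausdorff_ratio u * ennreal (norm (u - qF x)))
          * ennreal (lp_kernel v ((1 / norm (u - qF x)) *\<^sub>R (u - qF x))) \<partial>perp_lborel u)
      = (\<integral>\<^sup>+x. hausdorff_ratio u * ennreal (indicator U x * dens v x) \<partial>perp_lborel u)"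
  proof (rule nn_integral_cong)
    fix x
    show "indicator U x * (hausdorff_ratio u * ennreal (norm (u - qF x)))
          * ennreal (lp_kernel v ((1 / norm (u - qF x)) *\<^sub>R (u - qF x)))
      = hausdorff_ratio u * ennreal (indicator U x * dens v x)"
    proof (cases "x \<in> U")
      case True
      have "ennreal (norm (u - qF x)) * ennreal (lp_kernel v ((1 / norm (u - qF x)) *\<^sub>R (u - qF x)))
          = ennreal (dens v x)"
        unfolding dens_eq[OF True, symmetric] by (rule ennreal_mult[symmetric]) (auto simp: lp_kernel_def)
      then show ?thesis using True by (simp add: mult.assoc)
    qed simp
  qed
  also have "\<dots> = hausdorff_ratio u * (\<integral>\<^sup>+x. ennreal (indicator U x * dens v x) \<partial>perp_lborel u)"
    by (rule nn_integral_cmult) measurable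
  also have "(\<integral>\<^sup>+x. ennreal (indicator U x * dens v x) \<partial>perp_lborel u) = ennreal (half v)"
    unfolding half_def by (intro nn_integral_eq_integral dens_integrable \<kappa>) (simp add: dens_nonneg)
  finally show ?thesis .
qed

lemma half_nonneg: "0 \<le> half v"
  unfolding half_def by (intro integral_nonneg_AE AE_I2) (simp add: dens_nonneg)

lemma sets_surface_area_measure:
  "sets (surface_area_measure (M :: (real^'n) set)) = sets (restrict_space borel (sphere 0 1))"
  by (simp add: surface_area_measure_def)

lemma integral_lp_kernel:
  "(LINT \<theta>|surface_area_measure M. lp_kernel v \<theta>)
    = enn2real (\<integral>\<^sup>+\<theta>. ennreal (lp_kernel v \<theta>) \<partial>surface_area_measure M)"
proof (rule integral_eq_nn_integral)
  show "lp_kernel v \<in> borel_measurable (surface_area_measure M)"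
    using measurable_restrict_space1[OF lp_kernel_measurable[of v], of "sphere 0 1"]
    by (simp cong: measurable_cong_sets add: sets_surface_area_measure measurable_cong_sets[OF sets_surface_area_measure refl])
qed (simp add: lp_kernel_def)

lemma lp_projection_support_degenerate:
  assumes \<kappa>: "hausdorff_ratio u = 0"
  shows "lp_projection_support p M v = 0"
proof -
  have "(\<lambda>\<theta>. ennreal (lp_kernel v \<theta>)) \<in> borel_measurable borel"
    using lp_kernel_measurable[of v] by measurable
  from nn_integral_surface_area_measure[OF this]
  have "(\<integral>\<^sup>+\<theta>. ennreal (lp_kernel v \<theta>) \<partial>surface_area_measure M) = 0" by (simp add: \<kappa>)
  then have "(LINT \<theta>|surface_area_measure M. lp_kernel v \<theta>) = 0" by (simp add: integral_lp_kernel)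
  then show ?thesis unfolding lp_projection_support_def Let_def lp_kernel_def by simp
qed

end

context graph_body0
begin

section \<open>Both graphs together: positivity, strictness and convexity\<close>

interpretation L: graph_body0 "- u" M K' U G F qG qF p by (rule flip0)

lemma lp_projection_support_eq:
  assumes \<kappa>: "hausdorff_ratio u \<noteq> 0"
  shows "lp_projection_support p M v =
    (1 / (real CARD('n) * unit_ball_vol (real CARD('n)) * lp_const (real CARD('n) - 2) p)
      * (enn2real (hausdorff_ratio u) * (half v + L.half v))) powr (1 / p)"
proof -
  have \<kappa>': "hausdorff_ratio (- u) = hausdorff_ratio u" using hausdorff_ratio_eq[of "- u" u] u by simp
  have "(\<lambda>\<theta>. ennreal (lp_kernel v \<theta>)) \<in> borel_measurable borel"
    using lp_kernel_measurable[of v] by measurable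
  from nn_integral_surface_area_measure[OF this]
  have "(\<integral>\<^sup>+\<theta>. ennreal (lp_kernel v \<theta>) \<partial>surface_area_measure M)
      = hausdorff_ratio u * ennreal (half v) + hausdorff_ratio u * ennreal (L.half v)"
    unfolding nn_integral_half[OF \<kappa>] using L.nn_integral_half[of v] \<kappa> unfolding \<kappa>' perp_lborel_uminus_dir by simp
  also have "\<dots> = hausdorff_ratio u * ennreal (half v + L.half v)"
    using half_nonneg L.half_nonneg by (simp add: distrib_left)
  finally have "(LINT \<theta>|surface_area_measure M. lp_kernel v \<theta>) = enn2real (hausdorff_ratio u) * (half v + L.half v)"
    unfolding integral_lp_kernel using half_nonneg[of v] L.half_nonneg[of v] by (simp add: enn2real_mult del: ennreal_plus)
  then show ?thesis unfolding lp_projection_support_def Let_def lp_kernel_def by simp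
qed

lemma L_half_eq:
  "L.half v = (LINT x|perp_lborel u. indicator U x *
    (\<bar>v \<bullet> (- u - qG x)\<bar> powr p * (G x - x \<bullet> qG x) powr (1 - p)))"
  unfolding L.half_def L.dens_def perp_lborel_uminus_dir ..

lemma zero_in_U: "0 \<in> U"
  using interior_perp_U[OF zero] by (simp add: perp_part_def)

text \<open>If all normals were orthogonal to \<open>v\<close> then \<open>F\<close> and \<open>- G\<close> would be affine with equal slope along
  the projection of \<open>v\<close>, and \<open>M\<close> would be unbounded in that direction.\<close>

lemma normals_not_orthogonal:
  assumes v: "v \<noteq> 0"
  shows "\<exists>x\<in>U. v \<bullet> (u - qF x) \<noteq> 0 \<or> v \<bullet> (- u - qG x) \<noteq> 0"
proof (rule ccontr)
  assume "\<not> ?thesis"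
  then have vF: "v \<bullet> qF x = v \<bullet> u" and vG: "v \<bullet> qG x = - (v \<bullet> u)" if "x \<in> U" for x
    using that by (force simp: inner_diff_right)+
  define v' where "v' = perp_part u v"
  have v'u: "v' \<bullet> u = 0" by (simp add: v'_def inner_perp_part[OF u])
  have v'q: "q \<bullet> v' = v \<bullet> q" if "q \<bullet> u = 0" for q
    using that by (simp add: v'_def perp_part_def inner_diff_right inner_commute)
  let ?s = "v \<bullet> u"
  \<comment> \<open>The supergradient inequalities at 0 and at \<open>r *\<^sub>R v'\<close> give
    opposite bounds with the same slope.\<close>
  have Fl: "F (r *\<^sub>R v') = F 0 + r * ?s" and Gl: "G (r *\<^sub>R v') = G 0 - r * ?s" if r: "r *\<^sub>R v' \<in> U" for r
  proof -
    have z: "0 \<in> K'" "r *\<^sub>R v' \<in> K'" using zero_in_U r U_sub by auto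
    show "F (r *\<^sub>R v') = F 0 + r * ?s"
      using sup_F[OF zero_in_U z(2)] sup_F[OF r z(1)] vF[OF zero_in_U] vF[OF r]
        v'q[OF qF_perp[OF zero_in_U]] v'q[OF qF_perp[OF r]] by simp
    show "G (r *\<^sub>R v') = G 0 - r * ?s"
      using sup_G[OF zero_in_U z(2)] sup_G[OF r z(1)] vG[OF zero_in_U] vG[OF r]
        v'q[OF qG_perp[OF zero_in_U]] v'q[OF qG_perp[OF r]] by simp
  qed
  have v'0: "v' \<noteq> 0"
  proof
    assume "v' = 0"
    then have "?s = 0" using vF[OF zero_in_U] v'q[OF qF_perp[OF zero_in_U]] by simp
    then have "v = 0" using perp_part_decomp[of u v] \<open>v' = 0\<close> by (simp add: v'_def)
    then show False using v by blast
  qed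
  define T where "T = {r. r *\<^sub>R v' \<in> U}"
  have "T = (\<lambda>r. r *\<^sub>R v') -` (perp_part u -` U)"
    unfolding T_def using v'u by (auto simp: perp_part_eq)
  moreover have "open ((\<lambda>r. r *\<^sub>R v') -` (perp_part u -` U))"
    by (intro continuous_open_vimage perp_vimage_U_open) (intro continuous_intros)
  ultimately have oT: "open T" by simp
  \<comment> \<open>While the line stays in \<open>U\<close>, the two graphs over it are parallel at
    the positive distance \<open>F 0 + G 0\<close>. A limit point therefore still lies under a
    nondegenerate fibre of \<open>M\<close>, which makes \<open>T\<close> closed as well as
    open.\<close>
  have T_eq: "T = (\<lambda>r. r *\<^sub>R v' + (F 0 + r * ?s) *\<^sub>R u) -` M \<inter> (\<lambda>r. r *\<^sub>R v' + (- G 0 + r * ?s) *\<^sub>R u) -` M"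
  proof (intro set_eqI iffI)
    fix r assume "r \<in> T"
    then have r: "r *\<^sub>R v' \<in> U" by (simp add: T_def)
    then have K: "r *\<^sub>R v' \<in> K'" using U_sub by blast
    show "r \<in> (\<lambda>r. r *\<^sub>R v' + (F 0 + r * ?s) *\<^sub>R u) -` M \<inter> (\<lambda>r. r *\<^sub>R v' + (- G 0 + r * ?s) *\<^sub>R u) -` M"
      using mem_M[OF K] Fl[OF r] Gl[OF r] pos[OF r] by simp
  next
    fix r assume r: "r \<in> (\<lambda>r. r *\<^sub>R v' + (F 0 + r * ?s) *\<^sub>R u) -` M \<inter> (\<lambda>r. r *\<^sub>R v' + (- G 0 + r * ?s) *\<^sub>R u) -` M"
    have Pr: "perp_part u (r *\<^sub>R v' + c *\<^sub>R u) = r *\<^sub>R v'" for c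
      unfolding perp_part_add_dir[OF u] by (rule perp_part_eq) (simp add: v'u)
    have K: "r *\<^sub>R v' \<in> K'" using M_decomp(1)[of "r *\<^sub>R v' + (F 0 + r * ?s) *\<^sub>R u"] r unfolding Pr by blast
    have "r *\<^sub>R v' + (F 0 + r * ?s) *\<^sub>R u \<in> M" "r *\<^sub>R v' + (- G 0 + r * ?s) *\<^sub>R u \<in> M" using r by auto
    then have "F 0 + r * ?s \<le> F (r *\<^sub>R v')" "- G (r *\<^sub>R v') \<le> - G 0 + r * ?s" unfolding mem_M[OF K] by auto
    then have "- G (r *\<^sub>R v') < F (r *\<^sub>R v')" using pos[OF zero_in_U] by linarith
    then show "r \<in> T" using flat[OF K] by (auto simp: T_def)
  qed
  have Mc: "closed M" "bounded M" using cb by (auto simp: convex_body_def compact_imp_closed compact_imp_bounded)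
  have cT: "closed T"
    unfolding T_eq by (intro closed_Int continuous_closed_vimage Mc) (intro continuous_intros)+
  have "0 \<in> T" using zero_in_U by (simp add: T_def)
  then have "T = UNIV" using clopen[of T] oT cT by auto
  then have all: "r *\<^sub>R v' \<in> U" for r by (auto simp: T_def set_eq_iff)
  obtain B where B: "\<And>y. y \<in> M \<Longrightarrow> norm y \<le> B" using Mc(2) by (auto simp: bounded_iff)
  define r where "r = (\<bar>B\<bar> + 1) / norm v'"
  have "r *\<^sub>R v' = perp_part u (graph_map u F (r *\<^sub>R v'))"
    by (rule perp_part_graph_map[OF u, symmetric]) (simp add: v'u)
  then have "norm (r *\<^sub>R v') \<le> norm (graph_map u F (r *\<^sub>R v'))" using norm_perp_part_le[OF u] by metis
  also have "\<dots> \<le> B" by (rule B[OF graph_in_M[OF all]])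
  finally show False using v'0 by (simp add: r_def)
qed

text \<open>By continuity a nonzero value persists on a relatively open part of \<open>U\<close>,
  and this has positive hyperplane measure.\<close>

lemma not_AE_of_nonzero:
  assumes g: "continuous_on U g" and x: "x \<in> U" "g x \<noteq> (0::real)"
  shows "\<not> (AE y in perp_lborel u. y \<in> U \<longrightarrow> g y = 0)"
proof
  assume AE: "AE y in perp_lborel u. y \<in> U \<longrightarrow> g y = 0"
  obtain C where C: "open C" "U = C \<inter> {x. x \<bullet> u = 0}" using U_open by blast
  have "openin (top_of_set U) (U \<inter> g -` (- {0}))"
    by (rule continuous_openin_preimage_gen[OF g]) auto
  then obtain W where W: "open W" "U \<inter> g -` (- {0}) = U \<inter> W" by (auto simp: openin_open)
  have o: "open (C \<inter> W)" using C(1) W(1) by (rule open_Int)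
  have xW: "x \<in> C \<inter> W" "x \<bullet> u = 0" using x W(2) C(2) by auto
  have "AE y in perp_lborel u. y \<notin> C \<inter> W"
    using AE AE_perp_lborel[OF u]
  proof eventually_elim
    case (elim y)
    show ?case
    proof
      assume y: "y \<in> C \<inter> W"
      then have yU: "y \<in> U" using C(2) elim by blast
      then have "y \<in> U \<inter> g -` (- {0})" using y W(2) by blast
      then show False using elim yU by blast
    qed
  qed
  then have "emeasure (perp_lborel u) (C \<inter> W) = 0"
    using o by (intro AE_iff_measurable[THEN iffD1, of "C \<inter> W" "perp_lborel u" "\<lambda>x. x \<notin> C \<inter> W"]) auto
  then show False using emeasure_perp_lborel_open_pos[OF u o xW] by simp
qed

lemma half_pos_of_nonzero:
  assumes \<kappa>: "hausdorff_ratio u \<noteq> 0" and x: "x \<in> U" "v \<bullet> (u - qF x) \<noteq> 0"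
  shows "0 < half v"
proof -
  have "half v \<noteq> 0"
  proof
    assume "half v = 0"
    then have "AE y in perp_lborel u. indicator U y * dens v y = 0"
      unfolding half_def
      by (subst (asm) integral_nonneg_eq_0_iff_AE[OF dens_integrable[OF \<kappa>]]) (auto simp: dens_nonneg)
    then have "AE y in perp_lborel u. y \<in> U \<longrightarrow> v \<bullet> (u - qF y) = 0"
    proof eventually_elim
      case (elim y)
      show ?case
      proof
        assume yU: "y \<in> U"
        then have "dens v y = 0" using elim by simp
        then show "v \<bullet> (u - qF y) = 0" using height_pos[OF yU] by (simp add: dens_def)
      qed
    qed
    moreover have "continuous_on U (\<lambda>y. v \<bullet> (u - qF y))" by (intro continuous_intros cont_qF)
    ultimately show False using not_AE_of_nonzero[of "\<lambda>y. v \<bullet> (u - qF y)"] x by blast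
  qed
  then show ?thesis using half_nonneg[of v] by simp
qed

lemma half_sum_pos:
  assumes \<kappa>: "hausdorff_ratio u \<noteq> 0" and v: "v \<noteq> 0"
  shows "0 < half v + L.half v"
proof -
  have \<kappa>': "hausdorff_ratio (- u) \<noteq> 0" using hausdorff_ratio_eq[of "- u" u] u \<kappa> by simp
  obtain x where x: "x \<in> U" "v \<bullet> (u - qF x) \<noteq> 0 \<or> v \<bullet> (- u - qG x) \<noteq> 0"
    using normals_not_orthogonal[OF v] by blast
  from x(2) show ?thesis
  proof
    assume "v \<bullet> (u - qF x) \<noteq> 0"
    then show ?thesis using half_pos_of_nonzero[OF \<kappa> x(1)] L.half_nonneg[of v] by (simp add: add_pos_nonneg)
  next
    assume "v \<bullet> (- u - qG x) \<noteq> 0"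
    then show ?thesis using graph_body0.half_pos_of_nonzero[OF flip0 \<kappa>' x(1)] half_nonneg[of v] by (simp add: add_nonneg_pos)
  qed
qed

text \<open>The product of \<open>u\<close> with \<open>u - qF x\<close> is 1, so moving
  \<open>v\<close> by \<open>c\<close> along \<open>u\<close> shifts the first argument of the
  perspective by \<open>c\<close> at every point of \<open>U\<close>, while the second stays
  fixed.\<close>

lemma half_strict:
  assumes \<kappa>: "hausdorff_ratio u \<noteq> 0" and c: "c \<noteq> 0"
  shows "half (v + (c / 2) *\<^sub>R u) < (half v + half (v + c *\<^sub>R u)) / 2"
proof -
  have strict: "dens (v + (c / 2) *\<^sub>R u) x < (dens v x + dens (v + c *\<^sub>R u) x) / 2" if x: "x \<in> U" for x
  proof -
    have uq: "u \<bullet> (u - qF x) = 1"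
      using qF_perp[OF x] unit_inner_self[OF u] by (simp add: inner_diff_right inner_commute)
    have e: "(v + s *\<^sub>R u) \<bullet> (u - qF x) = v \<bullet> (u - qF x) + s" for s
      unfolding inner_add_left inner_scaleR_left uq by simp
    let ?a = "v \<bullet> (u - qF x)"
    have m: "?a + c / 2 = (?a + (?a + c)) / 2" by (simp add: field_simps)
    have "?a \<noteq> ?a + c" using c by simp
    then show ?thesis unfolding dens_def e m by (rule perspective_strict[OF p height_pos[OF x]])
  qed
  define g where "g x = (indicator U x * dens v x + indicator U x * dens (v + c *\<^sub>R u) x) / 2
      - indicator U x * dens (v + (c / 2) *\<^sub>R u) x" for x
  have gi: "integrable (perp_lborel u) g"
    unfolding g_def using dens_integrable[OF \<kappa>, of v] dens_integrable[OF \<kappa>, of "v + c *\<^sub>R u"]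
      dens_integrable[OF \<kappa>, of "v + (c / 2) *\<^sub>R u"] by simp
  have g0: "0 \<le> g x" for x
    using strict[of x] by (cases "x \<in> U") (auto simp: g_def less_imp_le)
  have "(LINT x|perp_lborel u. g x) \<noteq> 0"
  proof
    assume "(LINT x|perp_lborel u. g x) = 0"
    then have "AE x in perp_lborel u. g x = 0"
      by (subst (asm) integral_nonneg_eq_0_iff_AE[OF gi]) (auto simp: g0)
    \<comment> \<open>A disguised form of the claim that \<open>U\<close> is a null set, shaped so
      that the lemma on continuous functions refutes it.\<close>
    then have "AE x in perp_lborel u. x \<in> U \<longrightarrow> (1::real) = 0"
    proof eventually_elim
      case (elim x)
      then show ?case using strict[of x] by (auto simp: g_def)
    qed
    then show False using not_AE_of_nonzero[of "\<lambda>_. 1" 0] zero_in_U by (simp add: continuous_on_const)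
  qed
  moreover have "0 \<le> (LINT x|perp_lborel u. g x)" by (intro integral_nonneg_AE AE_I2 g0)
  ultimately have "0 < (LINT x|perp_lborel u. g x)" by simp
  also have "(LINT x|perp_lborel u. g x) = (half v + half (v + c *\<^sub>R u)) / 2 - half (v + (c / 2) *\<^sub>R u)"
    unfolding g_def half_def using dens_integrable[OF \<kappa>] by simp
  finally show ?thesis by simp
qed

lemma half_scale: "half (c *\<^sub>R v) = \<bar>c\<bar> powr p * half v"
proof -
  have "dens (c *\<^sub>R v) x = \<bar>c\<bar> powr p * dens v x" for x
    unfolding dens_def by (simp add: abs_mult powr_mult)
  then have "indicator U x * dens (c *\<^sub>R v) x = \<bar>c\<bar> powr p * (indicator U x * dens v x)" for x
    by (simp only: mult.left_commute)
  then have "half (c *\<^sub>R v) = (LINT x|perp_lborel u. \<bar>c\<bar> powr p * (indicator U x * dens v x))"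
    unfolding half_def by (simp only:)
  also have "\<dots> = \<bar>c\<bar> powr p * half v" unfolding half_def by (rule integral_mult_right_zero)
  finally show ?thesis .
qed

lemma half_convex:
  assumes \<kappa>: "hausdorff_ratio u \<noteq> 0" and l: "0 \<le> l" "l \<le> 1"
  shows "half ((1 - l) *\<^sub>R v + l *\<^sub>R v') \<le> (1 - l) * half v + l * half v'"
proof -
  have "half ((1 - l) *\<^sub>R v + l *\<^sub>R v')
      \<le> (LINT x|perp_lborel u. (1 - l) * (indicator U x * dens v x) + l * (indicator U x * dens v' x))"
    unfolding half_def
  proof (rule integral_mono[OF dens_integrable[OF \<kappa>]])
    fix x
    show "indicator U x * dens ((1 - l) *\<^sub>R v + l *\<^sub>R v') x
        \<le> (1 - l) * (indicator U x * dens v x) + l * (indicator U x * dens v' x)"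
    proof (cases "x \<in> U")
      case True
      have b: "(1 - l) * (F x - x \<bullet> qF x) + l * (F x - x \<bullet> qF x) = F x - x \<bullet> qF x" by (simp add: algebra_simps)
      have "dens ((1 - l) *\<^sub>R v + l *\<^sub>R v') x \<le> (1 - l) * dens v x + l * dens v' x"
        using perspective_convex[OF p height_pos[OF True] height_pos[OF True] l,
            of "v \<bullet> (u - qF x)" "v' \<bullet> (u - qF x)"]
        unfolding dens_def b by (simp add: inner_add_left)
      then show ?thesis using True by simp
    qed simp
  next
    show "integrable (perp_lborel u) (\<lambda>x. (1 - l) * (indicator U x * dens v x) + l * (indicator U x * dens v' x))"
      using dens_integrable[OF \<kappa>, of v] dens_integrable[OF \<kappa>, of v'] by simp
  qed
  also have "\<dots> = (1 - l) * half v + l * half v'"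
    unfolding half_def using dens_integrable[OF \<kappa>] by simp
  finally show ?thesis .
qed

end

section \<open>Linear reflection shadow systems\<close>

definition reflect :: "'a::euclidean_space \<Rightarrow> 'a \<Rightarrow> 'a" where
  "reflect u v = v - (2 * (v \<bullet> u)) *\<^sub>R u"

lemma linear_reflect: "linear (reflect u)"
  unfolding reflect_def by (intro linearI) (simp_all add: inner_add_left algebra_simps)

context
  fixes u :: "'a::euclidean_space" assumes u: "norm u = 1"
begin

lemma reflect_add_dir: "reflect u (v + c *\<^sub>R u) = reflect u v + (- c) *\<^sub>R u"
proof -
  have "reflect u u = - u"
    unfolding reflect_def unit_inner_self[OF u] by (simp add: scaleR_2)
  then show ?thesis
    by (simp add: linear_add[OF linear_reflect] linear_scale[OF linear_reflect])
qed

lemma perp_part_reflect: "perp_part u (reflect u v) = perp_part u v"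
  using perp_part_add_dir[OF u, of v "- (2 * (v \<bullet> u))"] by (simp add: reflect_def)

lemma inner_reflect_dir: "reflect u v \<bullet> u = - (v \<bullet> u)"
  unfolding reflect_def inner_diff_left inner_scaleR_left unit_inner_self[OF u] by simp

lemma reflect_reflect: "reflect u (reflect u v) = v"
  unfolding reflect_def[of u "reflect u v"] inner_reflect_dir by (simp add: reflect_def)

lemma inner_reflect_perp:
  assumes "q \<bullet> u = 0" shows "reflect u v \<bullet> q = v \<bullet> q"
  using assms unfolding reflect_def inner_diff_left inner_scaleR_left inner_commute[of u q] by simp

lemma norm_reflect: "norm (reflect u v) = norm v"
proof -
  have "(norm (reflect u v))\<^sup>2 = (norm v)\<^sup>2"
    unfolding norm_perp_part[OF u, of "reflect u v"] norm_perp_part[OF u, of v] perp_part_reflect inner_reflect_dir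
    by simp
  then show ?thesis by simp
qed

end

section \<open>The shadow body as a body between two graphs\<close>

context smooth_strict_body
begin

text \<open>Since \<open>top_f (- u)\<close> is the negative of the lower graph function of
  \<open>K\<close>, the lower boundary of \<open>K_t\<close> is the graph of
  \<open>- shadow_top u (- t)\<close>.\<close>

definition shadow_top :: "real^'n \<Rightarrow> real \<Rightarrow> real^'n \<Rightarrow> real" where
  "shadow_top u t x = (1 + t) / 2 * top_f u x + (1 - t) / 2 * top_f (- u) x"

definition shadow_grad :: "real^'n \<Rightarrow> real \<Rightarrow> real^'n \<Rightarrow> real^'n" where
  "shadow_grad u t x = ((1 + t) / 2) *\<^sub>R top_grad u x + ((1 - t) / 2) *\<^sub>R top_grad (- u) x"

context
  fixes u :: "real^'n" assumes u: "norm u = 1"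
begin

lemma u': "norm (- u) = 1" using u by simp

lemma fibre_mem_iff:
  assumes x: "x \<in> shadow u"
  shows "x + s *\<^sub>R u \<in> K \<longleftrightarrow> - top_f (- u) x \<le> s \<and> s \<le> top_f u x"
proof
  assume "x + s *\<^sub>R u \<in> K"
  then show "- top_f (- u) x \<le> s \<and> s \<le> top_f u x"
    using top_ge[OF u, of x s] top_ge[OF u', of x "- s"] by simp
next
  assume s: "- top_f (- u) x \<le> s \<and> s \<le> top_f u x"
  have "convex {s. x + s *\<^sub>R u \<in> K}"
  proof (rule convexI)
    fix a b and k l :: real
    assume *: "a \<in> {s. x + s *\<^sub>R u \<in> K}" "b \<in> {s. x + s *\<^sub>R u \<in> K}" "0 \<le> k" "0 \<le> l" "k + l = 1"
    have "k *\<^sub>R (x + a *\<^sub>R u) + l *\<^sub>R (x + b *\<^sub>R u) \<in> K" using * by (intro convexD[OF K_convex]) auto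
    also have "k *\<^sub>R (x + a *\<^sub>R u) + l *\<^sub>R (x + b *\<^sub>R u) = (k + l) *\<^sub>R x + (k * a + l * b) *\<^sub>R u"
      by (simp add: algebra_simps)
    finally show "k *\<^sub>R a + l *\<^sub>R b \<in> {s. x + s *\<^sub>R u \<in> K}" using *(5) by simp
  qed
  then have int: "is_interval {s. x + s *\<^sub>R u \<in> K}" by (simp add: is_interval_convex_1)
  have 1: "- top_f (- u) x \<in> {s. x + s *\<^sub>R u \<in> K}"
    using top_mem[OF u', of x] x unfolding shadow_uminus by simp
  have 2: "top_f u x \<in> {s. x + s *\<^sub>R u \<in> K}" using top_mem[OF u x] by simp
  have "s \<in> {s. x + s *\<^sub>R u \<in> K}" using s by (intro mem_is_interval_1_I[OF int 1 2]) auto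
  then show "x + s *\<^sub>R u \<in> K" by simp
qed

lemma reflection_shadow_eq:
  "reflection_shadow u K t = {x + s *\<^sub>R u | x s. x \<in> shadow u \<and> - shadow_top u (- t) x \<le> s \<and> s \<le> shadow_top u t x}"
proof -
  have p: "proj_perp u K = shadow u" by (simp add: proj_perp_def shadow_def perp_part_def image_def)
  have "t / 2 * (upper_graph u K x + lower_graph u K x) - 1 / 2 * (upper_graph u K x - lower_graph u K x)
      = - shadow_top u (- t) x" for x
    by (simp add: shadow_top_def lower_graph_eq field_simps)
  moreover have "t / 2 * (upper_graph u K x + lower_graph u K x) + 1 / 2 * (upper_graph u K x - lower_graph u K x)
      = shadow_top u t x" for x
    by (simp add: shadow_top_def lower_graph_eq field_simps)
  ultimately show ?thesis unfolding reflection_shadow_def p by (simp only:)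
qed

lemma reflection_shadow_1: "reflection_shadow u K 1 = K"
proof -
  have st: "shadow_top u 1 x = top_f u x" "shadow_top u (- 1) x = top_f (- u) x" for x
    by (simp_all add: shadow_top_def)
  show ?thesis unfolding reflection_shadow_eq st
  proof (intro set_eqI iffI)
    fix y assume y: "y \<in> K"
    have "perp_part u y \<in> shadow u" using y by (simp add: shadow_def)
    moreover have "perp_part u y + (y \<bullet> u) *\<^sub>R u \<in> K" using y by (simp add: perp_part_decomp)
    ultimately show "y \<in> {x + s *\<^sub>R u | x s. x \<in> shadow u \<and> - top_f (- u) x \<le> s \<and> s \<le> top_f u x}"
      using fibre_mem_iff[of "perp_part u y" "y \<bullet> u"] perp_part_decomp[of u y, symmetric] by blast
  qed (auto simp: fibre_mem_iff)
qed

text \<open>The shadow body is a linear image of the pairs of points of \<open>K\<close> lying on a common line parallel to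
  \<open>u\<close>, hence compact and convex.\<close>

definition shadow_map :: "real \<Rightarrow> (real^'n) \<times> (real^'n) \<Rightarrow> real^'n" where
  "shadow_map t z = perp_part u (fst z) + ((1 + t) / 2 * (fst z \<bullet> u) - (1 - t) / 2 * (snd z \<bullet> u)) *\<^sub>R u"

definition fibre_pairs :: "((real^'n) \<times> (real^'n)) set" where
  "fibre_pairs = {z \<in> K \<times> K. perp_part u (fst z) = perp_part u (snd z)}"

lemma reflection_shadow_eq_image:
  assumes t: "t \<in> {-1..1}" shows "reflection_shadow u K t = shadow_map t ` fibre_pairs"
proof (intro set_eqI iffI)
  fix y assume "y \<in> reflection_shadow u K t"
  then obtain x s where x: "x \<in> shadow u" and s: "- shadow_top u (- t) x \<le> s" "s \<le> shadow_top u t x"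
    and y: "y = x + s *\<^sub>R u"
    unfolding reflection_shadow_eq by blast
  define f g where "f = top_f u x" and "g = top_f (- u) x"
  have fg: "0 \<le> f + g" using fibre_mem_iff[OF x, of f] top_mem[OF u x] by (simp add: f_def g_def)
  \<comment> \<open>The relative height of \<open>s\<close> in the fibre of the shadow body, with a
    default for a fibre that is a single point. Below, \<open>a\<close> is taken at this relative
    height above the bottom of the fibre of \<open>K\<close>, and \<open>b\<close> at the same
    distance below its top.\<close>
  define l where "l = (if f + g = 0 then 0 else (s + shadow_top u (- t) x) / (f + g))"
  have st: "shadow_top u t x + shadow_top u (- t) x = f + g"
    by (simp add: shadow_top_def f_def g_def field_simps)
  have l: "0 \<le> l" "l \<le> 1" using s fg st by (auto simp: l_def divide_le_eq_1)
  have ls: "l * (f + g) = s + shadow_top u (- t) x" using s st by (auto simp: l_def)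
  have l1: "0 \<le> l * (f + g)" "l * (f + g) \<le> f + g"
    using l fg mult_right_mono[of l 1 "f + g"] by auto
  define a b where "a = - g + l * (f + g)" and "b = f - l * (f + g)"
  have ab: "x + a *\<^sub>R u \<in> K" "x + b *\<^sub>R u \<in> K"
    unfolding fibre_mem_iff[OF x] f_def[symmetric] g_def[symmetric] using l1 by (auto simp: a_def b_def)
  have xu: "x \<bullet> u = 0" using shadow_perp[OF u x] .
  have Pc: "perp_part u (x + c *\<^sub>R u) = x" for c
    unfolding perp_part_add_dir[OF u] by (rule perp_part_eq[OF xu])
  have ic: "(x + c *\<^sub>R u) \<bullet> u = c" for c
    unfolding inner_add_left inner_scaleR_left unit_inner_self[OF u] xu by simp
  have "(1 + t) / 2 * a - (1 - t) / 2 * b = l * (f + g) - shadow_top u (- t) x"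
    by (simp add: a_def b_def shadow_top_def f_def[symmetric] g_def[symmetric] field_simps)
  then have "(1 + t) / 2 * a - (1 - t) / 2 * b = s" using ls by simp
  then have "y = shadow_map t (x + a *\<^sub>R u, x + b *\<^sub>R u)"
    unfolding shadow_map_def fst_conv snd_conv Pc ic y by simp
  moreover have "(x + a *\<^sub>R u, x + b *\<^sub>R u) \<in> fibre_pairs" using ab by (simp add: fibre_pairs_def Pc)
  ultimately show "y \<in> shadow_map t ` fibre_pairs" by blast
next
  fix y assume "y \<in> shadow_map t ` fibre_pairs"
  then obtain v w where vw: "v \<in> K" "w \<in> K" "perp_part u v = perp_part u w" and y: "y = shadow_map t (v, w)"
    by (auto simp: fibre_pairs_def)
  define x where "x = perp_part u v"
  have x: "x \<in> shadow u" using vw(1) by (simp add: x_def shadow_def)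
  have "x + (v \<bullet> u) *\<^sub>R u \<in> K" "x + (w \<bullet> u) *\<^sub>R u \<in> K"
    using vw perp_part_decomp[of u v] perp_part_decomp[of u w] by (simp_all add: x_def)
  then have a: "- top_f (- u) x \<le> v \<bullet> u" "v \<bullet> u \<le> top_f u x" and b: "- top_f (- u) x \<le> w \<bullet> u" "w \<bullet> u \<le> top_f u x"
    unfolding fibre_mem_iff[OF x] by auto
  have t2: "0 \<le> (1 + t) / 2" "0 \<le> (1 - t) / 2" using t by auto
  let ?s = "(1 + t) / 2 * (v \<bullet> u) - (1 - t) / 2 * (w \<bullet> u)"
  have "?s \<le> shadow_top u t x"
    using mult_left_mono[OF a(2) t2(1)] mult_left_mono[OF b(1) t2(2)] by (simp add: shadow_top_def)
  moreover have "- shadow_top u (- t) x \<le> ?s"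
    using mult_left_mono[OF a(1) t2(1)] mult_left_mono[OF b(2) t2(2)] by (simp add: shadow_top_def)
  moreover have "y = x + ?s *\<^sub>R u" by (simp add: y shadow_map_def x_def)
  ultimately show "y \<in> reflection_shadow u K t" unfolding reflection_shadow_eq using x by blast
qed

lemma linear_shadow_map: "linear (shadow_map t)"
  by (intro linearI)
     (simp_all add: shadow_map_def perp_part_add perp_part_scale inner_add_left algebra_simps add_divide_distrib diff_divide_distrib)

lemma fibre_pairs_compact: "compact fibre_pairs" and fibre_pairs_convex: "convex fibre_pairs"
proof -
  have eq: "fibre_pairs = (K \<times> K) \<inter> {z. perp_part u (fst z) = perp_part u (snd z)}"
    by (auto simp: fibre_pairs_def)
  have "closed {z. perp_part u (fst z) = perp_part u (snd z)}"
    by (intro closed_Collect_eq continuous_intros)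
  then show "compact fibre_pairs" unfolding eq by (intro compact_Int_closed compact_Times K_compact)
  have "convex {z. perp_part u (fst z) = perp_part u (snd z)}"
    by (intro convexI) (simp add: perp_part_add perp_part_scale)
  then show "convex fibre_pairs" unfolding eq by (intro convex_Int convex_Times K_convex)
qed

text \<open>A centred ball in \<open>K\<close> is invariant under reflection, and each
  \<open>y\<close> in it is the image of the pair formed by \<open>y\<close> and its mirror
  image.\<close>

lemma zero_interior_reflection_shadow:
  assumes t: "t \<in> {-1..1}" shows "0 \<in> interior (reflection_shadow u K t)"
proof -
  obtain r where r: "r > 0" "ball 0 r \<subseteq> K" using zero by (auto simp: mem_interior)
  have "ball 0 r \<subseteq> reflection_shadow u K t"
  proof
    fix y :: "real^'n" assume y: "y \<in> ball 0 r"
    then have "reflect u y \<in> ball 0 r" by (simp add: norm_reflect[OF u])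
    then have "(y, reflect u y) \<in> fibre_pairs" using y r(2) perp_part_reflect[OF u] by (auto simp: fibre_pairs_def)
    moreover have "shadow_map t (y, reflect u y) = y"
    proof -
      have "(1 + t) / 2 * (y \<bullet> u) - (1 - t) / 2 * (- (y \<bullet> u)) = y \<bullet> u" by (simp add: field_simps)
      then show ?thesis
        unfolding shadow_map_def fst_conv snd_conv inner_reflect_dir[OF u] by (simp add: perp_part_decomp)
    qed
    ultimately show "y \<in> reflection_shadow u K t"
      unfolding reflection_shadow_eq_image[OF t] by (metis image_eqI)
  qed
  then show ?thesis using r(1) by (auto simp: mem_interior)
qed

lemma convex_body_reflection_shadow:
  assumes t: "t \<in> {-1..1}" shows "convex_body (reflection_shadow u K t)"
proof -
  have "compact (reflection_shadow u K t)"
    unfolding reflection_shadow_eq_image[OF t]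
    by (intro compact_continuous_image fibre_pairs_compact linear_continuous_on
        linear_conv_bounded_linear[THEN iffD1] linear_shadow_map)
  moreover have "convex (reflection_shadow u K t)"
    unfolding reflection_shadow_eq_image[OF t]
    by (intro convex_linear_image linear_shadow_map fibre_pairs_convex)
  ultimately show ?thesis using zero_interior_reflection_shadow[OF t] by (auto simp: convex_body_def)
qed

lemma shadow_top_supergradient:
  assumes t: "t \<in> {-1..1}" and x: "x \<in> shadow_int u" and z: "z \<in> shadow u"
  shows "shadow_top u t z \<le> shadow_top u t x + shadow_grad u t x \<bullet> (z - x)"
proof -
  have t2: "0 \<le> (1 + t) / 2" "0 \<le> (1 - t) / 2" using t by auto
  have "top_f (- u) z \<le> top_f (- u) x + top_grad (- u) x \<bullet> (z - x)"
    using top_supergradient[OF u'] x z by (simp add: shadow_uminus)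
  from mult_left_mono[OF this t2(2)] mult_left_mono[OF top_supergradient[OF u x z] t2(1)]
  show ?thesis by (simp add: shadow_top_def shadow_grad_def inner_add_left distrib_left)
qed

lemma shadow_grad_perp: "x \<in> shadow_int u \<Longrightarrow> shadow_grad u t x \<bullet> u = 0"
  using top_grad_perp[OF u, of x] top_grad_perp[OF u', of x] by (simp add: shadow_grad_def inner_add_left shadow_uminus)

lemma shadow_top_cont: "continuous_on (shadow_int u) (shadow_top u t)"
  unfolding shadow_top_def[abs_def]
  using top_cont[OF u] top_cont[OF u'] by (intro continuous_intros) (simp_all add: shadow_uminus)

lemma shadow_grad_cont: "continuous_on (shadow_int u) (shadow_grad u t)"
  unfolding shadow_grad_def[abs_def]
  using top_grad_cont[OF u] top_grad_cont[OF u'] by (intro continuous_intros) (simp_all add: shadow_uminus)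

lemma top_sum_pos: "x \<in> shadow_int u \<Longrightarrow> 0 < top_f u x + top_f (- u) x"
proof -
  assume "x \<in> shadow_int u"
  then obtain s where s: "x + s *\<^sub>R u \<in> interior K" using shadow_int_obtain[OF u] by blast
  have "s < top_f u x" by (rule interior_lt_top[OF u s])
  moreover have "- s < top_f (- u) x" using interior_lt_top[OF u', of x "- s"] s by simp
  ultimately show ?thesis by linarith
qed

text \<open>By strict convexity a nondegenerate chord parallel to \<open>u\<close> has an interior
  midpoint, so it cannot lie over the rim of the shadow.\<close>

lemma top_sum_zero: "x \<in> shadow u \<Longrightarrow> x \<notin> shadow_int u \<Longrightarrow> top_f u x + top_f (- u) x = 0"
proof (rule ccontr)
  assume x: "x \<in> shadow u" "x \<notin> shadow_int u" and ne: "top_f u x + top_f (- u) x \<noteq> 0"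
  let ?a = "x + top_f u x *\<^sub>R u" and ?b = "x + (- top_f (- u) x) *\<^sub>R u"
  have a: "?a \<in> K" by (rule top_mem[OF u x(1)])
  have b: "?b \<in> K"
    using a unfolding fibre_mem_iff[OF x(1)] by simp
  have "?a \<noteq> ?b"
  proof
    assume "?a = ?b"
    then have "top_f u x *\<^sub>R u = (- top_f (- u) x) *\<^sub>R u" by simp
    moreover have "u \<noteq> 0" using u by auto
    ultimately have "top_f u x = - top_f (- u) x" by (metis scaleR_cancel_right)
    then show False using ne by simp
  qed
  from strict[OF a b this] have "(1/2) *\<^sub>R (?a + ?b) \<in> interior K" .
  also have "(1/2) *\<^sub>R (?a + ?b) = x + ((top_f u x - top_f (- u) x) / 2) *\<^sub>R u"
  proof -
    have "(1/2) *\<^sub>R (?a + ?b) = (1/2 + 1/2) *\<^sub>R x + ((1/2) * top_f u x + (1/2) * (- top_f (- u) x)) *\<^sub>R u"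
      by (simp only: scaleR_add_left scaleR_add_right scaleR_scaleR) (simp add: algebra_simps)
    also have "(1/2::real) + 1/2 = 1" by simp
    also have "(1/2) * top_f u x + (1/2) * (- top_f (- u) x) = (top_f u x - top_f (- u) x) / 2" by (simp add: field_simps)
    finally show ?thesis by simp
  qed
  finally have "x \<in> shadow_int u" using mem_shadow_int[OF u shadow_perp[OF u x(1)]] by blast
  then show False using x(2) by blast
qed

lemma graph_body0_reflection_shadow:
  assumes t: "t \<in> {-1..1}" and p: "1 < p"
  shows "graph_body0 u (reflection_shadow u K t) (shadow u) (shadow_int u)
    (shadow_top u t) (shadow_top u (- t)) (shadow_grad u t) (shadow_grad u (- t)) p"
proof
  have mt: "- t \<in> {-1..1}" using t by auto
  have sum: "shadow_top u t x + shadow_top u (- t) x = top_f u x + top_f (- u) x" for x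
    by (simp add: shadow_top_def field_simps)
  show "norm u = 1" by (rule u)
  show "convex_body (reflection_shadow u K t)" by (rule convex_body_reflection_shadow[OF t])
  show "reflection_shadow u K t = {x + s *\<^sub>R u | x s. x \<in> shadow u \<and> - shadow_top u (- t) x \<le> s \<and> s \<le> shadow_top u t x}"
    by (rule reflection_shadow_eq)
  show "x \<bullet> u = 0" if "x \<in> shadow u" for x by (rule shadow_perp[OF u that])
  show "shadow_int u \<subseteq> shadow u" by (rule shadow_int_sub[OF u])
  show "\<exists>C. open C \<and> shadow_int u = C \<inter> {x. x \<bullet> u = 0}" by (rule shadow_int_open[OF u])
  show "- shadow_top u (- t) x < shadow_top u t x" if "x \<in> shadow_int u" for x
    using top_sum_pos[OF that] sum[of x] by linarith
  show "- shadow_top u (- t) x = shadow_top u t x" if "x \<in> shadow u" "x \<notin> shadow_int u" for x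
    using top_sum_zero[OF that] sum[of x] by linarith
  show "shadow_top u t z \<le> shadow_top u t x + shadow_grad u t x \<bullet> (z - x)"
    and "shadow_top u (- t) z \<le> shadow_top u (- t) x + shadow_grad u (- t) x \<bullet> (z - x)"
    if "x \<in> shadow_int u" "z \<in> shadow u" for x z
    using shadow_top_supergradient[OF t that] shadow_top_supergradient[OF mt that] by auto
  show "shadow_grad u t x \<bullet> u = 0" "shadow_grad u (- t) x \<bullet> u = 0" if "x \<in> shadow_int u" for x
    by (rule shadow_grad_perp[OF that])+
  show "continuous_on (shadow_int u) (shadow_grad u t)" "continuous_on (shadow_int u) (shadow_grad u (- t))"
    by (rule shadow_grad_cont)+
  show "continuous_on (shadow_int u) (shadow_top u t)" "continuous_on (shadow_int u) (shadow_top u (- t))"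
    by (rule shadow_top_cont)+
  show "0 \<in> interior (reflection_shadow u K t)" by (rule zero_interior_reflection_shadow[OF t])
  show "1 < p" by (rule p)
qed

section \<open>The gauge of the polar body along the shadow system\<close>

context
  fixes p :: real assumes p: "1 < p"
begin

definition upper_dens :: "real \<Rightarrow> real^'n \<Rightarrow> real^'n \<Rightarrow> real" where
  "upper_dens t v x = \<bar>v \<bullet> (u - shadow_grad u t x)\<bar> powr p * (shadow_top u t x - x \<bullet> shadow_grad u t x) powr (1 - p)"

definition upper_part :: "real \<Rightarrow> real^'n \<Rightarrow> real" where
  "upper_part t v = (LINT x|perp_lborel u. indicator (shadow_int u) x * upper_dens t v x)"

lemmas gb = graph_body0_reflection_shadow[OF _ p]

lemma half_eq_upper_part:
  assumes t: "t \<in> {-1..1}"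
  shows "graph_body0.half u (shadow_int u) (shadow_top u t) (shadow_grad u t) p = upper_part t"
proof
  fix v
  interpret graph_body0 u "reflection_shadow u K t" "shadow u" "shadow_int u"
    "shadow_top u t" "shadow_top u (- t)" "shadow_grad u t" "shadow_grad u (- t)" p by (rule gb[OF t])
  show "half v = upper_part t v" unfolding half_def dens_def upper_part_def upper_dens_def ..
qed

text \<open>Reflecting \<open>v\<close> turns its product with the lower normal
  \<open>- u - q\<close> into the product with the upper normal \<open>u - q\<close>. Thus the
  single function \<open>upper_part\<close> governs both halves.\<close>

lemma flip_half_eq_upper_part:
  assumes t: "t \<in> {-1..1}"
  shows "graph_body0.half (- u) (shadow_int u) (shadow_top u (- t)) (shadow_grad u (- t)) p v
    = upper_part (- t) (reflect u v)"
proof -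
  interpret graph_body0 u "reflection_shadow u K t" "shadow u" "shadow_int u"
    "shadow_top u t" "shadow_top u (- t)" "shadow_grad u t" "shadow_grad u (- t)" p by (rule gb[OF t])
  have eq: "\<bar>v \<bullet> (- u - shadow_grad u (- t) x)\<bar> = \<bar>reflect u v \<bullet> (u - shadow_grad u (- t) x)\<bar>"
    if "x \<in> shadow_int u" for x
    unfolding inner_diff_right inner_reflect_dir[OF u] inner_reflect_perp[OF u shadow_grad_perp[OF that]]
    by simp
  show ?thesis
    unfolding L_half_eq upper_part_def upper_dens_def
    by (intro Bochner_Integration.integral_cong refl) (auto simp: indicator_def eq)
qed

lemma upper_height_pos:
  assumes t: "t \<in> {-1..1}" and x: "x \<in> shadow_int u"
  shows "0 < shadow_top u t x - x \<bullet> shadow_grad u t x"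
  by (rule graph_body0.height_pos[OF gb[OF t] x])

text \<open>Both arguments of the perspective are affine in \<open>l\<close>. For the first this
  rests on \<open>v\<close> and \<open>v'\<close> having the same part orthogonal to
  \<open>u\<close>; otherwise the product with the gradient would be quadratic in
  \<open>l\<close>.\<close>

lemma upper_dens_joint:
  assumes t: "t \<in> {-1..1}" "t' \<in> {-1..1}" and l: "0 \<le> l" "l \<le> 1" and P: "perp_part u v = perp_part u v'"
    and x: "x \<in> shadow_int u"
  shows "upper_dens ((1 - l) * t + l * t') ((1 - l) *\<^sub>R v + l *\<^sub>R v') x \<le> (1 - l) * upper_dens t v x + l * upper_dens t' v' x"
proof -
  let ?t = "(1 - l) * t + l * t'" and ?v = "(1 - l) *\<^sub>R v + l *\<^sub>R v'"
  have top: "shadow_top u ?t x = (1 - l) * shadow_top u t x + l * shadow_top u t' x"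
    by (simp add: shadow_top_def field_simps)
  have c1: "(1 + ?t) / 2 = (1 - l) * ((1 + t) / 2) + l * ((1 + t') / 2)"
    and c2: "(1 - ?t) / 2 = (1 - l) * ((1 - t) / 2) + l * ((1 - t') / 2)" by (simp_all add: field_simps)
  have grad: "shadow_grad u ?t x = (1 - l) *\<^sub>R shadow_grad u t x + l *\<^sub>R shadow_grad u t' x"
    unfolding shadow_grad_def c1 c2 by (simp only: scaleR_add_left scaleR_add_right scaleR_scaleR add_ac)
  have b: "shadow_top u ?t x - x \<bullet> shadow_grad u ?t x
      = (1 - l) * (shadow_top u t x - x \<bullet> shadow_grad u t x) + l * (shadow_top u t' x - x \<bullet> shadow_grad u t' x)"
    unfolding top grad by (simp add: inner_add_right algebra_simps)
  have vq: "v \<bullet> shadow_grad u s x = v' \<bullet> shadow_grad u s x" for s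
  proof -
    have "z \<bullet> shadow_grad u s x = perp_part u z \<bullet> shadow_grad u s x" for z
      using shadow_grad_perp[OF x, of s]
      unfolding perp_part_def inner_diff_left inner_scaleR_left inner_commute[of u "shadow_grad u s x"] by simp
    then show ?thesis using P by metis
  qed
  have a: "?v \<bullet> (u - shadow_grad u ?t x)
      = (1 - l) * (v \<bullet> (u - shadow_grad u t x)) + l * (v' \<bullet> (u - shadow_grad u t' x))"
  proof -
    have "?v \<bullet> shadow_grad u ?t x = v \<bullet> shadow_grad u ?t x"
      unfolding inner_add_left inner_scaleR_left vq[symmetric] by (simp add: algebra_simps)
    also have "\<dots> = (1 - l) * (v \<bullet> shadow_grad u t x) + l * (v' \<bullet> shadow_grad u t' x)"
      unfolding grad inner_add_right inner_scaleR_right vq[symmetric] ..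
    finally have "?v \<bullet> shadow_grad u ?t x = (1 - l) * (v \<bullet> shadow_grad u t x) + l * (v' \<bullet> shadow_grad u t' x)" .
    then show ?thesis unfolding inner_diff_right inner_add_left inner_scaleR_left by (simp add: algebra_simps)
  qed
  show ?thesis unfolding upper_dens_def a b
    by (rule perspective_convex[OF p upper_height_pos[OF t(1) x] upper_height_pos[OF t(2) x] l])
qed

context
  assumes \<kappa>: "hausdorff_ratio u \<noteq> 0"
begin

lemma upper_integrable:
  assumes t: "t \<in> {-1..1}"
  shows "integrable (perp_lborel u) (\<lambda>x. indicator (shadow_int u) x * upper_dens t v x)"
proof -
  interpret graph_body0 u "reflection_shadow u K t" "shadow u" "shadow_int u"
    "shadow_top u t" "shadow_top u (- t)" "shadow_grad u t" "shadow_grad u (- t)" p by (rule gb[OF t])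
  show ?thesis using dens_integrable[OF \<kappa>, of v] unfolding dens_def upper_dens_def .
qed

lemma upper_part_joint:
  assumes t: "t \<in> {-1..1}" "t' \<in> {-1..1}" and l: "0 \<le> l" "l \<le> 1" and P: "perp_part u v = perp_part u v'"
  shows "upper_part ((1 - l) * t + l * t') ((1 - l) *\<^sub>R v + l *\<^sub>R v') \<le> (1 - l) * upper_part t v + l * upper_part t' v'"
proof -
  let ?t = "(1 - l) * t + l * t'" and ?v = "(1 - l) *\<^sub>R v + l *\<^sub>R v'"
  have tt: "?t \<in> {-1..1}"
    using convexD[OF convex_real_interval(5), of t "-1" 1 t' "1 - l" l] t l by simp
  note i = upper_integrable[OF t(1), of v] upper_integrable[OF t(2), of v']
  have "upper_part ?t ?v \<le> (LINT x|perp_lborel u. (1 - l) * (indicator (shadow_int u) x * upper_dens t v x)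
      + l * (indicator (shadow_int u) x * upper_dens t' v' x))"
    unfolding upper_part_def
  proof (rule integral_mono[OF upper_integrable[OF tt]])
    fix x
    show "indicator (shadow_int u) x * upper_dens ?t ?v x
        \<le> (1 - l) * (indicator (shadow_int u) x * upper_dens t v x) + l * (indicator (shadow_int u) x * upper_dens t' v' x)"
      using upper_dens_joint[OF t l P, of x] by (cases "x \<in> shadow_int u") auto
  next
    show "integrable (perp_lborel u) (\<lambda>x. (1 - l) * (indicator (shadow_int u) x * upper_dens t v x)
      + l * (indicator (shadow_int u) x * upper_dens t' v' x))" using i by simp
  qed
  also have "\<dots> = (1 - l) * upper_part t v + l * upper_part t' v'"
    unfolding upper_part_def using i by simp
  finally show ?thesis .
qed

definition lp_factor :: real where
  "lp_factor = 1 / (real CARD('n) * unit_ball_vol (real CARD('n)) * lp_const (real CARD('n) - 2) p)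
      * enn2real (hausdorff_ratio u)"

text \<open>The \<open>p\<close>-th power of the support function of the projection body of
  \<open>K_t\<close>, written so that changing \<open>t\<close> into \<open>- t\<close> and
  reflecting \<open>v\<close> visibly swaps the two terms.\<close>

definition lp_gauge :: "real \<Rightarrow> real^'n \<Rightarrow> real" where
  "lp_gauge t v = lp_factor * (upper_part t v + upper_part (- t) (reflect u v))"

lemma lp_projection_support_shadow:
  assumes t: "t \<in> {-1..1}"
  shows "lp_projection_support p (reflection_shadow u K t) v = lp_gauge t v powr (1 / p)"
proof -
  interpret graph_body0 u "reflection_shadow u K t" "shadow u" "shadow_int u"
    "shadow_top u t" "shadow_top u (- t)" "shadow_grad u t" "shadow_grad u (- t)" p by (rule gb[OF t])
  show ?thesis
    unfolding lp_projection_support_eq[OF \<kappa>] half_eq_upper_part[OF t] flip_half_eq_upper_part[OF t]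
      lp_gauge_def lp_factor_def by (simp add: mult.assoc)
qed

text \<open>\<open>unit_ball_vol\<close> is positive at nonnegative arguments;
  \<open>2 \<le> CARD('n)\<close> serves the argument \<open>n - 2\<close>, and \<open>1 < p\<close>
  the argument \<open>p - 1\<close>.\<close>

lemma lp_factor_pos:
  assumes n: "2 \<le> CARD('n)" shows "0 < lp_factor"
proof -
  have "0 < hausdorff_ratio u" "hausdorff_ratio u < top" using \<kappa> hausdorff_ratio_finite[OF u] by (auto simp: zero_less_iff_neq_zero)
  then have "0 < enn2real (hausdorff_ratio u)" by (simp add: enn2real_positive_iff)
  moreover have "0 < lp_const (real CARD('n) - 2) p"
    unfolding lp_const_def using n p by (intro divide_pos_pos mult_pos_pos unit_ball_vol_pos) auto
  moreover have "0 < unit_ball_vol (real CARD('n))" by simp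
  moreover have "0 < real CARD('n)" using n by simp
  ultimately show ?thesis unfolding lp_factor_def by (intro mult_pos_pos divide_pos_pos) auto
qed

lemma fiber_family_lp_gauge:
  assumes n: "2 \<le> CARD('n)" shows "fiber_family lp_gauge u p"
proof
  note cpos = lp_factor_pos[OF n]
  have mt: "- t \<in> {-1..1}" if "t \<in> {-1..1}" for t :: real using that by auto
  show "norm u = 1" by (rule u)
  show "0 < p" using p by simp
  fix t :: real assume t: "t \<in> {-1..1}"
  show "0 < lp_gauge t v" if "v \<noteq> 0" for v
    using graph_body0.half_sum_pos[OF gb[OF t] \<kappa> that] cpos
    unfolding half_eq_upper_part[OF t] flip_half_eq_upper_part[OF t] lp_gauge_def by simp
  have scale: "upper_part s (c *\<^sub>R v) = \<bar>c\<bar> powr p * upper_part s v" if "s \<in> {-1..1}" for s c v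
    using graph_body0.half_scale[OF gb[OF that], of c v] unfolding half_eq_upper_part[OF that] .
  show "lp_gauge t (c *\<^sub>R v) = \<bar>c\<bar> powr p * lp_gauge t v" for c v
    unfolding lp_gauge_def linear_scale[OF linear_reflect] scale[OF t] scale[OF mt[OF t]] by (simp add: algebra_simps)
  have conv: "upper_part s ((1 - l) *\<^sub>R v + l *\<^sub>R v') \<le> (1 - l) * upper_part s v + l * upper_part s v'"
    if "s \<in> {-1..1}" "0 \<le> l" "l \<le> 1" for s l v v'
    using graph_body0.half_convex[OF gb[OF that(1)] \<kappa> that(2,3), of v v'] unfolding half_eq_upper_part[OF that(1)] .
  have lin: "reflect u ((1 - l) *\<^sub>R v + l *\<^sub>R v') = (1 - l) *\<^sub>R reflect u v + l *\<^sub>R reflect u v'" for l v v'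
    by (simp add: linear_add[OF linear_reflect] linear_scale[OF linear_reflect])
  show "convex_on UNIV (lp_gauge t)"
  proof (rule convex_onI)
    fix l :: real and v v' :: "real^'n" assume l: "0 < l" "l < 1"
    have "upper_part t ((1 - l) *\<^sub>R v + l *\<^sub>R v') + upper_part (- t) (reflect u ((1 - l) *\<^sub>R v + l *\<^sub>R v'))
        \<le> ((1 - l) * upper_part t v + l * upper_part t v')
          + ((1 - l) * upper_part (- t) (reflect u v) + l * upper_part (- t) (reflect u v'))"
      unfolding lin using l by (intro add_mono conv t mt) auto
    from mult_left_mono[OF this, of lp_factor]
    show "lp_gauge t ((1 - l) *\<^sub>R v + l *\<^sub>R v') \<le> (1 - l) * lp_gauge t v + l * lp_gauge t v'"
      unfolding lp_gauge_def using cpos by (simp add: algebra_simps)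
  qed simp
  show "lp_gauge (- t) v = lp_gauge t (v - (2 * (v \<bullet> u)) *\<^sub>R u)" for v
    unfolding reflect_def[symmetric] lp_gauge_def reflect_reflect[OF u] by (simp add: add.commute)
  have strict: "upper_part s (v + (c / 2) *\<^sub>R u) < (upper_part s v + upper_part s (v + c *\<^sub>R u)) / 2"
    if "s \<in> {-1..1}" "c \<noteq> 0" for s c v
    using graph_body0.half_strict[OF gb[OF that(1)] \<kappa> that(2), of v] unfolding half_eq_upper_part[OF that(1)] .
  show "lp_gauge t (v + (c / 2) *\<^sub>R u) < (lp_gauge t v + lp_gauge t (v + c *\<^sub>R u)) / 2" if c: "c \<noteq> 0" for v c
  proof -
    have "upper_part t (v + (c / 2) *\<^sub>R u) + upper_part (- t) (reflect u v + (- c / 2) *\<^sub>R u)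
        < (upper_part t v + upper_part t (v + c *\<^sub>R u)) / 2
          + (upper_part (- t) (reflect u v) + upper_part (- t) (reflect u v + (- c) *\<^sub>R u)) / 2"
      using c by (intro add_strict_mono strict t mt) auto
    from mult_strict_left_mono[OF this cpos]
    show ?thesis unfolding lp_gauge_def reflect_add_dir[OF u] by (simp add: algebra_simps add_divide_distrib)
  qed
  show "lp_gauge ((1 - l) * t + l * t') ((1 - l) *\<^sub>R v + l *\<^sub>R v') \<le> (1 - l) * lp_gauge t v + l * lp_gauge t' v'"
    if t': "t' \<in> {-1..1}" and P: "perp_part u v = perp_part u v'" and l: "0 \<le> l" "l \<le> 1" for t' v v' l
  proof -
    have mm: "- ((1 - l) * t + l * t') = (1 - l) * (- t) + l * (- t')" by (simp add: algebra_simps)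
    have "upper_part ((1 - l) * t + l * t') ((1 - l) *\<^sub>R v + l *\<^sub>R v')
          + upper_part (- ((1 - l) * t + l * t')) (reflect u ((1 - l) *\<^sub>R v + l *\<^sub>R v'))
        \<le> ((1 - l) * upper_part t v + l * upper_part t' v')
          + ((1 - l) * upper_part (- t) (reflect u v) + l * upper_part (- t') (reflect u v'))"
      unfolding lin mm using P by (intro add_mono upper_part_joint t t' l mt) (simp_all add: perp_part_reflect[OF u])
    from mult_left_mono[OF this, of lp_factor]
    show ?thesis unfolding lp_gauge_def using cpos by (simp add: algebra_simps)
  qed
qed

lemma polar_body_shadow:
  assumes n: "2 \<le> CARD('n)" and t: "t \<in> {-1..1}"
  shows "polar_body (lp_projection_body p (reflection_shadow u K t)) = {v. lp_gauge t v \<le> 1}"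
proof -
  interpret fiber_family lp_gauge u p by (rule fiber_family_lp_gauge[OF n])
  show ?thesis
    using w_pos[OF t] w_scale[OF t] w_convex[OF t]
    by (intro polar_lp_projection_body_eq[OF \<open>1 < p\<close> lp_projection_support_shadow[OF t]]) auto
qed

lemma volume_constant_nondegenerate:
  assumes n: "2 \<le> CARD('n)"
    and lim: "((\<lambda>t. (measure lebesgue (polar_body (lp_projection_body p (reflection_shadow u K t)))
               - measure lebesgue (polar_body (lp_projection_body p K))) / (t - 1)) \<longlongrightarrow> 0) (at_left 1)"
  shows "(\<lambda>t. measure lebesgue (polar_body (lp_projection_body p (reflection_shadow u K t)))) constant_on {-1..1}"
proof -
  interpret fiber_family lp_gauge u p by (rule fiber_family_lp_gauge[OF n])
  have V: "measure lebesgue (polar_body (lp_projection_body p (reflection_shadow u K t))) = V t"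
    if "t \<in> {-1..1}" for t
    unfolding polar_body_shadow[OF n that] V_def B_def ..
  have V1: "measure lebesgue (polar_body (lp_projection_body p K)) = V 1"
    using V[of 1] by (simp add: reflection_shadow_1)
  have "\<forall>\<^sub>F t in at_left (1::real). 0 < t \<and> t < 1"
    using eventually_at_left[of 0 "1::real"] by (auto intro!: exI[of _ 0])
  then have "\<forall>\<^sub>F t in at_left (1::real). (measure lebesgue (polar_body (lp_projection_body p (reflection_shadow u K t)))
               - measure lebesgue (polar_body (lp_projection_body p K))) / (t - 1) = (V t - V 1) / (t - 1)"
    by eventually_elim (simp add: V V1)
  then have "((\<lambda>t. (V t - V 1) / (t - 1)) \<longlongrightarrow> 0) (at_left 1)"
    using lim by (rule tendsto_cong[THEN iffD1])
  from V_constant[OF this] show ?thesis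
    unfolding constant_on_def by (intro exI[of _ "V 1"] ballI) (simp only: V)
qed

end

text \<open>All support functions are then 0, so the definite description is literally the same term
  for every \<open>t\<close>, whatever it denotes.\<close>

lemma volume_constant_degenerate:
  assumes \<kappa>: "hausdorff_ratio u = 0"
  shows "(\<lambda>t. measure lebesgue (polar_body (lp_projection_body p (reflection_shadow u K t)))) constant_on {-1..1}"
proof -
  have "lp_projection_body p (reflection_shadow u K t) = (THE L. convex_body L \<and> (\<forall>v::real^'n. support_fun L v = 0))"
    if t: "t \<in> {-1..1}" for t
    unfolding lp_projection_body_def graph_body0.lp_projection_support_degenerate[OF gb[OF t] \<kappa>] ..
  then show ?thesis unfolding constant_on_def by auto
qed

end

end

end

theorem lemma7p6:
  fixes K :: "(real^'n) set" and u :: "real^'n" and p :: real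
  assumes "CARD('n) \<ge> 2" and "p > 1"
    and "convex_body K" and "origin_symmetric K" and "class_C2_plus K"
    and "u \<in> sphere 0 1"
    and "((\<lambda>t. (measure lebesgue (polar_body (lp_projection_body p (reflection_shadow u K t)))
               - measure lebesgue (polar_body (lp_projection_body p K))) / (t - 1))
          \<longlongrightarrow> 0) (at_left 1)"
  shows "(\<lambda>t. measure lebesgue (polar_body (lp_projection_body p (reflection_shadow u K t))))
           constant_on {-1..1}"
proof -
  interpret smooth_strict_body K by (rule smooth_strict_body_of_class_C2_plus[OF assms(3-5)])
  have u: "norm u = 1" using assms(6) by simp
  show ?thesis
    using volume_constant_degenerate[OF u assms(2)] volume_constant_nondegenerate[OF u assms(2) _ assms(1,7)]
    by blast
qed

end
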